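(* For the generic $f\in C(\lambda)$ (that is, for all $f$ in a comeager subset of $C(\lambda)$), the permuton $\mu=\mu_f$ satisfies $$\liminf_{n\to\infty}\frac{H_n(\mu)}{n}=0\qquad\text{and}\qquad \limsup_{n\to\infty}\frac{H_n(\mu)}{n\log n}=1.$$
   Context: $C(\lambda)$ is the space of continuous maps $f:[0,1]\to[0,1]$ preserving the Lebesgue measure $\lambda$, equipped with the supremum metric (a complete metric space). A permuton is a Borel probability measure on $[0,1]^2$ with uniform marginals. For a Lebesgue-measure-preserving map $f$, the permuton $\mu_f$ is defined by $\mu_f(A\times B)=\lambda(A\cap f^{-1}(B))$. For a permuton $\mu$ and $n\ge 1$, draw $n$ i.i.d. points from $\mu$ and read the relative order of their heights from left to right; this gives a random permutation whose distribution on $\mathrm{Sym}(n)$ is denoted $\mu^{(n)}$, and $H_n(\mu)$ is the Shannon entropy of $\mu^{(n)}$ (natural logarithm). *)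

theory Defs
  imports "HOL-Probability.Probability" "HOL-Combinatorics.Permutations"
begin

definition nowhere_dense_in :: "'a topology \<Rightarrow> 'a set \<Rightarrow> bool" where
  "nowhere_dense_in X S \<longleftrightarrow> S \<subseteq> topspace X \<and> X interior_of (X closure_of S) = {}"

definition meager_in :: "'a topology \<Rightarrow> 'a set \<Rightarrow> bool" where
  "meager_in X S \<longleftrightarrow> (\<exists>\<N>. countable \<N> \<and> (\<forall>N\<in>\<N>. nowhere_dense_in X N) \<and> S = \<Union>\<N>)"

definition comeager_in :: "'a topology \<Rightarrow> 'a set \<Rightarrow> bool" where
  "comeager_in X S \<longleftrightarrow> S \<subseteq> topspace X \<and> meager_in X (topspace X - S)"

definition unit_lebesgue :: "real measure" where
  "unit_lebesgue = restrict_space lborel {0..1}"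

text \<open>The points of \<open>C_lambda\<close> are extensional functions (\<open>undefined\<close> off the unit interval),
  as required by \<^const>\<open>cfunspace\<close>, whose distance is the supremum distance.\<close>

definition C_lambda :: "(real \<Rightarrow> real) metric" where
  "C_lambda = submetric (cfunspace (top_of_set {0..1}) (submetric euclidean_metric {0..1}))
     {f. f \<in> unit_lebesgue \<rightarrow>\<^sub>M unit_lebesgue \<and> distr unit_lebesgue unit_lebesgue f = unit_lebesgue}"

definition permuton :: "(real \<times> real) measure \<Rightarrow> bool" where
  "permuton \<mu> \<longleftrightarrow> prob_space \<mu> \<and> sets \<mu> = sets (restrict_space borel ({0..1} \<times> {0..1})) \<and>
     distr \<mu> unit_lebesgue fst = unit_lebesgue \<and> distr \<mu> unit_lebesgue snd = unit_lebesgue"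

text \<open>The permuton of a measure-preserving map is the push-forward of Lebesgue measure to the graph.
  Its values on rectangles, which determine it, are given by \<open>emeasure_map_permuton\<close> and \<open>map_permuton_unique\<close> below.\<close>

definition map_permuton :: "(real \<Rightarrow> real) \<Rightarrow> (real \<times> real) measure" where
  "map_permuton f = distr unit_lebesgue (restrict_space borel ({0..1} \<times> {0..1})) (\<lambda>x. (x, f x))"

text \<open>Ties are broken by the index, so that ranks form a permutation for every sample; for samples
  from a permuton, ties have probability zero.\<close>

definition sample_rank :: "nat \<Rightarrow> (nat \<Rightarrow> real) \<Rightarrow> nat \<Rightarrow> nat" where
  "sample_rank n z i = card {j \<in> {1..n}. z j < z i \<or> z j = z i \<and> j \<le> i}"

text \<open>The value at \<open>k\<close> is the rank of the height of the \<open>k\<close>-th point from the left.\<close>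

definition pattern :: "nat \<Rightarrow> (nat \<Rightarrow> real \<times> real) \<Rightarrow> nat \<Rightarrow> nat" where
  "pattern n \<omega> k = (if k \<in> {1..n}
     then sample_rank n (snd \<circ> \<omega>) (inv_into {1..n} (sample_rank n (fst \<circ> \<omega>)) k) else k)"

definition pattern_measure :: "(real \<times> real) measure \<Rightarrow> nat \<Rightarrow> (nat \<Rightarrow> nat) measure" where
  "pattern_measure \<mu> n =
     distr (\<Pi>\<^sub>M i\<in>{1..n}. \<mu>) (count_space {\<pi>. \<pi> permutes {1..n}}) (pattern n)"

definition permuton_entropy :: "nat \<Rightarrow> (real \<times> real) measure \<Rightarrow> real" where
  "permuton_entropy n \<mu> = prob_space.entropy (pattern_measure \<mu> n) (exp 1)
     (count_space {\<pi>. \<pi> permutes {1..n}}) (\<lambda>\<pi>. \<pi>)"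

lemma prob_space_unit_lebesgue: "prob_space unit_lebesgue"
  by (rule prob_spaceI)
    (simp add: unit_lebesgue_def space_restrict_space emeasure_restrict_space)

lemma space_unit_lebesgue [simp]: "space unit_lebesgue = {0..1}"
  by (simp add: unit_lebesgue_def space_restrict_space)

lemma mspace_C_lambdaD:
  assumes "f \<in> mspace C_lambda"
  shows "f \<in> unit_lebesgue \<rightarrow>\<^sub>M unit_lebesgue" "distr unit_lebesgue unit_lebesgue f = unit_lebesgue"
  using assms by (auto simp: C_lambda_def)

lemma sets_unit_lebesgue: "sets unit_lebesgue = sets (restrict_space borel {0..1})"
  unfolding unit_lebesgue_def by (rule sets_restrict_space_cong) simp

lemma measurable_graph:
  assumes "f \<in> unit_lebesgue \<rightarrow>\<^sub>M unit_lebesgue"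
  shows "(\<lambda>x. (x, f x)) \<in> unit_lebesgue \<rightarrow>\<^sub>M restrict_space borel ({0..1} \<times> {0..1})"
proof (rule measurable_restrict_space2)
  show "(\<lambda>x. (x, f x)) \<in> space unit_lebesgue \<rightarrow> {0..1} \<times> {0..1}"
    using measurable_space[OF assms] by auto
  have [measurable]: "f \<in> borel_measurable unit_lebesgue"
    using assms unfolding measurable_cong_sets[OF refl sets_unit_lebesgue]
    by (simp add: measurable_restrict_space2_iff)
  have [measurable]: "(\<lambda>x. x) \<in> borel_measurable unit_lebesgue"
    unfolding measurable_cong_sets[OF sets_unit_lebesgue refl]
    by (simp add: measurable_restrict_space1)
  show "(\<lambda>x. (x, f x)) \<in> borel_measurable unit_lebesgue"
    by measurable
qed

lemma Times_sets_square:
  assumes "A \<in> sets unit_lebesgue" "B \<in> sets unit_lebesgue"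
  shows "A \<times> B \<in> sets (restrict_space borel ({0..1::real} \<times> {0..1::real}))"
proof -
  have "{0..1::real} \<times> {0..1::real} \<in> sets borel"
    by (intro borel_closed closed_Times) auto
  moreover from assms have "A \<in> sets borel" "A \<subseteq> {0..1}" "B \<in> sets borel" "B \<subseteq> {0..1}"
    by (auto simp: sets_unit_lebesgue sets_restrict_space_iff)
  ultimately show ?thesis
    by (subst sets_restrict_space_iff) (auto simp: borel_Times)
qed

lemma emeasure_map_permuton:
  assumes f: "f \<in> unit_lebesgue \<rightarrow>\<^sub>M unit_lebesgue"
    and A: "A \<in> sets unit_lebesgue" and B: "B \<in> sets unit_lebesgue"
  shows "emeasure (map_permuton f) (A \<times> B) = emeasure unit_lebesgue (A \<inter> f -` B)"
proof -
  have "(\<lambda>x. (x, f x)) -` (A \<times> B) \<inter> space unit_lebesgue = A \<inter> f -` B"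
    using sets.sets_into_space[OF A] by auto
  then show ?thesis
    unfolding map_permuton_def
    by (subst emeasure_distr[OF measurable_graph[OF f] Times_sets_square[OF A B]]) simp
qed

lemma sets_square_eq_pair:
  "sets (restrict_space borel ({0..1::real} \<times> {0..1::real})) = sets (unit_lebesgue \<Otimes>\<^sub>M unit_lebesgue)"
proof
  let ?S = "restrict_space borel ({0..1::real} \<times> {0..1::real})"
  show "sets (unit_lebesgue \<Otimes>\<^sub>M unit_lebesgue) \<subseteq> sets ?S"
  proof -
    have "sigma_sets (space ?S) {a \<times> b | a b. a \<in> sets unit_lebesgue \<and> b \<in> sets unit_lebesgue} \<subseteq> sets ?S"
      using Times_sets_square by (intro sets.sigma_sets_subset) blast
    then show ?thesis
      by (simp add: sets_pair_measure space_restrict_space)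
  qed
  have l: "(\<lambda>x. x) \<in> borel_measurable unit_lebesgue"
    unfolding measurable_cong_sets[OF sets_unit_lebesgue refl]
    by (simp add: measurable_restrict_space1)
  have "(\<lambda>x. (fst x, snd x)) \<in> borel_measurable (unit_lebesgue \<Otimes>\<^sub>M unit_lebesgue)"
    by (intro borel_measurable_Pair measurable_compose[OF measurable_fst l]
        measurable_compose[OF measurable_snd l])
  then have "(\<lambda>x. x) \<in> (unit_lebesgue \<Otimes>\<^sub>M unit_lebesgue) \<rightarrow>\<^sub>M ?S"
    by (intro measurable_restrict_space2) (auto simp: space_pair_measure)
  note id = this
  show "sets ?S \<subseteq> sets (unit_lebesgue \<Otimes>\<^sub>M unit_lebesgue)"
  proof
    fix X assume X: "X \<in> sets ?S"
    then have "X \<subseteq> space (unit_lebesgue \<Otimes>\<^sub>M unit_lebesgue)"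
      using sets.sets_into_space[OF X] by (simp add: space_pair_measure space_restrict_space)
    then show "X \<in> sets (unit_lebesgue \<Otimes>\<^sub>M unit_lebesgue)"
      using measurable_sets[OF id X] by (simp add: Int_absorb2)
  qed
qed

lemma map_permuton_unique:
  assumes f: "f \<in> unit_lebesgue \<rightarrow>\<^sub>M unit_lebesgue"
    and sets: "sets \<mu> = sets (restrict_space borel ({0..1} \<times> {0..1}))"
    and rect: "\<And>A B. A \<in> sets unit_lebesgue \<Longrightarrow> B \<in> sets unit_lebesgue \<Longrightarrow>
      emeasure \<mu> (A \<times> B) = emeasure unit_lebesgue (A \<inter> f -` B)"
  shows "\<mu> = map_permuton f"
proof (rule measure_eqI_generator_eq[OF Int_stable_pair_measure_generator pair_measure_closed])
  let ?E = "{a \<times> b | a b. a \<in> sets unit_lebesgue \<and> b \<in> sets unit_lebesgue}"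
  show "emeasure \<mu> X = emeasure (map_permuton f) X" if "X \<in> ?E" for X
    using that by (auto simp: rect emeasure_map_permuton[OF f])
  show "sets \<mu> = sigma_sets (space unit_lebesgue \<times> space unit_lebesgue) ?E"
    "sets (map_permuton f) = sigma_sets (space unit_lebesgue \<times> space unit_lebesgue) ?E"
    using sets sets_square_eq_pair by (simp_all add: map_permuton_def sets_pair_measure)
  show "range (\<lambda>_::nat. space unit_lebesgue \<times> space unit_lebesgue) \<subseteq> ?E"
    by blast
  show "emeasure \<mu> (space unit_lebesgue \<times> space unit_lebesgue) \<noteq> \<infinity>"
    using rect[OF sets.top sets.top] prob_space_unit_lebesgue
    by (simp add: finite_measure.emeasure_finite prob_space_def)
qed simp

lemma permuton_map_permuton:
  assumes "f \<in> mspace C_lambda"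
  shows "permuton (map_permuton f)"
proof -
  note f = mspace_C_lambdaD[OF assms]
  let ?S = "restrict_space borel ({0..1::real} \<times> {0..1::real})"
  have S: "space ?S = {0..1} \<times> {0..1}" by (simp add: space_restrict_space)
  have fst: "fst \<in> ?S \<rightarrow>\<^sub>M unit_lebesgue" and snd: "snd \<in> ?S \<rightarrow>\<^sub>M unit_lebesgue"
    unfolding measurable_cong_sets[OF refl sets_unit_lebesgue]
    by (intro measurable_restrict_space2 measurable_restrict_space1
        borel_measurable_continuous_onI continuous_intros; simp add: S Pi_iff split_beta)+
  have "prob_space (map_permuton f)"
    unfolding map_permuton_def
    by (rule prob_space.prob_space_distr[OF prob_space_unit_lebesgue measurable_graph[OF f(1)]])
  moreover have "distr (map_permuton f) unit_lebesgue fst = unit_lebesgue"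
    unfolding map_permuton_def
    by (subst distr_distr[OF fst measurable_graph[OF f(1)]]) (simp add: comp_def distr_id)
  moreover have "distr (map_permuton f) unit_lebesgue snd = unit_lebesgue"
    unfolding map_permuton_def
    by (subst distr_distr[OF snd measurable_graph[OF f(1)]]) (simp add: comp_def f(2))
  ultimately show ?thesis
    by (simp add: permuton_def map_permuton_def)
qed

lemma bij_betw_sample_rank: "bij_betw (sample_rank n z) {1..n} {1..n}"
proof -
  let ?S = "\<lambda>i. {j \<in> {1..n}. z j < z i \<or> z j = z i \<and> j \<le> i}"
  have less: "sample_rank n z a < sample_rank n z b"
    if "a \<in> {1..n}" "b \<in> {1..n}" "z a < z b \<or> z a = z b \<and> a < b" for a b
  proof -
    have "?S a \<subseteq> ?S b" using that(3) by auto
    moreover have "b \<in> ?S b" "b \<notin> ?S a" using that by auto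
    ultimately have "?S a \<subset> ?S b" by blast
    then show ?thesis unfolding sample_rank_def by (intro psubset_card_mono) auto
  qed
  have inj: "inj_on (sample_rank n z) {1..n}"
  proof (rule inj_onI)
    fix a b assume ab: "a \<in> {1..n}" "b \<in> {1..n}" "sample_rank n z a = sample_rank n z b"
    show "a = b"
      using less[OF ab(1,2)] less[OF ab(2,1)] ab(3)
      by (metis less_irrefl linorder_less_linear)
  qed
  have "sample_rank n z ` {1..n} \<subseteq> {1..n}"
  proof
    fix y assume "y \<in> sample_rank n z ` {1..n}"
    then obtain i where i: "i \<in> {1..n}" "y = sample_rank n z i" by auto
    have "?S i \<noteq> {}" using i by auto
    then have "card (?S i) \<ge> 1" by (simp add: Suc_le_eq card_gt_0_iff)
    moreover have "card (?S i) \<le> card {1..n}" by (intro card_mono) auto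
    ultimately show "y \<in> {1..n}" using i by (simp add: sample_rank_def)
  qed
  then show ?thesis
    using inj by (simp add: bij_betw_def endo_inj_surj)
qed

lemma pattern_permutes: "pattern n \<omega> permutes {1..n}"
proof (rule bij_imp_permutes)
  have "bij_betw (sample_rank n (snd \<circ> \<omega>) \<circ> inv_into {1..n} (sample_rank n (fst \<circ> \<omega>))) {1..n} {1..n}"
    by (intro bij_betw_trans[OF bij_betw_inv_into[OF bij_betw_sample_rank] bij_betw_sample_rank])
  then show "bij_betw (pattern n \<omega>) {1..n} {1..n}"
    by (rule bij_betw_cong[THEN iffD1, rotated]) (simp add: pattern_def)
qed (auto simp: pattern_def)

lemma pattern_rank:
  assumes "i \<in> {1..n}"
  shows "pattern n \<omega> (sample_rank n (fst \<circ> \<omega>) i) = sample_rank n (snd \<circ> \<omega>) i"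
proof -
  have "sample_rank n (fst \<circ> \<omega>) i \<in> {1..n}"
    using bij_betw_sample_rank[of n "fst \<circ> \<omega>"] assms by (auto simp: bij_betw_def)
  then show ?thesis
    unfolding pattern_def
    using bij_betw_imp_inj_on[OF bij_betw_sample_rank[of n "fst \<circ> \<omega>"]] assms
    by (simp add: inv_into_f_f)
qed

lemma pattern_eq_iff:
  assumes "\<pi> permutes {1..n}"
  shows "pattern n \<omega> = \<pi> \<longleftrightarrow>
    (\<forall>i\<in>{1..n}. \<pi> (sample_rank n (fst \<circ> \<omega>) i) = sample_rank n (snd \<circ> \<omega>) i)"
proof
  assume *: "\<forall>i\<in>{1..n}. \<pi> (sample_rank n (fst \<circ> \<omega>) i) = sample_rank n (snd \<circ> \<omega>) i"
  show "pattern n \<omega> = \<pi>"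
  proof
    fix k show "pattern n \<omega> k = \<pi> k"
    proof (cases "k \<in> {1..n}")
      case True
      then have "k \<in> sample_rank n (fst \<circ> \<omega>) ` {1..n}"
        using bij_betw_imp_surj_on[OF bij_betw_sample_rank] by simp
      then obtain i where "i \<in> {1..n}" "k = sample_rank n (fst \<circ> \<omega>) i"
        by blast
      then show ?thesis using * pattern_rank by metis
    next
      case False
      then show ?thesis
        using assms pattern_permutes[of n \<omega>] by (metis permutes_not_in)
    qed
  qed
qed (auto simp: pattern_rank simp del: comp_apply)

lemma measurable_sample_rank [measurable]:
  assumes [measurable]: "\<And>j. j \<in> {1..n} \<Longrightarrow> (\<lambda>\<omega>. g \<omega> j) \<in> borel_measurable M" and "i \<in> {1..n}"
  shows "(\<lambda>\<omega>. sample_rank n (g \<omega>) i) \<in> M \<rightarrow>\<^sub>M count_space UNIV"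
proof -
  have [measurable]: "(\<lambda>\<omega>. g \<omega> i) \<in> borel_measurable M" using assms by auto
  have "sample_rank n (g \<omega>) i = (\<Sum>j\<in>{1..n}. if g \<omega> j < g \<omega> i \<or> g \<omega> j = g \<omega> i \<and> j \<le> i then 1 else 0)"
    for \<omega>
    unfolding sample_rank_def by (subst sum.If_cases) (auto simp: Int_def)
  then show ?thesis by simp
qed

lemma measurable_pattern:
  assumes "sets \<mu> = sets (restrict_space borel ({0..1::real} \<times> {0..1::real}))"
  shows "pattern n \<in> (\<Pi>\<^sub>M i\<in>{1..n}. \<mu>) \<rightarrow>\<^sub>M count_space {\<pi>. \<pi> permutes {1..n}}"
proof -
  let ?M = "\<Pi>\<^sub>M i\<in>{1..n}. \<mu>"
  have id: "(\<lambda>x. x) \<in> borel_measurable \<mu>"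
    unfolding measurable_cong_sets[OF assms refl] by (simp add: measurable_restrict_space1)
  have c: "(\<lambda>\<omega>. \<omega> j) \<in> borel_measurable ?M" if "j \<in> {1..n}" for j
    using measurable_compose[OF measurable_component_singleton[OF that] id] by simp
  have "(\<lambda>\<omega>. (fst \<circ> \<omega>) j) \<in> borel_measurable ?M" "(\<lambda>\<omega>. (snd \<circ> \<omega>) j) \<in> borel_measurable ?M"
    if "j \<in> {1..n}" for j
    using c[OF that] by (auto simp: borel_prod[symmetric])
  then have [measurable]:
    "(\<lambda>\<omega>. sample_rank n (fst \<circ> \<omega>) i) \<in> ?M \<rightarrow>\<^sub>M count_space UNIV"
    "(\<lambda>\<omega>. sample_rank n (snd \<circ> \<omega>) i) \<in> ?M \<rightarrow>\<^sub>M count_space UNIV" if "i \<in> {1..n}" for i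
    using that by (auto intro!: measurable_sample_rank simp del: comp_apply)
  have "pattern n -` {\<pi>} \<inter> space ?M \<in> sets ?M" if "\<pi> permutes {1..n}" for \<pi>
  proof -
    have "pattern n -` {\<pi>} \<inter> space ?M = {\<omega> \<in> space ?M.
        \<forall>i\<in>{1..n}. \<pi> (sample_rank n (fst \<circ> \<omega>) i) = sample_rank n (snd \<circ> \<omega>) i}"
      using pattern_eq_iff[OF that] by auto
    also have "\<dots> \<in> sets ?M" by measurable
    finally show ?thesis .
  qed
  then show ?thesis
    by (subst measurable_count_space_eq2)
      (auto simp: finite_permutations pattern_permutes simp del: One_nat_def)
qed

lemma prob_space_pattern_measure:
  assumes "permuton \<mu>"
  shows "prob_space (pattern_measure \<mu> n)"
proof -
  have "prob_space \<mu>" using assms by (simp add: permuton_def)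
  then interpret P: prob_space "\<Pi>\<^sub>M i\<in>{1..n}. \<mu>" by (intro prob_space_PiM)
  show ?thesis
    unfolding pattern_measure_def
    using assms by (intro P.prob_space_distr measurable_pattern) (simp add: permuton_def)
qed

lemma permuton_entropy_eq:
  assumes "permuton \<mu>"
  shows "permuton_entropy n \<mu> = - (\<Sum>\<pi> | \<pi> permutes {1..n}.
    measure (pattern_measure \<mu> n) {\<pi>} * ln (measure (pattern_measure \<mu> n) {\<pi>}))"
proof -
  let ?S = "{\<pi>. \<pi> permutes {1..n}}"
  let ?M = "pattern_measure \<mu> n"
  interpret prob_space ?M by (rule prob_space_pattern_measure[OF assms])
  interpret information_space ?M "exp 1" by unfold_locales simp
  have sp: "space ?M = ?S" and st: "sets ?M = Pow ?S" by (simp_all add: pattern_measure_def)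
  have fin: "finite ?S" by (simp add: finite_permutations)
  have "simple_distributed ?M (\<lambda>\<pi>. \<pi>) (\<lambda>\<pi>. measure ?M {\<pi>})"
  proof (rule simple_distributedI)
    show "simple_function ?M (\<lambda>\<pi>. \<pi>)" using fin by (simp add: simple_function_def sp st)
    show "measure ?M {\<pi>} = measure ?M ((\<lambda>\<pi>. \<pi>) -` {\<pi>} \<inter> space ?M)" if "\<pi> \<in> (\<lambda>\<pi>. \<pi>) ` space ?M" for \<pi>
      using that by (auto intro!: arg_cong[where f="measure ?M"])
  qed auto
  from entropy_simple_distributed[OF this] show ?thesis
    by (simp add: permuton_entropy_def sp log_def)
qed

end

theory Submission
  imports Defs
begin

text \<open>
  For fixed \<open>n\<close> the entropy \<open>H n f\<close> of the pattern of \<open>n\<close> sample points is a continuous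
  function of \<open>f\<close> (\<open>permuton_entropy_continuous\<close>): moving the graph by \<open>d\<close> changes the
  relative order only of heights that differ by at most \<open>2 * d\<close>, and since the heights are
  independent and uniform, two of them are that close with probability \<open>O(n\<^sup>2 * d)\<close>. Hence the sets
  \<open>{f. \<exists>n > k. H n f < n / (k + 1)}\<close> and \<open>{f. \<exists>n \<ge> k + 2. H n f > (1 - 1 / (k + 1)) * n * ln n}\<close>
  are open, and a map in all of them has lower limit at most \<open>0\<close> and upper limit at least \<open>1\<close>.
  The reverse inequalities are \<open>0 \<le> H n f \<le> ln (fact n) \<le> n * ln n\<close>. What remains is that the
  sets are dense, so any \<open>f\<close> has to be approximated in two ways.

  Many patterns (\<open>dense_high_entropy\<close>). Divide the unit interval into \<open>m\<close> blocks and let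
  \<open>\<phi>\<close> run up and down \<open>K\<close> times through each of them. It is uniformly within \<open>1 / m\<close> of the
  identity, so \<open>f \<circ> \<phi>\<close> is close to \<open>f\<close>. For large \<open>K\<close> the sample points lie in
  different runs of the zigzag; their horizontal order then only depends on the runs, while the
  position inside the run makes the height behave like an independent variable with a density of at
  most \<open>m\<close>. For independent heights all patterns are equally likely, so no pattern is more likely
  than about \<open>m ^ n / fact n\<close>, and the entropy is at least \<open>n * ln n - O(n)\<close>.

  Few patterns (\<open>dense_low_entropy\<close>). Divide domain and range into \<open>M\<close> intervals. As \<open>f\<close>
  preserves the measure, Hall's marriage theorem gives a permutation \<open>\<sigma>\<close> such that \<open>f\<close> maps
  some point of the \<open>k\<close>-th interval into the band \<open>\<sigma> k\<close> of heights; the interval exchange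
  that translates the \<open>k\<close>-th interval onto the band \<open>\<sigma> k\<close> is then close to \<open>f\<close>. It is made
  continuous by steep transits between consecutive bands, and it still preserves the measure
  if every interval gives up the time that the transits spend in its band. With high probability no
  sample point lies on a transit. The pattern is then determined by the numbers of points in
  the \<open>M\<close> intervals, so there are at most \<open>(n + 1) ^ M\<close> of them and the entropy is \<open>O(M * ln n)\<close>.
\<close>

section \<open>Order patterns\<close>

lemma sample_rank_cong_order:
  assumes "\<And>i j. i \<in> {1..n} \<Longrightarrow> j \<in> {1..n} \<Longrightarrow> z j < z i \<longleftrightarrow> z' j < z' i"
    and "i \<in> {1..n}"
  shows "sample_rank n z i = sample_rank n z' i"
proof -
  have "z j = z i \<longleftrightarrow> z' j = z' i" if "j \<in> {1..n}" for j
    using assms(1)[OF that assms(2)] assms(1)[OF assms(2) that] by (cases "z j < z i"; cases "z i < z j") auto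
  then have "{j \<in> {1..n}. z j < z i \<or> z j = z i \<and> j \<le> i} = {j \<in> {1..n}. z' j < z' i \<or> z' j = z' i \<and> j \<le> i}"
    using assms by blast
  then show ?thesis by (simp add: sample_rank_def)
qed

lemma pattern_eqI_ranks:
  assumes "\<And>i. i \<in> {1..n} \<Longrightarrow> sample_rank n (fst \<circ> \<omega>) i = sample_rank n (fst \<circ> \<omega>') i"
    and "\<And>i. i \<in> {1..n} \<Longrightarrow> sample_rank n (snd \<circ> \<omega>) i = sample_rank n (snd \<circ> \<omega>') i"
  shows "pattern n \<omega> = pattern n \<omega>'"
  unfolding pattern_eq_iff[OF pattern_permutes] using assms by (simp add: pattern_rank del: comp_apply)

text \<open>Ties are the pairs for which neither strict inequality holds. So the two strict orders determine
  the ties, the tie-breaking and hence the pattern.\<close>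
lemma pattern_cong_order:
  assumes "\<And>i j. i \<in> {1..n} \<Longrightarrow> j \<in> {1..n} \<Longrightarrow> fst (\<omega> j) < fst (\<omega> i) \<longleftrightarrow> fst (\<omega>' j) < fst (\<omega>' i)"
    and "\<And>i j. i \<in> {1..n} \<Longrightarrow> j \<in> {1..n} \<Longrightarrow> snd (\<omega> j) < snd (\<omega> i) \<longleftrightarrow> snd (\<omega>' j) < snd (\<omega>' i)"
  shows "pattern n \<omega> = pattern n \<omega>'"
  by (rule pattern_eqI_ranks; rule sample_rank_cong_order) (use assms in auto)

section \<open>Shannon entropy on a finite set\<close>

text \<open>Gibbs' inequality for one atom: \<open>ln t \<le> t - 1\<close> at \<open>t = a / p\<close>. Summed over a part of the space,
  with a weight \<open>a\<close> adapted to that part, it bounds the contribution of the part to the entropy.\<close>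
lemma neg_mult_ln_le:
  assumes "p \<ge> 0" "a > 0"
  shows "- (p * ln p) \<le> p * ln (1 / a) + a - (p::real)"
proof (cases "p = 0")
  case False
  then have p: "p > 0" using assms by simp
  have "ln (a / p) \<le> a / p - 1" using p assms by (intro ln_le_minus_one) simp
  then have "p * ln (a / p) \<le> p * (a / p - 1)" using p by (intro mult_left_mono) auto
  then show ?thesis using p assms by (simp add: ln_div algebra_simps)
qed (use assms in simp)

lemma sum_neg_mult_ln_le:
  assumes "\<And>x. x \<in> T \<Longrightarrow> p x \<ge> 0" "a > 0"
  shows "- (\<Sum>x\<in>T. p x * ln (p x)) \<le> (\<Sum>x\<in>T. p x) * ln (1 / a) + real (card T) * a - (\<Sum>x\<in>T. p x)"
proof -
  have "- (\<Sum>x\<in>T. p x * ln (p x)) = (\<Sum>x\<in>T. - (p x * ln (p x)))" by (simp add: sum_negf)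
  also have "\<dots> \<le> (\<Sum>x\<in>T. p x * ln (1 / a) + a - p x)"
    by (intro sum_mono neg_mult_ln_le assms) auto
  also have "\<dots> = (\<Sum>x\<in>T. p x) * ln (1 / a) + real (card T) * a - (\<Sum>x\<in>T. p x)"
    by (simp add: sum.distrib sum_subtractf sum_distrib_right)
  finally show ?thesis .
qed

lemma entropy_le_ln_card:
  assumes "finite S" "S \<noteq> {}" "\<And>x. x \<in> S \<Longrightarrow> p x \<ge> 0" "(\<Sum>x\<in>S. p x) = 1"
  shows "- (\<Sum>x\<in>S. p x * ln (p x)) \<le> ln (real (card S))"
  using sum_neg_mult_ln_le[of S p "1 / card S"] assms by (simp add: card_gt_0_iff)

text \<open>The atoms are compared with the uniform weight of \<open>Q\<close> inside \<open>Q\<close> and with the uniform weight of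
  \<open>S\<close> outside: a rare exception costs \<open>ln (card S)\<close> times its probability. Each of the two
  comparisons loses at most the complementary probability, which is where the \<open>1\<close> comes from.\<close>
lemma entropy_le_concentrated:
  assumes "finite S" "Q \<subseteq> S" "Q \<noteq> {}" "\<And>x. x \<in> S \<Longrightarrow> p x \<ge> 0" "(\<Sum>x\<in>S. p x) = 1"
  shows "- (\<Sum>x\<in>S. p x * ln (p x))
    \<le> ln (real (card Q)) + (\<Sum>x\<in>S - Q. p x) * ln (real (card S)) + 1"
proof -
  have fin: "finite Q" using assms finite_subset by blast
  have split: "(\<Sum>x\<in>S. h x) = (\<Sum>x\<in>S - Q. h x) + (\<Sum>x\<in>Q. h x)" for h :: "_ \<Rightarrow> real"
    using assms by (intro sum.subset_diff) auto
  have cQ: "real (card Q) \<ge> 1" and cS: "real (card S) \<ge> 1"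
    using fin assms by (auto simp: Suc_le_eq card_gt_0_iff)
  have 1: "- (\<Sum>x\<in>Q. p x * ln (p x)) \<le> (\<Sum>x\<in>Q. p x) * ln (real (card Q)) + 1 - (\<Sum>x\<in>Q. p x)"
    using sum_neg_mult_ln_le[of Q p "1 / card Q"] assms cQ by auto
  have "real (card (S - Q)) \<le> real (card S)"
    using assms by (intro of_nat_mono card_mono) auto
  then have 2: "- (\<Sum>x\<in>S - Q. p x * ln (p x)) \<le> (\<Sum>x\<in>S - Q. p x) * ln (real (card S)) + 1 - (\<Sum>x\<in>S - Q. p x)"
    using sum_neg_mult_ln_le[of "S - Q" p "1 / card S"] assms cS
    by (auto simp: field_simps elim!: order_trans)
  have nn: "(\<Sum>x\<in>S - Q. p x) \<ge> 0" using assms by (intro sum_nonneg) auto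
  have "(\<Sum>x\<in>Q. p x) \<le> 1" using split[of p] assms nn by linarith
  then have "(\<Sum>x\<in>Q. p x) * ln (real (card Q)) \<le> ln (real (card Q))"
    using cQ mult_right_mono[of "sum p Q" 1 "ln (real (card Q))"] by auto
  then show ?thesis using 1 2 split[of p] split[of "\<lambda>x. p x * ln (p x)"] assms by linarith
qed

lemma entropy_nonneg_finite:
  assumes "finite S" "\<And>x. x \<in> S \<Longrightarrow> p x \<ge> 0" "(\<Sum>x\<in>S. p x) = (1::real)"
  shows "0 \<le> - (\<Sum>x\<in>S. p x * ln (p x))"
proof -
  have "p x \<le> 1" if "x \<in> S" for x
    using member_le_sum[of x S p] assms that by auto
  then have "p x * ln (p x) \<le> 0" if "x \<in> S" for x
    using assms(2)[OF that] that by (cases "p x = 0") (auto intro!: mult_nonneg_nonpos)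
  then show ?thesis by (simp add: sum_nonpos)
qed

lemma entropy_ge_neg_ln_max:
  assumes "finite S" "\<And>x. x \<in> S \<Longrightarrow> p x \<ge> 0" "(\<Sum>x\<in>S. p x) = (1::real)"
    and "\<And>x. x \<in> S \<Longrightarrow> p x \<le> q"
  shows "- ln q \<le> - (\<Sum>x\<in>S. p x * ln (p x))"
proof -
  have "p x * ln (p x) \<le> p x * ln q" if "x \<in> S" for x
    using assms(2,4)[OF that] by (cases "p x = 0") (auto intro!: mult_left_mono)
  then have "(\<Sum>x\<in>S. p x * ln (p x)) \<le> (\<Sum>x\<in>S. p x * ln q)" by (rule sum_mono)
  also have "\<dots> = ln q" using assms by (simp flip: sum_distrib_right)
  finally show ?thesis by simp
qed

section \<open>Hall's marriage theorem\<close>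

text \<open>The argument of Halmos and Vaughan. If a proper subset \<open>S\<close> has exactly \<open>card S\<close> neighbours, these
  must be used up by \<open>S\<close>, and what is left still satisfies the condition. If there is no such \<open>S\<close>,
  every nonempty proper subset has a neighbour to spare, and any first choice can be made.\<close>
lemma hall_marriage:
  assumes "finite A" "\<And>a. a \<in> A \<Longrightarrow> finite (N a)"
    and "\<And>S. S \<subseteq> A \<Longrightarrow> card S \<le> card (\<Union>(N ` S))"
  shows "\<exists>\<sigma>. inj_on \<sigma> A \<and> (\<forall>a\<in>A. \<sigma> a \<in> N a)"
  using assms
proof (induction "card A" arbitrary: A N rule: less_induct)
  case less
  note fin = less.prems(1,2) and hall = less.prems(3)
  have finN: "finite (\<Union>(N ` S))" if "S \<subseteq> A" for S
    using that fin finite_subset by blast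
  show ?case
  proof (cases "A = {}")
    case False
    show ?thesis
    proof (cases "\<exists>S. S \<subset> A \<and> S \<noteq> {} \<and> card S = card (\<Union>(N ` S))")
      case True
      then obtain S where S: "S \<subset> A" "S \<noteq> {}" "card S = card (\<Union>(N ` S))" by blast
      let ?U = "\<Union>(N ` S)"
      have "finite S" using S fin finite_subset by blast
      have cS: "card S < card A" using S fin by (intro psubset_card_mono) auto
      have cD: "card (A - S) < card A" using S fin by (intro psubset_card_mono) auto
      obtain \<sigma> where \<sigma>: "inj_on \<sigma> S" "\<forall>a\<in>S. \<sigma> a \<in> N a"
        using less.hyps[OF cS, of N] fin hall S finite_subset by (metis psubset_imp_subset subset_iff subset_trans)
      \<comment> \<open>Hall's condition for \<open>T \<union> S\<close>, minus the tight one for \<open>S\<close>.\<close>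
      have "card T \<le> card (\<Union>((\<lambda>a. N a - ?U) ` T))" if T: "T \<subseteq> A - S" for T
      proof -
        have "finite T" using T fin finite_subset by blast
        have "card T + card S = card (T \<union> S)"
          using T \<open>finite T\<close> \<open>finite S\<close> by (subst card_Un_disjoint) auto
        also have "\<dots> \<le> card (\<Union>(N ` (T \<union> S)))" using T S by (intro hall) auto
        also have "\<Union>(N ` (T \<union> S)) = \<Union>((\<lambda>a. N a - ?U) ` T) \<union> ?U" by auto
        also have "card \<dots> \<le> card (\<Union>((\<lambda>a. N a - ?U) ` T)) + card ?U" by (rule card_Un_le)
        finally show ?thesis using S by simp
      qed
      then obtain \<tau> where \<tau>: "inj_on \<tau> (A - S)" "\<forall>a\<in>A - S. \<tau> a \<in> N a - ?U"
        using less.hyps[OF cD, of "\<lambda>a. N a - ?U"] fin by auto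
      let ?\<rho> = "\<lambda>a. if a \<in> S then \<sigma> a else \<tau> a"
      have "inj_on ?\<rho> A"
      proof (rule inj_onI)
        fix a b assume "a \<in> A" "b \<in> A" "?\<rho> a = ?\<rho> b"
        then show "a = b"
          using \<sigma> \<tau> by (auto split: if_splits dest: inj_onD)
            (metis DiffI UN_I DiffD2)+
      qed
      moreover have "\<forall>a\<in>A. ?\<rho> a \<in> N a" using \<sigma> \<tau> by auto
      ultimately show ?thesis by blast
    next
      case strict: False
      obtain a where a: "a \<in> A" using False by blast
      have "card {a} \<le> card (\<Union>(N ` {a}))" using a by (intro hall) auto
      then have "N a \<noteq> {}" by auto
      then obtain b where b: "b \<in> N a" by blast
      have cA: "card (A - {a}) < card A" using a fin by (intro psubset_card_mono) auto
      have "card T \<le> card (\<Union>((\<lambda>x. N x - {b}) ` T))" if T: "T \<subseteq> A - {a}" for T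
      proof (cases "T = {}")
        case False
        have "T \<subset> A" using T a by blast
        then have "card T < card (\<Union>(N ` T))"
          using strict False hall[of T] T a by (metis (no_types, lifting) \<open>T \<subset> A\<close> le_neq_implies_less psubset_imp_subset)
        moreover have "\<Union>((\<lambda>x. N x - {b}) ` T) = \<Union>(N ` T) - {b}" by auto
        moreover have "card (\<Union>(N ` T)) - 1 \<le> card (\<Union>(N ` T) - {b})"
          using finN[of T] \<open>T \<subset> A\<close> by (simp add: card_Diff_singleton_if)
        ultimately show ?thesis by simp
      qed simp
      then obtain \<tau> where \<tau>: "inj_on \<tau> (A - {a})" "\<forall>x\<in>A - {a}. \<tau> x \<in> N x - {b}"
        using less.hyps[OF cA, of "\<lambda>x. N x - {b}"] fin by auto
      have "inj_on (\<tau>(a := b)) A"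
        using \<tau> by (auto simp: inj_on_def)
      moreover have "\<forall>x\<in>A. (\<tau>(a := b)) x \<in> N x" using \<tau> b by auto
      ultimately show ?thesis by blast
    qed
  qed auto
qed

section \<open>The space of measure-preserving maps\<close>

lemma measurable_unit_lebesgue_continuous:
  assumes "continuous_on {0..1} f" "f ` {0..1} \<subseteq> {0..1}"
  shows "f \<in> unit_lebesgue \<rightarrow>\<^sub>M unit_lebesgue"
  unfolding measurable_cong_sets[OF sets_unit_lebesgue sets_unit_lebesgue]
  using assms by (intro measurable_restrict_space2 borel_measurable_continuous_on_restrict)
    (auto simp: space_restrict_space)

lemma emeasure_unit_lebesgue:
  assumes "A \<in> sets borel" "A \<subseteq> {0..1}"
  shows "emeasure unit_lebesgue A = emeasure lborel A"
  unfolding unit_lebesgue_def using assms by (intro emeasure_restrict_space) auto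

lemma sets_unit_lebesgue_iff: "A \<in> sets unit_lebesgue \<longleftrightarrow> A \<in> sets borel \<and> A \<subseteq> {0..1}"
  unfolding sets_unit_lebesgue by (subst sets_restrict_space_iff) auto

lemma mtopology_of_unit_interval:
  "mtopology_of (submetric euclidean_metric {0..1::real}) = top_of_set {0..1}"
  by (simp add: mtopology_of_submetric)

lemma mspace_C_lambda_iff:
  "f \<in> mspace C_lambda \<longleftrightarrow> f \<in> extensional {0..1} \<and> continuous_on {0..1} f \<and> f ` {0..1} \<subseteq> {0..1}
    \<and> distr unit_lebesgue unit_lebesgue f = unit_lebesgue"
proof -
  have "Metric_space.mbounded (mspace (submetric euclidean_metric {0..1}))
      (mdist (submetric euclidean_metric {0..1::real})) (f ` {0..1})" if "f ` {0..1} \<subseteq> {0..1}"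
    unfolding Metric_space.mbounded_alt[OF Metric_space_mspace_mdist]
    using that by (auto intro!: exI[of _ 1] simp: dist_real_def abs_le_iff) (smt (verit) atLeastAtMost_iff image_subset_iff)+
  moreover have "continuous_map (top_of_set {0..1}) (top_of_set {0..1::real}) f \<longleftrightarrow>
      continuous_on {0..1} f \<and> f ` {0..1} \<subseteq> {0..1}"
    by (auto simp: continuous_map_in_subtopology)
  ultimately show ?thesis
    unfolding C_lambda_def
    by (auto simp: mtopology_of_unit_interval intro!: measurable_unit_lebesgue_continuous)
qed

lemma C_lambdaD:
  assumes "f \<in> mspace C_lambda"
  shows "continuous_on {0..1} f" "\<And>x. x \<in> {0..1} \<Longrightarrow> f x \<in> {0..1}"
    "f \<in> unit_lebesgue \<rightarrow>\<^sub>M unit_lebesgue" "distr unit_lebesgue unit_lebesgue f = unit_lebesgue"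
  using assms mspace_C_lambdaD[OF assms] by (auto simp: mspace_C_lambda_iff image_subset_iff)

lemma emeasure_vimage_C_lambda:
  assumes "f \<in> mspace C_lambda" "A \<in> sets unit_lebesgue"
  shows "emeasure unit_lebesgue (f -` A \<inter> {0..1}) = emeasure unit_lebesgue A"
  using emeasure_distr[OF C_lambdaD(3)[OF assms(1)] assms(2)] C_lambdaD(4)[OF assms(1)] by simp

lemma C_lambdaI:
  assumes "continuous_on {0..1} f" "f ` {0..1} \<subseteq> {0..1}"
    and "\<And>A. A \<in> sets borel \<Longrightarrow> A \<subseteq> {0..1} \<Longrightarrow> emeasure lborel ({0..1} \<inter> f -` A) = emeasure lborel A"
  shows "restrict f {0..1} \<in> mspace C_lambda"
proof -
  have f: "f \<in> unit_lebesgue \<rightarrow>\<^sub>M unit_lebesgue" using assms by (intro measurable_unit_lebesgue_continuous)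
  have "distr unit_lebesgue unit_lebesgue f = unit_lebesgue"
  proof (rule measure_eqI)
    fix A assume "A \<in> sets (distr unit_lebesgue unit_lebesgue f)"
    then have A: "A \<in> sets unit_lebesgue" by simp
    have "f -` A \<inter> {0..1} \<in> sets unit_lebesgue" using measurable_sets[OF f A] by simp
    then show "emeasure (distr unit_lebesgue unit_lebesgue f) A = emeasure unit_lebesgue A"
      using A assms(3)[of A]
      by (subst emeasure_distr[OF f]) (auto simp: emeasure_unit_lebesgue sets_unit_lebesgue_iff Int_commute)
  qed simp
  moreover have "distr unit_lebesgue unit_lebesgue (restrict f {0..1}) = distr unit_lebesgue unit_lebesgue f"
    by (rule distr_cong) auto
  moreover have "continuous_on {0..1} (restrict f {0..1})"
    using assms(1) by (subst continuous_on_cong[OF refl, of _ _ f]) auto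
  ultimately show ?thesis
    using assms(2) f unfolding mspace_C_lambda_iff by (auto simp del: restrict_apply)
qed

lemma mdist_C_lambda_le:
  assumes "f \<in> mspace C_lambda" "g \<in> mspace C_lambda"
  shows "mdist C_lambda f g \<le> a \<longleftrightarrow> (\<forall>x\<in>{0..1}. \<bar>f x - g x\<bar> \<le> a)"
proof -
  have "mdist C_lambda f g = mdist (cfunspace (top_of_set {0..1}) (submetric euclidean_metric {0..1})) f g"
    by (simp add: C_lambda_def)
  then show ?thesis
    using assms by (simp add: C_lambda_def cfunspace_mdist_le dist_real_def)
qed

lemma C_lambda_compose:
  assumes f: "f \<in> mspace C_lambda" and h: "h \<in> mspace C_lambda"
  shows "compose {0..1} f h \<in> mspace C_lambda"
  unfolding compose_def
proof (rule C_lambdaI)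
  show "continuous_on {0..1} (\<lambda>x. f (h x))"
    using C_lambdaD[OF f] C_lambdaD[OF h]
    by (intro continuous_on_compose2[of "{0..1}" f "{0..1}" h]) auto
  show "(\<lambda>x. f (h x)) ` {0..1} \<subseteq> {0..1}" using C_lambdaD[OF f] C_lambdaD[OF h] by auto
  fix A :: "real set" assume "A \<in> sets borel" "A \<subseteq> {0..1}"
  then have A: "A \<in> sets unit_lebesgue" by (simp add: sets_unit_lebesgue_iff)
  let ?B = "f -` A \<inter> {0..1}"
  have B: "?B \<in> sets unit_lebesgue" using measurable_sets[OF C_lambdaD(3)[OF f] A] by simp
  have C: "h -` ?B \<inter> {0..1} \<in> sets unit_lebesgue" using measurable_sets[OF C_lambdaD(3)[OF h] B] by simp
  have "{0..1} \<inter> (\<lambda>x. f (h x)) -` A = h -` ?B \<inter> {0..1}" using C_lambdaD(2)[OF h] by auto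
  then show "emeasure lborel ({0..1} \<inter> (\<lambda>x. f (h x)) -` A) = emeasure lborel A"
    using emeasure_vimage_C_lambda[OF f A] emeasure_vimage_C_lambda[OF h B] A B C
    by (simp add: emeasure_unit_lebesgue sets_unit_lebesgue_iff)
qed

section \<open>Piecewise affine maps\<close>

text \<open>The map with value \<open>p i\<close> at time \<open>t i\<close>: every summand is the increment along one segment, frozen
  before and after it. In this form the continuity is evident, and a segment of length zero
  contributes nothing.\<close>
definition piecewise_affine :: "nat \<Rightarrow> (nat \<Rightarrow> real) \<Rightarrow> (nat \<Rightarrow> real) \<Rightarrow> real \<Rightarrow> real" where
  "piecewise_affine L t p x =
     p 0 + (\<Sum>i<L. (p (Suc i) - p i) * max 0 (min 1 ((x - t i) * inverse (t (Suc i) - t i))))"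

lemma continuous_on_piecewise_affine: "continuous_on S (piecewise_affine L t p)"
  unfolding piecewise_affine_def by (intro continuous_intros)

text \<open>Segments may have length zero, as long as they carry no jump.\<close>
locale breakpoints =
  fixes L :: nat and t p :: "nat \<Rightarrow> real"
  assumes mono: "\<And>i. i < L \<Longrightarrow> t i \<le> t (Suc i)"
    and jump_free: "\<And>i. i < L \<Longrightarrow> t i = t (Suc i) \<Longrightarrow> p i = p (Suc i)"
begin

lemma mono_le: "i \<le> j \<Longrightarrow> j \<le> L \<Longrightarrow> t i \<le> t j"
proof (induction j)
  case (Suc j) then show ?case using mono[of j] by (cases "i = Suc j") auto
qed auto

lemma piecewise_affine_segment:
  assumes k: "k < L" and x: "t k \<le> x" "x \<le> t (Suc k)" and nd: "t k < t (Suc k)"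
  shows "piecewise_affine L t p x = p k + (p (Suc k) - p k) * ((x - t k) / (t (Suc k) - t k))"
proof -
  let ?h = "\<lambda>i. (p (Suc i) - p i) * max 0 (min 1 ((x - t i) * inverse (t (Suc i) - t i)))"
  have below: "?h i = p (Suc i) - p i" if "i < k" for i
  proof (cases "t i = t (Suc i)")
    case False
    have "t (Suc i) \<le> x" using mono_le[of "Suc i" k] that k x by auto
    moreover have "t i < t (Suc i)" using mono[of i] that k False by simp
    ultimately have "1 \<le> (x - t i) * inverse (t (Suc i) - t i)" by (simp add: field_simps)
    then show ?thesis by simp
  qed (use jump_free[of i] that k in simp)
  have above: "?h i = 0" if "i \<in> {Suc k..<L}" for i
  proof -
    have "x \<le> t i" using mono_le[of "Suc k" i] that x by auto
    moreover have "t i \<le> t (Suc i)" using mono[of i] that by simp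
    ultimately have "(x - t i) * inverse (t (Suc i) - t i) \<le> 0" by (intro mult_nonpos_nonneg) auto
    then show ?thesis by simp
  qed
  have "(\<Sum>i<L. ?h i) = (\<Sum>i<k. ?h i) + (\<Sum>i\<in>{k..<L}. ?h i)"
    using k sum.atLeastLessThan_concat[of 0 k L ?h] by (simp add: lessThan_atLeast0)
  also have "(\<Sum>i\<in>{k..<L}. ?h i) = ?h k + (\<Sum>i\<in>{Suc k..<L}. ?h i)"
    using k by (rule sum.atLeast_Suc_lessThan)
  also have "(\<Sum>i<k. ?h i) = p k - p 0" by (simp add: below sum_lessThan_telescope)
  also have "(\<Sum>i\<in>{Suc k..<L}. ?h i) = 0" by (intro sum.neutral ballI above)
  also have "?h k = (p (Suc k) - p k) * ((x - t k) / (t (Suc k) - t k))"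
  proof -
    have "0 \<le> (x - t k) / (t (Suc k) - t k)" "(x - t k) / (t (Suc k) - t k) \<le> 1"
      using x nd by (auto simp: divide_le_eq)
    then show ?thesis by (simp add: divide_inverse[symmetric])
  qed
  finally show ?thesis by (simp add: piecewise_affine_def)
qed

lemma piecewise_affine_between:
  assumes k: "k < L" and x: "t k \<le> x" "x \<le> t (Suc k)" and nd: "t k < t (Suc k)"
  shows "piecewise_affine L t p x \<in> {min (p k) (p (Suc k))..max (p k) (p (Suc k))}"
proof -
  define u where "u = (x - t k) / (t (Suc k) - t k)"
  have u: "0 \<le> u" "u \<le> 1" using x nd by (auto simp: u_def)
  have eq: "piecewise_affine L t p x = p k + u * (p (Suc k) - p k)"
    unfolding piecewise_affine_segment[OF assms] u_def[symmetric] by (simp add: algebra_simps)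
  show ?thesis
  proof (cases "p k \<le> p (Suc k)")
    case True
    then have "0 \<le> u * (p (Suc k) - p k)" "u * (p (Suc k) - p k) \<le> 1 * (p (Suc k) - p k)"
      using u by (simp, intro mult_right_mono, auto)
    then show ?thesis using True eq by auto
  next
    case False
    then have "0 \<le> u * (p k - p (Suc k))" "u * (p k - p (Suc k)) \<le> 1 * (p k - p (Suc k))"
      using u by (simp, intro mult_right_mono, auto)
    then show ?thesis using False eq by (auto simp: algebra_simps)
  qed
qed

lemma in_segment:
  assumes "t 0 < x" "x \<le> t L"
  obtains k where "k < L" "t k < x" "x \<le> t (Suc k)"
proof -
  define k where "k = (LEAST k. x \<le> t k)"
  have le: "x \<le> t k" unfolding k_def by (rule LeastI[of "\<lambda>k. x \<le> t k" L]) (use assms in auto)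
  have "k \<noteq> 0" using assms le by (intro notI) auto
  then obtain j where j: "k = Suc j" using not0_implies_Suc by blast
  have "k \<le> L" unfolding k_def by (rule Least_le) (use assms in auto)
  moreover have "\<not> x \<le> t j" using not_less_Least[of j "\<lambda>k. x \<le> t k"] j by (auto simp: k_def)
  ultimately show ?thesis using that[of j] j le by auto
qed

text \<open>An affine segment spreads its duration evenly over the heights that it passes. The left endpoint
  is left out so that the segments tile the interval.\<close>
lemma emeasure_segment_vimage:
  assumes k: "k < L" and nd: "t k < t (Suc k)" "p k \<noteq> p (Suc k)" and A: "A \<in> sets borel"
  shows "emeasure lborel ({t k<..t (Suc k)} \<inter> piecewise_affine L t p -` A) =
    ennreal ((t (Suc k) - t k) / \<bar>p (Suc k) - p k\<bar>)
      * emeasure lborel (A \<inter> {min (p k) (p (Suc k))..max (p k) (p (Suc k))})"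
proof -
  let ?g = "piecewise_affine L t p"
  let ?J = "{min (p k) (p (Suc k))..max (p k) (p (Suc k))}"
  define c where "c = (t (Suc k) - t k) / (p (Suc k) - p k)"
  have c: "c \<noteq> 0" using nd by (simp add: c_def)
  have gm[measurable]: "?g \<in> borel_measurable borel"
    by (intro borel_measurable_continuous_onI continuous_on_piecewise_affine)
  have S: "{t k<..t (Suc k)} \<inter> ?g -` A \<in> sets borel"
    using measurable_sets[OF gm A] by auto
  have "emeasure lborel ({t k<..t (Suc k)} \<inter> ?g -` A) =
      (\<integral>\<^sup>+ x. indicator ({t k<..t (Suc k)} \<inter> ?g -` A) x \<partial>lborel)"
    using S by simp
  also have "\<dots> = \<bar>c\<bar> * (\<integral>\<^sup>+ y. indicator ({t k<..t (Suc k)} \<inter> ?g -` A) ((t k - c * p k) + c * y) \<partial>lborel)"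
    using S c by (intro nn_integral_real_affine) auto
  also have "(\<lambda>y. indicator ({t k<..t (Suc k)} \<inter> ?g -` A) ((t k - c * p k) + c * y)) =
      (indicator (A \<inter> ?J - {p k}) :: real \<Rightarrow> ennreal)"
  proof
    fix y :: real
    let ?x = "(t k - c * p k) + c * y"
    let ?D = "t (Suc k) - t k" and ?P = "p (Suc k) - p k"
    have D: "?D > 0" and P: "?P \<noteq> 0" using nd by auto
    define u where "u = (y - p k) / ?P"
    have x: "?x = t k + ?D * u" by (simp add: u_def c_def diff_divide_distrib algebra_simps)
    have "t k < ?x \<longleftrightarrow> 0 < u" unfolding x using D by (simp add: zero_less_mult_iff)
    moreover have "?x \<le> t (Suc k) \<longleftrightarrow> ?D * u \<le> ?D * 1" unfolding x by auto
    moreover have "\<dots> \<longleftrightarrow> u \<le> 1" using D by (simp only: mult_le_cancel_left_pos)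
    ultimately have "?x \<in> {t k<..t (Suc k)} \<longleftrightarrow> 0 < u \<and> u \<le> 1" by simp
    also have "\<dots> \<longleftrightarrow> y \<in> ?J - {p k}"
      using P by (cases "p (Suc k) > p k") (auto simp: u_def field_simps min_def max_def)
    finally have in_iff: "?x \<in> {t k<..t (Suc k)} \<longleftrightarrow> y \<in> ?J - {p k}" .
    have "?g ?x = y" if "?x \<in> {t k<..t (Suc k)}"
    proof -
      have "(?x - t k) / ?D = (y - p k) / ?P" unfolding x u_def[symmetric] using D by simp
      then show ?thesis using piecewise_affine_segment[OF k _ _ nd(1), of ?x] that P by simp
    qed
    then show "indicator ({t k<..t (Suc k)} \<inter> ?g -` A) ?x = (indicator (A \<inter> ?J - {p k}) y :: ennreal)"
      using in_iff by (auto simp: indicator_def)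
  qed
  also have "(\<integral>\<^sup>+ y. indicator (A \<inter> ?J - {p k}) y \<partial>lborel) = emeasure lborel (A \<inter> ?J - {p k})"
    using A by (intro nn_integral_indicator) auto
  also have "\<dots> = emeasure lborel (A \<inter> ?J)"
    using A by (intro emeasure_Diff_null_set) auto
  also have "\<bar>c\<bar> = (t (Suc k) - t k) / \<bar>p (Suc k) - p k\<bar>" using nd by (simp add: c_def abs_divide)
  finally show ?thesis .
qed

end

text \<open>The density at height \<open>y\<close> of the image of Lebesgue measure is the sum, over the segments passing
  \<open>y\<close>, of the inverse slopes. The map preserves the measure if this density is \<open>1\<close>.\<close>
lemma piecewise_affine_in_C_lambda:
  assumes "breakpoints L t p" and ends: "t 0 = 0" "t L = 1"
    and nd: "\<And>i. i < L \<Longrightarrow> t i < t (Suc i) \<Longrightarrow> p i \<noteq> p (Suc i)"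
    and range: "\<And>i. i \<le> L \<Longrightarrow> p i \<in> {0..1}"
    and occ: "AE y in lborel. y \<in> {0..1} \<longrightarrow>
      (\<Sum>i<L. (t (Suc i) - t i) / \<bar>p (Suc i) - p i\<bar> *
         indicator {min (p i) (p (Suc i))..max (p i) (p (Suc i))} y) = 1"
  shows "restrict (piecewise_affine L t p) {0..1} \<in> mspace C_lambda"
proof (rule C_lambdaI)
  interpret breakpoints L t p by fact
  let ?g = "piecewise_affine L t p"
  let ?J = "\<lambda>i. {min (p i) (p (Suc i))..max (p i) (p (Suc i))}"
  let ?s = "\<lambda>i. (t (Suc i) - t i) / \<bar>p (Suc i) - p i\<bar>"
  show "continuous_on {0..1} ?g" by (rule continuous_on_piecewise_affine)
  show "?g ` {0..1} \<subseteq> {0..1}"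
  proof
    fix y assume "y \<in> ?g ` {0..1}"
    then obtain x where x: "x \<in> {0..1}" "y = ?g x" by blast
    show "y \<in> {0..1}"
    proof (cases "x = 0")
      case False
      then obtain k where k: "k < L" "t k < x" "x \<le> t (Suc k)"
        using in_segment[of x] x ends by auto
      have "?g x \<in> ?J k" using piecewise_affine_between[of k x] k by auto
      then show ?thesis using x range[of k] range[of "Suc k"] k by auto
    next
      case True
      have nn: "(x - t i) * inverse (t (Suc i) - t i) \<le> 0" if "i < L" for i
        using mono_le[of 0 i] mono[of i] that True ends by (intro mult_nonpos_nonneg) auto
      have "?g x = p 0" unfolding piecewise_affine_def using nn
        by (simp add: max_absorb1 min_absorb2 order_trans[OF _ zero_le_one])
      then show ?thesis using x range[of 0] by simp
    qed
  qed
  fix A :: "real set" assume A: "A \<in> sets borel" "A \<subseteq> {0..1}"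
  have gm[measurable]: "?g \<in> borel_measurable borel"
    by (intro borel_measurable_continuous_onI continuous_on_piecewise_affine)
  have vm: "?g -` A \<in> sets borel" using measurable_sets[OF gm A(1)] by simp
  let ?W = "\<lambda>k. {t k<..t (Suc k)} \<inter> ?g -` A"
  have "emeasure lborel ({0..1} \<inter> ?g -` A) = emeasure lborel ({0..1} \<inter> ?g -` A - {0})"
    using vm by (intro emeasure_Diff_null_set[symmetric]) auto
  also have "{0..1} \<inter> ?g -` A - {0} = (\<Union>k\<in>{..<L}. ?W k)"
  proof -
    have "{0..1} - {0} = (\<Union>k\<in>{..<L}. {t k<..t (Suc k)})"
    proof (intro equalityI subsetI)
      fix x assume "x \<in> {0..1} - {0::real}"
      then have "t 0 < x" "x \<le> t L" using ends by auto
      then show "x \<in> (\<Union>k\<in>{..<L}. {t k<..t (Suc k)})" by (rule in_segment) auto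
    next
      fix x assume "x \<in> (\<Union>k\<in>{..<L}. {t k<..t (Suc k)})"
      then obtain k where "k < L" "t k < x" "x \<le> t (Suc k)" by auto
      then show "x \<in> {0..1} - {0}" using mono_le[of 0 k] mono_le[of "Suc k" L] ends by auto
    qed
    then show ?thesis by blast
  qed
  also have "emeasure lborel (\<Union>k\<in>{..<L}. ?W k) = (\<Sum>k<L. emeasure lborel (?W k))"
  proof (rule sum_emeasure[symmetric])
    show "disjoint_family_on ?W {..<L}"
      unfolding disjoint_family_on_def
    proof (intro ballI impI)
      have *: "?W i \<inter> ?W j = {}" if "i < j" "j < L" for i j
        using mono_le[of "Suc i" j] that by fastforce
      fix i j assume "i \<in> {..<L}" "j \<in> {..<L}" "i \<noteq> j"
      then show "?W i \<inter> ?W j = {}" using *[of i j] *[of j i] by (cases "i < j") auto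
    qed
  qed (use vm in auto)
  also have "\<dots> = (\<Sum>k<L. ennreal (?s k) * emeasure lborel (A \<inter> ?J k))"
  proof (rule sum.cong[OF refl])
    fix k assume k: "k \<in> {..<L}"
    show "emeasure lborel (?W k) = ennreal (?s k) * emeasure lborel (A \<inter> ?J k)"
    proof (cases "t k < t (Suc k)")
      case True
      then show ?thesis using emeasure_segment_vimage[of k A] k nd A by auto
    next
      case False
      then have "t k = t (Suc k)" using mono[of k] k by auto
      then show ?thesis by simp
    qed
  qed
  also have "\<dots> = (\<Sum>k<L. \<integral>\<^sup>+y. ennreal (?s k) * indicator (A \<inter> ?J k) y \<partial>lborel)"
    using A by (intro sum.cong refl) (subst nn_integral_cmult_indicator, auto)
  also have "\<dots> = (\<integral>\<^sup>+y. (\<Sum>k<L. ennreal (?s k) * indicator (A \<inter> ?J k) y) \<partial>lborel)"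
    using A by (intro nn_integral_sum[symmetric]) auto
  also have "\<dots> = (\<integral>\<^sup>+y. indicator A y \<partial>lborel)"
  proof (rule nn_integral_cong_AE)
    show "AE y in lborel. (\<Sum>k<L. ennreal (?s k) * indicator (A \<inter> ?J k) y) = indicator A y"
      using occ
    proof eventually_elim
      fix y assume y: "y \<in> {0..1} \<longrightarrow> (\<Sum>i<L. ?s i * indicator (?J i) y) = 1"
      have s: "0 \<le> ?s k" if "k < L" for k using mono[OF that] by simp
      show "(\<Sum>k<L. ennreal (?s k) * indicator (A \<inter> ?J k) y) = indicator A y"
      proof (cases "y \<in> A")
        case True
        have "(\<Sum>k<L. ennreal (?s k) * indicator (A \<inter> ?J k) y) = (\<Sum>k<L. ennreal (?s k * indicator (?J k) y))"
          using True by (intro sum.cong refl) (auto simp: indicator_def)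
        also have "\<dots> = ennreal (\<Sum>k<L. ?s k * indicator (?J k) y)"
          using s by (intro sum_ennreal mult_nonneg_nonneg) auto
        also have "(\<Sum>k<L. ?s k * indicator (?J k) y) = 1" using y True A by blast
        finally show ?thesis using True by simp
      qed simp
    qed
  qed
  also have "\<dots> = emeasure lborel A" using A by simp
  finally show "emeasure lborel ({0..1} \<inter> ?g -` A) = emeasure lborel A" .
qed

section \<open>The distribution of the pattern of a map\<close>

abbreviation sample_space :: "nat \<Rightarrow> (nat \<Rightarrow> real) measure" where
  "sample_space n \<equiv> \<Pi>\<^sub>M i\<in>{1..n}. unit_lebesgue"

lemma prob_space_sample_space: "prob_space (sample_space n)"
  by (intro prob_space_PiM prob_space_unit_lebesgue)

lemma pattern_restrict: "pattern n (restrict \<omega> {1..n}) = pattern n \<omega>"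
  by (rule pattern_cong_order) auto

text \<open>Sampling from the permuton of \<open>f\<close> is sampling \<open>n\<close> uniform points on the horizontal axis and
  lifting them to the graph.\<close>
lemma pattern_measure_map_permuton:
  assumes "f \<in> mspace C_lambda"
  shows "(\<lambda>x. pattern n (\<lambda>i. (x i, f (x i)))) \<in> sample_space n \<rightarrow>\<^sub>M count_space {\<pi>. \<pi> permutes {1..n}}"
    and "pattern_measure (map_permuton f) n =
      distr (sample_space n) (count_space {\<pi>. \<pi> permutes {1..n}}) (\<lambda>x. pattern n (\<lambda>i. (x i, f (x i))))"
proof -
  let ?S = "restrict_space borel ({0..1::real} \<times> {0..1::real})"
  let ?G = "\<lambda>x. (x, f x)"
  let ?P = "\<Pi>\<^sub>M i\<in>{1..n}. map_permuton f"
  have G: "?G \<in> unit_lebesgue \<rightarrow>\<^sub>M ?S" by (rule measurable_graph[OF C_lambdaD(3)[OF assms]])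
  have sets: "sets (map_permuton f) = sets ?S" by (simp add: map_permuton_def)
  have G': "?G \<in> unit_lebesgue \<rightarrow>\<^sub>M map_permuton f"
    using G by (simp add: measurable_cong_sets[OF refl sets])
  have ps: "prob_space (map_permuton f)"
    using permuton_map_permuton[OF assms] by (simp add: permuton_def)
  have "distr (sample_space n) ?P (compose {1..n} ?G) = (\<Pi>\<^sub>M i\<in>{1..n}. distr unit_lebesgue (map_permuton f) ?G)"
    using G' by (intro distr_PiM_finite_prob_space' prob_space_unit_lebesgue ps) auto
  also have "distr unit_lebesgue (map_permuton f) ?G = map_permuton f"
    unfolding map_permuton_def by (rule distr_cong) (simp_all add: map_permuton_def)
  finally have P: "distr (sample_space n) ?P (compose {1..n} ?G) = ?P" .
  have cm: "compose {1..n} ?G \<in> sample_space n \<rightarrow>\<^sub>M ?P"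
    unfolding compose_def
  proof (rule measurable_restrict)
    show "(\<lambda>x. (x i, f (x i))) \<in> sample_space n \<rightarrow>\<^sub>M map_permuton f" if "i \<in> {1..n}" for i
      using measurable_compose[OF measurable_component_singleton[OF that] G'] .
  qed
  have pm: "pattern n \<in> ?P \<rightarrow>\<^sub>M count_space {\<pi>. \<pi> permutes {1..n}}"
    by (intro measurable_pattern sets)
  have eq: "pattern n \<circ> compose {1..n} ?G = (\<lambda>x. pattern n (\<lambda>i. (x i, f (x i))))"
    using pattern_restrict by (auto simp: fun_eq_iff compose_def)
  show "(\<lambda>x. pattern n (\<lambda>i. (x i, f (x i)))) \<in> sample_space n \<rightarrow>\<^sub>M count_space {\<pi>. \<pi> permutes {1..n}}"
    using measurable_comp[OF cm pm] unfolding eq .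
  show "pattern_measure (map_permuton f) n =
      distr (sample_space n) (count_space {\<pi>. \<pi> permutes {1..n}}) (\<lambda>x. pattern n (\<lambda>i. (x i, f (x i))))"
    unfolding pattern_measure_def
    by (subst P[symmetric], subst distr_distr[OF pm cm]) (simp only: eq)
qed

definition pattern_prob :: "(real \<Rightarrow> real) \<Rightarrow> nat \<Rightarrow> (nat \<Rightarrow> nat) \<Rightarrow> real" where
  "pattern_prob f n \<pi> = measure (sample_space n) {x \<in> space (sample_space n). pattern n (\<lambda>i. (x i, f (x i))) = \<pi>}"

lemma pattern_event_sets:
  assumes "f \<in> mspace C_lambda"
  shows "{x \<in> space (sample_space n). pattern n (\<lambda>i. (x i, f (x i))) \<in> Q} \<in> sets (sample_space n)"
proof -
  have "(\<lambda>x. pattern n (\<lambda>i. (x i, f (x i)))) -` (Q \<inter> {\<pi>. \<pi> permutes {1..n}}) \<inter> space (sample_space n) \<in> sets (sample_space n)"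
    by (rule measurable_sets[OF pattern_measure_map_permuton(1)[OF assms]]) auto
  also have "(\<lambda>x. pattern n (\<lambda>i. (x i, f (x i)))) -` (Q \<inter> {\<pi>. \<pi> permutes {1..n}}) \<inter> space (sample_space n)
      = {x \<in> space (sample_space n). pattern n (\<lambda>i. (x i, f (x i))) \<in> Q}"
    using pattern_permutes by auto
  finally show ?thesis .
qed

lemma sum_pattern_prob:
  assumes "f \<in> mspace C_lambda" "finite Q"
  shows "(\<Sum>\<pi>\<in>Q. pattern_prob f n \<pi>) =
    measure (sample_space n) {x \<in> space (sample_space n). pattern n (\<lambda>i. (x i, f (x i))) \<in> Q}"
proof -
  interpret prob_space "sample_space n" by (rule prob_space_sample_space)
  let ?E = "\<lambda>\<pi>. {x \<in> space (sample_space n). pattern n (\<lambda>i. (x i, f (x i))) = \<pi>}"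
  have "{x \<in> space (sample_space n). pattern n (\<lambda>i. (x i, f (x i))) \<in> Q} = (\<Union>\<pi>\<in>Q. ?E \<pi>)" by auto
  moreover have "measure (sample_space n) (\<Union>\<pi>\<in>Q. ?E \<pi>) = (\<Sum>\<pi>\<in>Q. measure (sample_space n) (?E \<pi>))"
    using assms pattern_event_sets[OF assms(1), of n "{_}"]
    by (intro finite_measure_finite_Union) (auto simp: disjoint_family_on_def)
  ultimately show ?thesis by (simp add: pattern_prob_def)
qed

lemma pattern_prob_nonneg: "0 \<le> pattern_prob f n \<pi>"
  by (simp add: pattern_prob_def)

lemma sum_pattern_prob_permutes:
  assumes "f \<in> mspace C_lambda"
  shows "(\<Sum>\<pi> | \<pi> permutes {1..n}. pattern_prob f n \<pi>) = 1"
  using sum_pattern_prob[OF assms finite_permutations[of "{1..n}"], of n]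
    prob_space.prob_space[OF prob_space_sample_space]
  by (simp add: pattern_permutes del: One_nat_def)

lemma permuton_entropy_map_permuton:
  assumes "f \<in> mspace C_lambda"
  shows "permuton_entropy n (map_permuton f) =
    - (\<Sum>\<pi> | \<pi> permutes {1..n}. pattern_prob f n \<pi> * ln (pattern_prob f n \<pi>))"
proof -
  have "measure (pattern_measure (map_permuton f) n) {\<pi>} = pattern_prob f n \<pi>" if "\<pi> permutes {1..n}" for \<pi>
    unfolding pattern_measure_map_permuton(2)[OF assms] pattern_prob_def
    using that by (subst measure_distr[OF pattern_measure_map_permuton(1)[OF assms]])
      (auto intro!: arg_cong[where f="measure _"])
  then show ?thesis
    unfolding permuton_entropy_eq[OF permuton_map_permuton[OF assms]] by simp
qed

section \<open>Pairs of sample points\<close>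

lemma emeasure_PiM_pair:
  assumes M: "prob_space M" and I: "i \<in> I" "j \<in> I" "i \<noteq> j" "finite I" and E: "E \<in> sets (M \<Otimes>\<^sub>M M)"
  shows "emeasure (\<Pi>\<^sub>M i\<in>I. M) {x \<in> space (\<Pi>\<^sub>M i\<in>I. M). (x i, x j) \<in> E} = emeasure (M \<Otimes>\<^sub>M M) E"
proof -
  interpret M: prob_space M by fact
  interpret product_prob_space "\<lambda>_. M" I by unfold_locales
  let ?R = "\<lambda>x. restrict x {i, j}"
  let ?P2 = "\<Pi>\<^sub>M i\<in>{i, j}. M"
  have Rm: "?R \<in> (\<Pi>\<^sub>M i\<in>I. M) \<rightarrow>\<^sub>M ?P2" using I by (intro measurable_restrict_subset) auto
  have m2: "(\<lambda>\<sigma>. (\<sigma> i, \<sigma> j)) \<in> ?P2 \<rightarrow>\<^sub>M M \<Otimes>\<^sub>M M" by (intro measurable_Pair measurable_component_singleton) auto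
  let ?E2 = "(\<lambda>\<sigma>. (\<sigma> i, \<sigma> j)) -` E \<inter> space ?P2"
  have E2: "?E2 \<in> sets ?P2" by (rule measurable_sets[OF m2 E])
  have "{x \<in> space (\<Pi>\<^sub>M i\<in>I. M). (x i, x j) \<in> E} = ?R -` ?E2 \<inter> space (\<Pi>\<^sub>M i\<in>I. M)"
    using I by (auto simp: space_PiM)
  then have "emeasure (\<Pi>\<^sub>M i\<in>I. M) {x \<in> space (\<Pi>\<^sub>M i\<in>I. M). (x i, x j) \<in> E} = emeasure (distr (\<Pi>\<^sub>M i\<in>I. M) ?P2 ?R) ?E2"
    by (simp add: emeasure_distr[OF Rm E2])
  also have "distr (\<Pi>\<^sub>M i\<in>I. M) ?P2 ?R = ?P2" using I by (intro distr_PiM_restrict_finite) auto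
  also have "emeasure ?P2 ?E2 = (\<integral>\<^sup>+\<sigma>. indicator ?E2 \<sigma> \<partial>?P2)" using E2 by simp
  also have "\<dots> = (\<integral>\<^sup>+\<sigma>. (indicator E (\<sigma> i, \<sigma> j)) \<partial>?P2)"
    by (intro nn_integral_cong) (auto simp: indicator_def)
  also have "\<dots> = (\<integral>\<^sup>+z. indicator E (fst z, snd z) \<partial>(M \<Otimes>\<^sub>M M))"
    using I E product_nn_integral_pair[of "\<lambda>x y. indicator E (x, y)" i j] by simp
  also have "\<dots> = emeasure (M \<Otimes>\<^sub>M M) E" using E by simp
  finally show ?thesis .
qed

text \<open>A union bound over the pairs of indices; for one pair, two coordinates of the sample are
  independent, and the probability is the average of the sections of \<open>E\<close>.\<close>
lemma measure_some_pair_le: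
  assumes M: "prob_space M" and I: "finite I" and E: "E \<in> sets (M \<Otimes>\<^sub>M M)" and c: "c \<ge> 0"
    and sec: "\<And>x. x \<in> space M \<Longrightarrow> emeasure M (Pair x -` E) \<le> ennreal c"
  shows "{x \<in> space (\<Pi>\<^sub>M i\<in>I. M). \<exists>i\<in>I. \<exists>j\<in>I. i \<noteq> j \<and> (x i, x j) \<in> E} \<in> sets (\<Pi>\<^sub>M i\<in>I. M)" (is "?B \<in> _")
    and "measure (\<Pi>\<^sub>M i\<in>I. M) {x \<in> space (\<Pi>\<^sub>M i\<in>I. M). \<exists>i\<in>I. \<exists>j\<in>I. i \<noteq> j \<and> (x i, x j) \<in> E}
      \<le> (real (card I))\<^sup>2 * c"
proof -
  interpret M: prob_space M by fact
  interpret P: prob_space "\<Pi>\<^sub>M i\<in>I. M" by (intro prob_space_PiM M)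
  let ?P = "\<Pi>\<^sub>M i\<in>I. M"
  let ?K = "{(i, j). i \<in> I \<and> j \<in> I \<and> i \<noteq> j}"
  let ?A = "\<lambda>(i, j). {x \<in> space ?P. (x i, x j) \<in> E}"
  have fK: "finite ?K" using I by (intro finite_subset[of ?K "I \<times> I"]) auto
  have cK: "card ?K \<le> (card I)\<^sup>2"
    using card_mono[of "I \<times> I" ?K] I by (auto simp: card_cartesian_product power2_eq_square)
  have eq: "?B = (\<Union>k\<in>?K. ?A k)" by auto
  have A: "?A k \<in> sets ?P" if "k \<in> ?K" for k
  proof -
    obtain i j where k: "k = (i, j)" by (cases k)
    have m2: "(\<lambda>\<sigma>. (\<sigma> i, \<sigma> j)) \<in> ?P \<rightarrow>\<^sub>M M \<Otimes>\<^sub>M M"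
      using that k by (intro measurable_Pair measurable_component_singleton) auto
    show ?thesis using measurable_sets[OF m2 E] k by (simp add: vimage_def Int_def conj_commute)
  qed
  show "?B \<in> sets ?P" unfolding eq using fK A by (intro sets.finite_UN) auto
  have mA: "measure ?P (?A k) \<le> c" if "k \<in> ?K" for k
  proof -
    obtain i j where k: "k = (i, j)" by (cases k)
    have "emeasure ?P (?A k) = emeasure (M \<Otimes>\<^sub>M M) E"
      using that k I by (simp add: emeasure_PiM_pair[OF M _ _ _ _ E])
    also have "\<dots> = (\<integral>\<^sup>+x. emeasure M (Pair x -` E) \<partial>M)" by (rule M.emeasure_pair_measure_alt[OF E])
    also have "\<dots> \<le> (\<integral>\<^sup>+x. ennreal c \<partial>M)" by (intro nn_integral_mono sec)
    also have "\<dots> = ennreal c" by (simp add: M.emeasure_space_1)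
    finally show ?thesis using c by (simp add: P.emeasure_eq_measure)
  qed
  have "measure ?P ?B \<le> (\<Sum>k\<in>?K. measure ?P (?A k))"
    unfolding eq using fK A by (intro P.finite_measure_subadditive_finite) auto
  also have "\<dots> \<le> (\<Sum>k\<in>?K. c)" using mA by (rule sum_mono)
  also have "\<dots> = real (card ?K) * c" by simp
  also have "\<dots> \<le> real ((card I)\<^sup>2) * c" using cK c by (intro mult_right_mono of_nat_mono) auto
  finally show "measure ?P ?B \<le> (real (card I))\<^sup>2 * c" by simp
qed

lemma (in prob_space) prob_diff_le:
  assumes "A \<in> events" "B \<in> events" "N \<in> events" "A - N = B - N"
  shows "\<bar>prob A - prob B\<bar> \<le> prob N"
proof -
  have "prob A \<le> prob B + prob N" if "A \<in> events" "B \<in> events" "A - N = B - N" for A B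
  proof -
    have "prob A \<le> prob (B \<union> N)" using that assms by (intro finite_measure_mono) auto
    also have "\<dots> \<le> prob B + prob N" using that assms by (intro measure_Un_le) auto
    finally show ?thesis .
  qed
  from this[of A B] this[of B A] show ?thesis using assms by auto
qed

section \<open>Continuity of the entropy\<close>

lemma C_lambda_pair_measurable:
  assumes "f \<in> mspace C_lambda"
  shows "(\<lambda>z. f (fst z) - f (snd z)) \<in> borel_measurable (unit_lebesgue \<Otimes>\<^sub>M unit_lebesgue)"
proof -
  have l: "f \<in> borel_measurable unit_lebesgue"
    using C_lambdaD(3)[OF assms] unfolding measurable_cong_sets[OF refl sets_unit_lebesgue]
    by (simp add: measurable_restrict_space2_iff)
  show ?thesis
    by (intro borel_measurable_diff measurable_compose[OF measurable_fst l] measurable_compose[OF measurable_snd l])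
qed

text \<open>Because \<open>f\<close> preserves the measure, the second height is uniform when the first is fixed.\<close>
lemma near_collision_measure_le:
  assumes f: "f \<in> mspace C_lambda" and d: "d \<ge> 0"
  shows "{x \<in> space (sample_space n). \<exists>i\<in>{1..n}. \<exists>j\<in>{1..n}. i \<noteq> j \<and> \<bar>f (x i) - f (x j)\<bar> \<le> 2 * d} \<in> sets (sample_space n)"
      (is "?B \<in> _")
    and "measure (sample_space n) {x \<in> space (sample_space n).
      \<exists>i\<in>{1..n}. \<exists>j\<in>{1..n}. i \<noteq> j \<and> \<bar>f (x i) - f (x j)\<bar> \<le> 2 * d} \<le> real n ^ 2 * (4 * d)"
proof -
  let ?E = "{z \<in> space (unit_lebesgue \<Otimes>\<^sub>M unit_lebesgue). \<bar>f (fst z) - f (snd z)\<bar> \<le> 2 * d}"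
  have E: "?E \<in> sets (unit_lebesgue \<Otimes>\<^sub>M unit_lebesgue)"
    using C_lambda_pair_measurable[OF f] by measurable
  have sec: "emeasure unit_lebesgue (Pair x -` ?E) \<le> ennreal (4 * d)" if x: "x \<in> space unit_lebesgue" for x
  proof -
    let ?A = "{f x - 2 * d..f x + 2 * d} \<inter> {0..1}"
    have A: "?A \<in> sets unit_lebesgue" by (auto simp: sets_unit_lebesgue_iff)
    have "Pair x -` ?E = f -` ?A \<inter> {0..1}"
    proof (rule set_eqI)
      fix y
      have "y \<in> {0..1} \<Longrightarrow> f y \<in> {0..1}" by (rule C_lambdaD(2)[OF f])
      moreover have "\<bar>f x - f y\<bar> \<le> 2 * d \<longleftrightarrow> f y \<in> {f x - 2 * d..f x + 2 * d}" by auto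
      ultimately show "y \<in> Pair x -` ?E \<longleftrightarrow> y \<in> f -` ?A \<inter> {0..1}"
        using x unfolding vimage_def Int_iff mem_Collect_eq space_pair_measure by simp blast
    qed
    then have "emeasure unit_lebesgue (Pair x -` ?E) = emeasure unit_lebesgue ?A"
      using emeasure_vimage_C_lambda[OF f A] by simp
    also have "\<dots> = emeasure lborel ?A" using A by (simp add: emeasure_unit_lebesgue sets_unit_lebesgue_iff)
    also have "\<dots> \<le> emeasure lborel {f x - 2 * d..f x + 2 * d}" by (intro emeasure_mono) auto
    also have "\<dots> = ennreal (4 * d)" using d by simp
    finally show ?thesis .
  qed
  have eq: "?B = {x \<in> space (sample_space n). \<exists>i\<in>{1..n}. \<exists>j\<in>{1..n}. i \<noteq> j \<and> (x i, x j) \<in> ?E}"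
  proof -
    have "(x i, x j) \<in> ?E \<longleftrightarrow> \<bar>f (x i) - f (x j)\<bar> \<le> 2 * d"
      if "x \<in> space (sample_space n)" "i \<in> {1..n}" "j \<in> {1..n}" for x i j
      using that by (auto simp: space_PiM space_pair_measure PiE_iff)
    then show ?thesis by blast
  qed
  note * = measure_some_pair_le[OF prob_space_unit_lebesgue _ E _ sec, of "{1..n}"]
  show "?B \<in> sets (sample_space n)" unfolding eq using d by (intro *(1)) auto
  have "measure (sample_space n) ?B \<le> (real (card {1..n}))\<^sup>2 * (4 * d)"
    unfolding eq using d by (intro *(2)) auto
  then show "measure (sample_space n) ?B \<le> real n ^ 2 * (4 * d)" by simp
qed

text \<open>Two heights that differ by more than \<open>2 * d\<close> keep their order when each is moved by at most \<open>d\<close>.\<close>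
lemma pattern_prob_diff_le:
  assumes f: "f \<in> mspace C_lambda" and g: "g \<in> mspace C_lambda" and d: "d \<ge> 0"
    and close: "\<And>x. x \<in> {0..1} \<Longrightarrow> \<bar>f x - g x\<bar> \<le> d"
  shows "\<bar>pattern_prob f n \<pi> - pattern_prob g n \<pi>\<bar> \<le> real n ^ 2 * (4 * d)"
proof -
  interpret prob_space "sample_space n" by (rule prob_space_sample_space)
  define B where "B = {x \<in> space (sample_space n). \<exists>i\<in>{1..n}. \<exists>j\<in>{1..n}. i \<noteq> j \<and> \<bar>f (x i) - f (x j)\<bar> \<le> 2 * d}"
  let ?E = "\<lambda>f. {x \<in> space (sample_space n). pattern n (\<lambda>i. (x i, f (x i))) = \<pi>}"
  have same: "pattern n (\<lambda>i. (x i, f (x i))) = pattern n (\<lambda>i. (x i, g (x i)))"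
    if x: "x \<in> space (sample_space n)" "x \<notin> B" for x
  proof (rule pattern_cong_order)
    fix i j assume ij: "i \<in> {1..n}" "j \<in> {1..n}"
    have xi: "x i \<in> {0..1}" "x j \<in> {0..1}" using x ij by (auto simp: space_PiM PiE_iff)
    have "i \<noteq> j \<Longrightarrow> \<not> \<bar>f (x i) - f (x j)\<bar> \<le> 2 * d" using x ij unfolding B_def by blast
    then show "snd (x j, f (x j)) < snd (x i, f (x i)) \<longleftrightarrow> snd (x j, g (x j)) < snd (x i, g (x i))"
      using close[OF xi(1)] close[OF xi(2)] by (cases "i = j") auto
  qed auto
  then have "?E f - B = ?E g - B" by auto
  then have "\<bar>prob (?E f) - prob (?E g)\<bar> \<le> prob B"
    using pattern_event_sets[OF f, of n "{\<pi>}"] pattern_event_sets[OF g, of n "{\<pi>}"] near_collision_measure_le(1)[OF f d, of n, folded B_def]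
    by (intro prob_diff_le) auto
  also have "\<dots> \<le> real n ^ 2 * (4 * d)" unfolding B_def by (rule near_collision_measure_le(2)[OF f d])
  finally show ?thesis by (simp add: pattern_prob_def)
qed

lemma continuous_on_mult_ln: "continuous_on {0..} (\<lambda>x::real. x * ln x)"
proof (rule continuous_at_imp_continuous_on, rule ballI)
  \<comment> \<open>Only the continuity at \<open>0\<close> is at stake; it follows from \<open>ln (1 / s) \<le> 1 / s\<close> for \<open>s = sqrt x\<close>.\<close>
  have bound: "\<bar>x * ln x\<bar> \<le> 2 * sqrt \<bar>x\<bar>" if "\<bar>x\<bar> < 1" for x :: real
  proof (cases "x = 0")
    case False
    define s where "s = sqrt \<bar>x\<bar>"
    have s: "s > 0" "\<bar>x\<bar> = s\<^sup>2" using False by (auto simp: s_def)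
    have "s < 1" using that by (simp add: s_def)
    have lx: "ln x = 2 * ln s"
    proof -
      have "ln x = ln \<bar>x\<bar>" by (cases "x \<ge> 0") (auto simp: ln_minus)
      then show ?thesis using s by (simp add: ln_realpow)
    qed
    have "ln (1 / s) \<le> 1 / s" using s by (intro order_trans[OF ln_bound]) auto
    then have "- ln s \<le> 1 / s" using s by (simp add: ln_div)
    then have "s\<^sup>2 * (- ln s) \<le> s\<^sup>2 * (1 / s)" by (intro mult_left_mono) auto
    moreover have "ln s \<le> 0" using s \<open>s < 1\<close> by simp
    ultimately show ?thesis
      using s unfolding abs_mult lx s(2) s_def[symmetric] by (simp add: power2_eq_square)
  qed simp
  fix p :: real
  assume "p \<in> {0..}"
  show "isCont (\<lambda>x. x * ln x) p"
  proof (cases "p = 0")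
    case True
    have "((\<lambda>x::real. x * ln x) \<longlongrightarrow> 0) (at 0)"
    proof (rule Lim_null_comparison)
      have "eventually (\<lambda>x::real. \<bar>x\<bar> < 1) (at 0)"
        by (auto simp: eventually_at dist_real_def intro!: exI[of _ 1])
      then show "eventually (\<lambda>x::real. norm (x * ln x) \<le> 2 * sqrt \<bar>x\<bar>) (at 0)"
        by eventually_elim (use bound in simp)
      have "isCont (\<lambda>x::real. 2 * sqrt \<bar>x\<bar>) 0" by (intro continuous_intros)
      then show "((\<lambda>x::real. 2 * sqrt \<bar>x\<bar>) \<longlongrightarrow> 0) (at 0)" by (simp add: isCont_def)
    qed
    then show ?thesis using True by (simp add: isCont_def)
  qed (auto intro!: continuous_intros)
qed

lemma permuton_entropy_continuous:
  assumes f: "f \<in> mspace C_lambda" and e: "e > 0"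
  shows "\<exists>d>0. \<forall>g\<in>mspace C_lambda. mdist C_lambda f g < d \<longrightarrow>
    \<bar>permuton_entropy n (map_permuton g) - permuton_entropy n (map_permuton f)\<bar> < e"
proof -
  let ?S = "{\<pi>. \<pi> permutes {1..n}}"
  let ?\<eta> = "\<lambda>x::real. x * ln x"
  have fin: "finite ?S" by (simp add: finite_permutations)
  have ne: "id \<in> ?S" by (simp add: permutes_id)
  define e' where "e' = e / real (card ?S)"
  have cS: "card ?S > 0" using fin ne by (subst card_gt_0_iff) blast
  have e': "e' > 0" using e cS by (simp add: e'_def)
  have "\<exists>r>0. \<forall>y\<ge>0. \<bar>y - pattern_prob f n \<pi>\<bar> < r \<longrightarrow> \<bar>?\<eta> y - ?\<eta> (pattern_prob f n \<pi>)\<bar> < e'" for \<pi>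
    using bspec[OF continuous_on_mult_ln[unfolded continuous_on_iff dist_real_def],
        of "pattern_prob f n \<pi>"] pattern_prob_nonneg[of f n \<pi>] e'
    by (meson atLeast_iff)
  then obtain r where r: "\<And>\<pi>. r \<pi> > 0"
    "\<And>\<pi> y. y \<ge> 0 \<Longrightarrow> \<bar>y - pattern_prob f n \<pi>\<bar> < r \<pi> \<Longrightarrow> \<bar>?\<eta> y - ?\<eta> (pattern_prob f n \<pi>)\<bar> < e'"
    by metis
  define \<rho> where "\<rho> = Min (r ` ?S)"
  have \<rho>: "\<rho> > 0" "\<And>\<pi>. \<pi> \<in> ?S \<Longrightarrow> \<rho> \<le> r \<pi>"
  proof -
    have im: "finite (r ` ?S)" "r ` ?S \<noteq> {}" using fin ne by blast+
    show "\<rho> > 0" unfolding \<rho>_def using im r by (subst Min_gr_iff) blast+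
    show "\<rho> \<le> r \<pi>" if "\<pi> \<in> ?S" for \<pi>
      unfolding \<rho>_def using im that by (intro Min_le) blast+
  qed
  define d where "d = \<rho> / (4 * real n ^ 2 + 1)"
  have pos: "4 * real n ^ 2 + 1 > 0" by (simp add: add_nonneg_pos)
  have d: "d > 0" using \<rho> pos by (simp add: d_def)
  have dr: "real n ^ 2 * (4 * d) < \<rho>"
  proof -
    have "\<rho> = (4 * real n ^ 2 + 1) * d" using pos by (simp add: d_def)
    then show ?thesis using d by (simp add: algebra_simps)
  qed
  show ?thesis
  proof (intro exI[of _ d] conjI ballI impI d)
    fix g assume g: "g \<in> mspace C_lambda" and fg: "mdist C_lambda f g < d"
    have close: "\<bar>f x - g x\<bar> \<le> d" if "x \<in> {0..1}" for x
      using mdist_C_lambda_le[OF f g, of d] fg that by auto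
    have "\<bar>?\<eta> (pattern_prob g n \<pi>) - ?\<eta> (pattern_prob f n \<pi>)\<bar> < e'" if "\<pi> \<in> ?S" for \<pi>
      using pattern_prob_diff_le[OF f g _ close, of n \<pi>] d dr \<rho>(2)[OF that]
      by (intro r pattern_prob_nonneg) auto
    then have "(\<Sum>\<pi>\<in>?S. \<bar>?\<eta> (pattern_prob g n \<pi>) - ?\<eta> (pattern_prob f n \<pi>)\<bar>) < (\<Sum>\<pi>\<in>?S. e')"
      using fin ne by (intro sum_strict_mono) blast+
    also have "\<dots> = e" using cS by (simp add: e'_def)
    finally have "\<bar>\<Sum>\<pi>\<in>?S. ?\<eta> (pattern_prob g n \<pi>) - ?\<eta> (pattern_prob f n \<pi>)\<bar> < e"
      using sum_abs[of "\<lambda>\<pi>. ?\<eta> (pattern_prob g n \<pi>) - ?\<eta> (pattern_prob f n \<pi>)" ?S] by linarith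
    then show "\<bar>permuton_entropy n (map_permuton g) - permuton_entropy n (map_permuton f)\<bar> < e"
      unfolding permuton_entropy_map_permuton[OF f] permuton_entropy_map_permuton[OF g]
      by (simp add: sum_subtractf abs_minus_commute)
  qed
qed

text \<open>Keeps the index set \<open>{1..n}\<close> of a sample from being rewritten.\<close>
declare One_nat_def [simp del]

section \<open>Patterns with independent heights\<close>

text \<open>Without ties, the rank is the number of smaller or equal values, whatever the labels.\<close>
lemma sample_rank_compose:
  assumes "inj_on x {1..n}" "\<tau> permutes {1..n}" "i \<in> {1..n}"
  shows "sample_rank n (x \<circ> \<tau>) i = sample_rank n x (\<tau> i)"
proof -
  have \<tau>: "\<tau> j \<in> {1..n} \<longleftrightarrow> j \<in> {1..n}" for j using assms by (simp only: permutes_in_image)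
  have eq: "x (\<tau> j) = x (\<tau> i) \<longleftrightarrow> j = i" if "j \<in> {1..n}" for j
    using inj_on_eq_iff[OF assms(1), of "\<tau> j" "\<tau> i"] \<tau>[of j] \<tau>[of i] that assms(3)
      permutes_inj[OF assms(2)] by (auto dest: injD)
  have "{j \<in> {1..n}. x j < x (\<tau> i) \<or> x j = x (\<tau> i) \<and> j \<le> \<tau> i} = \<tau> ` {j \<in> {1..n}. x (\<tau> j) < x (\<tau> i) \<or> x (\<tau> j) = x (\<tau> i) \<and> j \<le> i}"
    (is "?L = \<tau> ` ?R")
  proof (intro equalityI subsetI)
    fix j assume j: "j \<in> ?L"
    then obtain k where k: "j = \<tau> k" using permutes_surj[OF assms(2)] by (metis surjD)
    then have "k \<in> {1..n}" using j \<tau> by blast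
    then have "k \<in> ?R" using j eq[of k] unfolding k by auto
    then show "j \<in> \<tau> ` ?R" using k by blast
  next
    fix j assume "j \<in> \<tau> ` ?R"
    then obtain k where "k \<in> ?R" "j = \<tau> k" by blast
    then show "j \<in> ?L" using eq[of k] \<tau>[of k] by auto
  qed
  then show ?thesis
    using permutes_inj_on[OF assms(2)] by (simp add: sample_rank_def card_image)
qed

text \<open>With the heights fixed, the pattern tells the horizontal rank of every point, hence how the
  horizontal coordinates were distributed among the points.\<close>
lemma pattern_compose_inj:
  assumes x: "inj_on x {1..n}" and \<sigma>: "\<sigma> permutes {1..n}" and \<tau>: "\<tau> permutes {1..n}"
    and eq: "pattern n (\<lambda>i. (x (\<sigma> i), y i)) = pattern n (\<lambda>i. (x (\<tau> i), y i))"
  shows "\<sigma> = \<tau>"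
proof
  fix i
  show "\<sigma> i = \<tau> i"
  proof (cases "i \<in> {1..n}")
    case True
    let ?P = "pattern n (\<lambda>i. (x (\<sigma> i), y i))"
    have c: "fst \<circ> (\<lambda>i. (x (\<rho> i), y i)) = x \<circ> \<rho>" "snd \<circ> (\<lambda>i. (x (\<rho> i), y i)) = y" for \<rho> by auto
    have r: "pattern n (\<lambda>i. (x (\<rho> i), y i)) (sample_rank n x (\<rho> i)) = sample_rank n y i"
      if "\<rho> permutes {1..n}" for \<rho>
      using pattern_rank[OF True, of "\<lambda>i. (x (\<rho> i), y i)"]
      by (simp only: c sample_rank_compose[OF x that True])
    have "?P (sample_rank n x (\<sigma> i)) = ?P (sample_rank n x (\<tau> i))"
      using r[OF \<sigma>] r[OF \<tau>] eq by simp
    then have "sample_rank n x (\<sigma> i) = sample_rank n x (\<tau> i)"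
      using permutes_inj[OF pattern_permutes[of n]] by (auto dest: injD)
    then show ?thesis
      using bij_betw_imp_inj_on[OF bij_betw_sample_rank[of n x]] True \<sigma> \<tau>
      by (meson inj_on_eq_iff permutes_in_image)
  qed (use \<sigma> \<tau> in \<open>simp add: permutes_not_in\<close>)
qed

lemma pattern_event_measurable:
  "{\<omega> \<in> space (\<Pi>\<^sub>M i\<in>{1..n}. borel \<Otimes>\<^sub>M borel). inj_on (fst \<circ> \<omega>) {1..n} \<and> pattern n \<omega> = \<pi>}
    \<in> sets (\<Pi>\<^sub>M i\<in>{1..n}. (borel :: real measure) \<Otimes>\<^sub>M (borel :: real measure))"
proof (cases "\<pi> permutes {1..n}")
  case True
  let ?M = "\<Pi>\<^sub>M i\<in>{1..n}. (borel :: real measure) \<Otimes>\<^sub>M (borel :: real measure)"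
  have F: "(\<lambda>\<omega>. (fst \<circ> \<omega>) j) \<in> borel_measurable ?M" and S: "(\<lambda>\<omega>. (snd \<circ> \<omega>) j) \<in> borel_measurable ?M"
    if "j \<in> {1..n}" for j
    using measurable_compose[OF measurable_component_singleton[OF that] measurable_fst]
      measurable_compose[OF measurable_component_singleton[OF that] measurable_snd] by simp_all
  have [measurable]:
    "(\<lambda>\<omega>. sample_rank n (fst \<circ> \<omega>) i) \<in> ?M \<rightarrow>\<^sub>M count_space UNIV"
    "(\<lambda>\<omega>. sample_rank n (snd \<circ> \<omega>) i) \<in> ?M \<rightarrow>\<^sub>M count_space UNIV" if "i \<in> {1..n}" for i
    using that F S by (auto intro!: measurable_sample_rank simp del: comp_apply)
  have D: "{\<omega> \<in> space ?M. (fst \<circ> \<omega>) i = (fst \<circ> \<omega>) j \<longrightarrow> i = j} \<in> sets ?M" if "i \<in> {1..n}" "j \<in> {1..n}" for i j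
    using borel_measurable_eq[OF F[OF that(1)] F[OF that(2)]] by (cases "i = j") (auto intro: sets.sets_Collect_neg)
  have "{\<omega> \<in> space ?M. \<forall>i\<in>{1..n}. \<forall>j\<in>{1..n}. (fst \<circ> \<omega>) i = (fst \<circ> \<omega>) j \<longrightarrow> i = j} \<in> sets ?M"
    using D by (intro sets.sets_Collect_finite_All) auto
  moreover have "{\<omega> \<in> space ?M. \<forall>i\<in>{1..n}. \<pi> (sample_rank n (fst \<circ> \<omega>) i) = sample_rank n (snd \<circ> \<omega>) i} \<in> sets ?M"
    by measurable
  ultimately have "{\<omega> \<in> space ?M. (\<forall>i\<in>{1..n}. \<forall>j\<in>{1..n}. (fst \<circ> \<omega>) i = (fst \<circ> \<omega>) j \<longrightarrow> i = j) \<and>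
      (\<forall>i\<in>{1..n}. \<pi> (sample_rank n (fst \<circ> \<omega>) i) = sample_rank n (snd \<circ> \<omega>) i)} \<in> sets ?M"
    by (intro sets.sets_Collect_conj)
  then show ?thesis unfolding pattern_eq_iff[OF True] inj_on_def .
next
  case False
  then have "{\<omega> \<in> space (\<Pi>\<^sub>M i\<in>{1..n}. (borel :: real measure) \<Otimes>\<^sub>M (borel :: real measure)).
      inj_on (fst \<circ> \<omega>) {1..n} \<and> pattern n \<omega> = \<pi>} = {}"
    using pattern_permutes by auto
  then show ?thesis by (simp only: sets.empty_sets)
qed

text \<open>Permuting the horizontal coordinates among the points preserves the product measure. The \<open>fact n\<close>
  permutations move \<open>W\<close> to disjoint events, since they produce different patterns for the
  same heights.\<close>
lemma measure_pattern_fixed_heights_le: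
  fixes M :: "real measure"
  assumes M: "prob_space M" and W: "W \<in> sets (\<Pi>\<^sub>M i\<in>{1..n}. M)"
    and W_sub: "\<And>x. x \<in> W \<Longrightarrow> inj_on x {1..n} \<and> pattern n (\<lambda>i. (x i, y i)) = \<pi>"
  shows "measure (\<Pi>\<^sub>M i\<in>{1..n}. M) W \<le> 1 / fact n"
proof -
  let ?P = "\<Pi>\<^sub>M i\<in>{1..n}. M"
  interpret P: prob_space ?P by (intro prob_space_PiM M)
  let ?S = "{\<tau>. \<tau> permutes {1..n}}"
  let ?T = "\<lambda>\<tau> x. \<lambda>i\<in>{1..n}. x (\<tau> i)"
  let ?W = "\<lambda>\<tau>. ?T \<tau> -` W \<inter> space ?P"
  have Tm: "?T \<tau> \<in> ?P \<rightarrow>\<^sub>M ?P" if "\<tau> \<in> ?S" for \<tau>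
  proof (rule measurable_restrict)
    fix i assume "i \<in> {1..n}"
    then have "\<tau> i \<in> {1..n}" using that by (simp only: mem_Collect_eq permutes_in_image)
    then show "(\<lambda>x. x (\<tau> i)) \<in> ?P \<rightarrow>\<^sub>M M" by (rule measurable_component_singleton)
  qed
  have dist: "distr ?P ?P (?T \<tau>) = ?P" if "\<tau> \<in> ?S" for \<tau>
  proof (rule distr_PiM_reindex)
    have \<tau>: "\<tau> permutes {1..n}" using that by blast
    show "inj_on \<tau> {1..n}" by (rule permutes_inj_on[OF \<tau>])
    show "\<tau> \<in> {1..n} \<rightarrow> {1..n}" unfolding Pi_iff using permutes_in_image[OF \<tau>] by blast
  qed (rule M)
  have meas: "P.prob (?W \<tau>) = P.prob W" if "\<tau> \<in> ?S" for \<tau>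
    using measure_distr[OF Tm[OF that] W] dist[OF that] by simp
  have disj: "disjoint_family_on ?W ?S"
    unfolding disjoint_family_on_def
  proof (intro ballI impI)
    fix \<sigma> \<tau> assume st: "\<sigma> \<in> ?S" "\<tau> \<in> ?S" "\<sigma> \<noteq> \<tau>"
    show "?W \<sigma> \<inter> ?W \<tau> = {}"
    proof (rule ccontr)
      assume "?W \<sigma> \<inter> ?W \<tau> \<noteq> {}"
      then obtain x where x: "?T \<sigma> x \<in> W" "?T \<tau> x \<in> W" by blast
      have pat: "pattern n (\<lambda>i. (x (\<rho> i), y i)) = \<pi>" if "?T \<rho> x \<in> W" for \<rho>
      proof -
        have "pattern n (\<lambda>i. (x (\<rho> i), y i)) = pattern n (\<lambda>i. (?T \<rho> x i, y i))"
          by (rule pattern_cong_order) auto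
        then show ?thesis using W_sub[OF that] by simp
      qed
      have "inj_on (?T \<sigma> x) {1..n}" using W_sub[OF x(1)] by blast
      then have "inj_on (x \<circ> \<sigma>) {1..n}"
        by (rule inj_on_cong[THEN iffD1, rotated]) (simp only: restrict_apply' comp_apply)
      then have "inj_on x (\<sigma> ` {1..n})" by (rule inj_on_imageI)
      moreover have "\<sigma> ` {1..n} = {1..n}" using st(1) permutes_image by blast
      ultimately have "inj_on x {1..n}" by (simp only:)
      from pattern_compose_inj[OF this, of \<sigma> \<tau> y] st pat[OF x(1)] pat[OF x(2)] show False
        by (metis mem_Collect_eq)
    qed
  qed
  have "fact n * P.prob W = (\<Sum>\<tau>\<in>?S. P.prob (?W \<tau>))"
    using card_permutations[of "{1..n}" n] by (simp add: meas)
  also have "\<dots> = P.prob (\<Union>\<tau>\<in>?S. ?W \<tau>)"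
    using disj Tm W finite_permutations[of "{1..n}"]
    by (intro P.finite_measure_finite_Union[symmetric]) (auto simp del: One_nat_def intro!: measurable_sets)
  also have "\<dots> \<le> 1" by (rule P.prob_le_1)
  finally show ?thesis by (simp add: field_simps)
qed

text \<open>Independent pairs with independent components are the same as two independent samples. This makes
  it possible to fix all heights and vary the horizontal coordinates.\<close>
lemma distr_PiM_pair:
  assumes M: "prob_space M" and N: "prob_space N" and I: "finite I"
  shows "distr ((\<Pi>\<^sub>M i\<in>I. M) \<Otimes>\<^sub>M (\<Pi>\<^sub>M i\<in>I. N)) (\<Pi>\<^sub>M i\<in>I. M \<Otimes>\<^sub>M N) (\<lambda>z. \<lambda>i\<in>I. (fst z i, snd z i)) =
    (\<Pi>\<^sub>M i\<in>I. M \<Otimes>\<^sub>M N)"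
    and "(\<lambda>z. \<lambda>i\<in>I. (fst z i, snd z i)) \<in> (\<Pi>\<^sub>M i\<in>I. M) \<Otimes>\<^sub>M (\<Pi>\<^sub>M i\<in>I. N) \<rightarrow>\<^sub>M (\<Pi>\<^sub>M i\<in>I. M \<Otimes>\<^sub>M N)"
proof -
  interpret M: prob_space M by fact
  interpret N: prob_space N by fact
  interpret MN: pair_prob_space M N by unfold_locales
  interpret PM: prob_space "\<Pi>\<^sub>M i\<in>I. M" by (intro prob_space_PiM M)
  interpret PN: prob_space "\<Pi>\<^sub>M i\<in>I. N" by (intro prob_space_PiM N)
  interpret Mp: product_prob_space "\<lambda>_. M" I by unfold_locales
  interpret Np: product_prob_space "\<lambda>_. N" I by unfold_locales
  interpret MNp: product_prob_space "\<lambda>_. M \<Otimes>\<^sub>M N" I by unfold_locales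
  let ?T = "\<lambda>z. \<lambda>i\<in>I. (fst z i, snd z i)"
  let ?Z = "(\<Pi>\<^sub>M i\<in>I. M) \<Otimes>\<^sub>M (\<Pi>\<^sub>M i\<in>I. N)"
  show Tm: "?T \<in> ?Z \<rightarrow>\<^sub>M (\<Pi>\<^sub>M i\<in>I. M \<Otimes>\<^sub>M N)"
    by measurable
  show "distr ?Z (\<Pi>\<^sub>M i\<in>I. M \<Otimes>\<^sub>M N) ?T = (\<Pi>\<^sub>M i\<in>I. M \<Otimes>\<^sub>M N)"
  proof (rule MNp.PiM_eqI[OF I])
    fix A assume A: "\<And>i. i \<in> I \<Longrightarrow> A i \<in> sets (M \<Otimes>\<^sub>M N)"
    have PA: "Pi\<^sub>E I A \<in> sets (\<Pi>\<^sub>M i\<in>I. M \<Otimes>\<^sub>M N)" using A I by (intro sets_PiM_I_finite) auto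
    have ind: "(\<lambda>y. indicator (A i) (x, y)) \<in> borel_measurable N" if "i \<in> I" "x \<in> space M" for i and x
      using A[OF that(1)] that(2) by (intro measurable_compose[OF measurable_Pair1' borel_measurable_indicator]) auto
    have "emeasure (distr ?Z (\<Pi>\<^sub>M i\<in>I. M \<Otimes>\<^sub>M N) ?T) (Pi\<^sub>E I A) = (\<integral>\<^sup>+z. indicator (Pi\<^sub>E I A) (?T z) \<partial>?Z)"
      using nn_integral_distr[OF Tm, of "indicator (Pi\<^sub>E I A)"] PA by simp
    also have "\<dots> = (\<integral>\<^sup>+x. \<integral>\<^sup>+y. indicator (Pi\<^sub>E I A) (?T (x, y)) \<partial>(\<Pi>\<^sub>M i\<in>I. N) \<partial>(\<Pi>\<^sub>M i\<in>I. M))"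
      using PA Tm by (intro PN.nn_integral_fst[symmetric] measurable_compose[OF Tm] borel_measurable_indicator)
    also have "\<dots> = (\<integral>\<^sup>+x. \<integral>\<^sup>+y. (\<Prod>i\<in>I. indicator (A i) (x i, y i)) \<partial>(\<Pi>\<^sub>M i\<in>I. N) \<partial>(\<Pi>\<^sub>M i\<in>I. M))"
      using I by (intro nn_integral_cong) (auto simp: indicator_def PiE_iff prod_eq_1_iff split: if_splits)
    \<comment> \<open>The \<open>A i\<close> need not be rectangles, so the two product measures are integrated out in turn.\<close>
    also have "\<dots> = (\<integral>\<^sup>+x. (\<Prod>i\<in>I. \<integral>\<^sup>+y. indicator (A i) (x i, y) \<partial>N) \<partial>(\<Pi>\<^sub>M i\<in>I. M))"
      using I ind by (intro nn_integral_cong Np.product_nn_integral_prod) (auto simp: space_PiM PiE_iff)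
    also have "\<dots> = (\<Prod>i\<in>I. \<integral>\<^sup>+x. \<integral>\<^sup>+y. indicator (A i) (x, y) \<partial>N \<partial>M)"
      using I A by (intro Mp.product_nn_integral_prod N.borel_measurable_nn_integral_fst) auto
    also have "\<dots> = (\<Prod>i\<in>I. emeasure (M \<Otimes>\<^sub>M N) (A i))"
      using A by (intro prod.cong refl N.emeasure_pair_measure[symmetric])
    finally show "emeasure (distr ?Z (\<Pi>\<^sub>M i\<in>I. M \<Otimes>\<^sub>M N) ?T) (Pi\<^sub>E I A) = (\<Prod>i\<in>I. emeasure (M \<Otimes>\<^sub>M N) (A i))" .
  qed simp
qed

text \<open>When the heights are independent of the horizontal positions, all \<open>fact n\<close> patterns are equally
  likely on the event that the positions are distinct.\<close>
lemma emeasure_pattern_independent_le: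
  fixes M N :: "real measure"
  assumes M: "prob_space M" "sets M = sets borel" and N: "prob_space N" "sets N = sets borel"
  shows "emeasure (\<Pi>\<^sub>M i\<in>{1..n}. M \<Otimes>\<^sub>M N)
    {\<omega> \<in> space (\<Pi>\<^sub>M i\<in>{1..n}. borel \<Otimes>\<^sub>M borel). inj_on (fst \<circ> \<omega>) {1..n} \<and> pattern n \<omega> = \<pi>}
    \<le> ennreal (1 / fact n)"
proof -
  let ?P = "\<Pi>\<^sub>M i\<in>{1..n}. M" and ?Q = "\<Pi>\<^sub>M i\<in>{1..n}. N" and ?R = "\<Pi>\<^sub>M i\<in>{1..n}. M \<Otimes>\<^sub>M N"
  interpret P: prob_space ?P by (intro prob_space_PiM M)
  interpret Q: prob_space ?Q by (intro prob_space_PiM N)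
  interpret PQ: pair_prob_space ?P ?Q by unfold_locales
  define W where "W = {\<omega> \<in> space (\<Pi>\<^sub>M i\<in>{1..n}. (borel::real measure) \<Otimes>\<^sub>M (borel::real measure)).
    inj_on (fst \<circ> \<omega>) {1..n} \<and> pattern n \<omega> = \<pi>}"
  let ?T = "\<lambda>z. \<lambda>i\<in>{1..n}. (fst z i, snd z i)"
  have sR: "sets ?R = sets (\<Pi>\<^sub>M i\<in>{1..n}. borel \<Otimes>\<^sub>M borel)"
    by (intro sets_PiM_cong sets_pair_measure_cong M N refl)
  have W: "W \<in> sets ?R" unfolding sR W_def by (rule pattern_event_measurable)
  have T: "distr (?P \<Otimes>\<^sub>M ?Q) ?R ?T = ?R" "?T \<in> ?P \<Otimes>\<^sub>M ?Q \<rightarrow>\<^sub>M ?R"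
    using distr_PiM_pair[OF M(1) N(1), of "{1..n}"] by auto
  let ?V = "?T -` W \<inter> space (?P \<Otimes>\<^sub>M ?Q)"
  have V: "?V \<in> sets (?P \<Otimes>\<^sub>M ?Q)" by (rule measurable_sets[OF T(2) W])
  have "emeasure ?R W = emeasure (?P \<Otimes>\<^sub>M ?Q) ?V"
    using emeasure_distr[OF T(2) W] by (simp only: T(1))
  also have "\<dots> = (\<integral>\<^sup>+y. emeasure ?P ((\<lambda>x. (x, y)) -` ?V) \<partial>?Q)"
    by (rule PQ.emeasure_pair_measure_alt2[OF V])
  also have "\<dots> \<le> (\<integral>\<^sup>+y. ennreal (1 / fact n) \<partial>?Q)"
  proof (rule nn_integral_mono)
    fix y
    have "measure ?P ((\<lambda>x. (x, y)) -` ?V) \<le> 1 / fact n"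
    proof (rule measure_pattern_fixed_heights_le[OF M(1)])
      show "(\<lambda>x. (x, y)) -` ?V \<in> sets ?P" using V by (rule sets_Pair2)
      fix x assume "x \<in> (\<lambda>x. (x, y)) -` ?V"
      then have w: "(\<lambda>i\<in>{1..n}. (x i, y i)) \<in> W" by auto
      then have "inj_on (fst \<circ> (\<lambda>i\<in>{1..n}. (x i, y i))) {1..n}" unfolding W_def by blast
      then have "inj_on x {1..n}"
        by (rule inj_on_cong[THEN iffD1, rotated]) (simp only: restrict_apply' comp_apply fst_conv)
      moreover have "pattern n (\<lambda>i\<in>{1..n}. (x i, y i)) = \<pi>" using w unfolding W_def by blast
      ultimately show "inj_on x {1..n} \<and> pattern n (\<lambda>i. (x i, y i)) = \<pi>"
        by (simp only: pattern_restrict simp_thms)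
    qed
    then show "emeasure ?P ((\<lambda>x. (x, y)) -` ?V) \<le> ennreal (1 / fact n)"
      unfolding P.emeasure_eq_measure by (rule ennreal_leI)
  qed
  also have "\<dots> = ennreal (1 / fact n)" by (simp add: Q.emeasure_space_1)
  finally show ?thesis unfolding W_def .
qed

section \<open>Domination by independent heights\<close>

text \<open>Fubini, one coordinate at a time: each coordinate costs a factor \<open>c\<close>.\<close>
lemma nn_integral_PiM_dominated:
  assumes A: "prob_space A" and B: "prob_space B" and sets: "sets A = sets B"
    and dom: "\<And>X. X \<in> sets A \<Longrightarrow> emeasure A X \<le> c * emeasure B X" and I: "finite I"
    and F: "F \<in> borel_measurable (\<Pi>\<^sub>M i\<in>I. A)"
  shows "(\<integral>\<^sup>+x. F x \<partial>(\<Pi>\<^sub>M i\<in>I. A)) \<le> c ^ card I * (\<integral>\<^sup>+x. F x \<partial>(\<Pi>\<^sub>M i\<in>I. B))"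
  using I F
proof (induction I arbitrary: F rule: finite_induct)
  case empty
  then show ?case by (simp add: PiM_empty)
next
  case (insert i I)
  interpret A: prob_space A by fact
  interpret B: prob_space B by fact
  interpret Ap: product_sigma_finite "\<lambda>_. A" by unfold_locales
  interpret Bp: product_sigma_finite "\<lambda>_. B" by unfold_locales
  have le: "(\<integral>\<^sup>+x. h x \<partial>A) \<le> c * (\<integral>\<^sup>+x. h x \<partial>B)" if h: "h \<in> borel_measurable A" for h
  proof -
    have hB: "h \<in> borel_measurable B" using h by (simp add: measurable_cong_sets[OF sets refl])
    have "A \<le> scale_measure c B"
      unfolding le_measure_iff le_fun_def
      using sets dom sets_eq_imp_space_eq[OF sets]
      by (simp add: space_scale_measure) (metis emeasure_notin_sets order_refl zero_le)
    then have "(\<integral>\<^sup>+x. h x \<partial>A) \<le> (\<integral>\<^sup>+x. h x \<partial>scale_measure c B)"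
      using sets by (intro nn_integral_mono_measure) auto
    then show ?thesis using hB by (simp add: nn_integral_scale_measure)
  qed
  have sP: "sets (\<Pi>\<^sub>M i\<in>J. A) = sets (\<Pi>\<^sub>M i\<in>J. B)" for J
    by (intro sets_PiM_cong sets refl)
  have FB: "F \<in> borel_measurable (\<Pi>\<^sub>M i\<in>insert i I. B)"
    using insert.prems by (simp add: measurable_cong_sets[OF sP refl])
  have m: "(\<lambda>z. F ((fst z)(i := snd z))) \<in> borel_measurable ((\<Pi>\<^sub>M i\<in>I. A) \<Otimes>\<^sub>M A)"
    using measurable_compose[OF measurable_add_dim insert.prems] by (simp add: split_beta' fun_upd_def)
  have mB: "(\<lambda>z. F ((fst z)(i := snd z))) \<in> borel_measurable ((\<Pi>\<^sub>M i\<in>I. A) \<Otimes>\<^sub>M B)"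
    using m by (simp add: measurable_cong_sets[OF sets_pair_measure_cong[OF refl sets] refl])
  have "(\<integral>\<^sup>+x. F x \<partial>(\<Pi>\<^sub>M i\<in>insert i I. A)) = (\<integral>\<^sup>+x. \<integral>\<^sup>+y. F (x(i := y)) \<partial>A \<partial>(\<Pi>\<^sub>M i\<in>I. A))"
    using insert by (intro Ap.product_nn_integral_insert) auto
  also have "\<dots> \<le> (\<integral>\<^sup>+x. c * (\<integral>\<^sup>+y. F (x(i := y)) \<partial>B) \<partial>(\<Pi>\<^sub>M i\<in>I. A))"
  proof (intro nn_integral_mono le)
    fix x assume "x \<in> space (\<Pi>\<^sub>M i\<in>I. A)"
    then show "(\<lambda>y. F (x(i := y))) \<in> borel_measurable A"
      using measurable_compose[OF measurable_Pair1' m] by simp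
  qed
  also have "\<dots> = c * (\<integral>\<^sup>+x. \<integral>\<^sup>+y. F (x(i := y)) \<partial>B \<partial>(\<Pi>\<^sub>M i\<in>I. A))"
    using B.borel_measurable_nn_integral_fst[OF mB] by (intro nn_integral_cmult) (simp only: fst_conv snd_conv)
  also have "\<dots> \<le> c * (c ^ card I * (\<integral>\<^sup>+x. \<integral>\<^sup>+y. F (x(i := y)) \<partial>B \<partial>(\<Pi>\<^sub>M i\<in>I. B)))"
    using B.borel_measurable_nn_integral_fst[OF mB] by (intro mult_left_mono insert.IH) (simp_all only: fst_conv snd_conv zero_le)
  also have "(\<integral>\<^sup>+x. \<integral>\<^sup>+y. F (x(i := y)) \<partial>B \<partial>(\<Pi>\<^sub>M i\<in>I. B)) = (\<integral>\<^sup>+x. F x \<partial>(\<Pi>\<^sub>M i\<in>insert i I. B))"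
    using insert.hyps FB by (intro Bp.product_nn_integral_insert[symmetric]) auto
  finally show ?case using insert.hyps by (simp add: mult.assoc)
qed

text \<open>The map \<open>c\<close> rounds the horizontal coordinate to a cell. If the points lie in different cells,
  rounding keeps their horizontal order and hence the pattern. The rounded point \<open>(c x, g x)\<close> is
  distributed like a pair with independent uniform height, up to the factor \<open>m\<close>, so the bound
  \<open>1 / fact n\<close> for independent heights is lost by at most \<open>m ^ n\<close>.\<close>
lemma pattern_prob_le_dominated:
  fixes c :: "real \<Rightarrow> real"
  assumes g: "g \<in> mspace C_lambda" and c: "mono c" and m: "m \<ge> 0" and \<delta>: "\<delta> \<ge> 0"
    and dom: "\<And>X. X \<in> sets (borel \<Otimes>\<^sub>M borel) \<Longrightarrow> emeasure unit_lebesgue {x \<in> {0..1}. (c x, g x) \<in> X}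
      \<le> ennreal m * (\<integral>\<^sup>+x. emeasure unit_lebesgue {y \<in> {0..1}. (c x, y) \<in> X} \<partial>unit_lebesgue)"
    and cell: "\<And>x. x \<in> {0..1} \<Longrightarrow> emeasure unit_lebesgue {y \<in> {0..1}. c x = c y} \<le> ennreal \<delta>"
  shows "pattern_prob g n \<pi> \<le> m ^ n / fact n + (real n)\<^sup>2 * \<delta>"
proof -
  let ?U = unit_lebesgue
  let ?P = "sample_space n"
  interpret P: prob_space ?P by (rule prob_space_sample_space)
  let ?T = "\<lambda>x. (c x, g x)"
  have idm: "(\<lambda>x. x) \<in> borel_measurable ?U"
    unfolding measurable_cong_sets[OF sets_unit_lebesgue refl] by (simp add: measurable_restrict_space1)
  have cm: "c \<in> borel_measurable ?U"
    using measurable_compose[OF idm borel_measurable_mono[OF c]] by simp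
  have gm: "g \<in> borel_measurable ?U"
    using C_lambdaD(3)[OF g] unfolding measurable_cong_sets[OF refl sets_unit_lebesgue]
    by (simp add: measurable_restrict_space2_iff)
  have Tm: "?T \<in> ?U \<rightarrow>\<^sub>M borel \<Otimes>\<^sub>M borel" using cm gm by (rule measurable_Pair)
  define M where "M = distr ?U borel c"
  define N where "N = distr ?U borel (\<lambda>x. x)"
  define A where "A = distr ?U (borel \<Otimes>\<^sub>M borel) ?T"
  have M: "prob_space M" "sets M = sets borel" and N: "prob_space N" "sets N = sets borel"
    unfolding M_def N_def
    by (auto intro!: prob_space.prob_space_distr[OF prob_space_unit_lebesgue] cm idm)
  have A: "prob_space A" unfolding A_def
    by (intro prob_space.prob_space_distr[OF prob_space_unit_lebesgue] Tm)
  interpret M: prob_space M by (rule M)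
  interpret N: prob_space N by (rule N)
  interpret MN: pair_prob_space M N by unfold_locales
  have sAB: "sets A = sets (M \<Otimes>\<^sub>M N)"
    using sets_pair_measure_cong[OF M(2) N(2)] by (simp add: A_def)
  have domA: "emeasure A X \<le> ennreal m * emeasure (M \<Otimes>\<^sub>M N) X" if X: "X \<in> sets A" for X
  proof -
    have Xb: "X \<in> sets (borel \<Otimes>\<^sub>M borel)" using X by (simp add: A_def)
    have XMN: "X \<in> sets (M \<Otimes>\<^sub>M N)" using X sAB by simp
    have "emeasure A X = emeasure ?U {x \<in> {0..1}. (c x, g x) \<in> X}"
      unfolding A_def by (subst emeasure_distr[OF Tm Xb]) (auto intro!: arg_cong[where f="emeasure _"])
    also have "\<dots> \<le> ennreal m * (\<integral>\<^sup>+x. emeasure ?U {y \<in> {0..1}. (c x, y) \<in> X} \<partial>?U)" by (rule dom[OF Xb])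
    also have "(\<integral>\<^sup>+x. emeasure ?U {y \<in> {0..1}. (c x, y) \<in> X} \<partial>?U) = (\<integral>\<^sup>+x. emeasure N (Pair (c x) -` X) \<partial>?U)"
    proof (rule nn_integral_cong)
      fix x
      have "Pair (c x) -` X \<in> sets borel" using sets_Pair1[OF Xb] .
      then show "emeasure ?U {y \<in> {0..1}. (c x, y) \<in> X} = emeasure N (Pair (c x) -` X)"
        unfolding N_def by (subst emeasure_distr[OF idm]) (auto intro!: arg_cong[where f="emeasure _"])
    qed
    also have "\<dots> = (\<integral>\<^sup>+v. emeasure N (Pair v -` X) \<partial>M)"
    proof -
      have "(\<lambda>v. emeasure N (Pair v -` X)) \<in> borel_measurable M"
        by (rule N.measurable_emeasure_Pair[OF XMN])
      then have "(\<lambda>v. emeasure N (Pair v -` X)) \<in> borel_measurable borel"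
        by (simp add: measurable_cong_sets[OF M(2) refl])
      then show ?thesis unfolding M_def by (subst nn_integral_distr[OF cm]) auto
    qed
    also have "\<dots> = emeasure (M \<Otimes>\<^sub>M N) X" by (rule N.emeasure_pair_measure_alt[OF XMN, symmetric])
    finally show ?thesis .
  qed
  let ?PA = "\<Pi>\<^sub>M i\<in>{1..n}. A" and ?PB = "\<Pi>\<^sub>M i\<in>{1..n}. M \<Otimes>\<^sub>M N"
  define W where "W = {\<omega> \<in> space (\<Pi>\<^sub>M i\<in>{1..n}. (borel::real measure) \<Otimes>\<^sub>M (borel::real measure)).
    inj_on (fst \<circ> \<omega>) {1..n} \<and> pattern n \<omega> = \<pi>}"
  have sA: "sets A = sets (borel \<Otimes>\<^sub>M borel)" by (simp add: A_def)
  have sPA: "sets ?PA = sets (\<Pi>\<^sub>M i\<in>{1..n}. (borel::real measure) \<Otimes>\<^sub>M (borel::real measure))"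
    by (intro sets_PiM_cong sA refl)
  have sPB: "sets ?PB = sets ?PA" by (intro sets_PiM_cong sAB[symmetric] refl)
  have WA: "W \<in> sets ?PA" unfolding sPA W_def by (rule pattern_event_measurable)
  have WB: "W \<in> sets ?PB" using WA by (simp only: sPB)
  have "emeasure ?PA W = (\<integral>\<^sup>+\<omega>. indicator W \<omega> \<partial>?PA)" using WA by simp
  also have "\<dots> \<le> ennreal m ^ card {1..n} * (\<integral>\<^sup>+\<omega>. indicator W \<omega> \<partial>?PB)"
    using WA by (intro nn_integral_PiM_dominated A MN.prob_space_axioms sAB domA borel_measurable_indicator finite_atLeastAtMost)
  also have "\<dots> = ennreal (m ^ n) * emeasure ?PB W" using WB m by (simp add: ennreal_power)
  also have "\<dots> \<le> ennreal (m ^ n) * ennreal (1 / fact n)"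
    unfolding W_def by (intro mult_left_mono emeasure_pattern_independent_le M N) simp
  also have "\<dots> = ennreal (m ^ n / fact n)" using m by (simp flip: ennreal_mult)
  finally have PAW: "emeasure ?PA W \<le> ennreal (m ^ n / fact n)" .
  have TA: "?T \<in> ?U \<rightarrow>\<^sub>M A" using Tm by (simp add: measurable_cong_sets[OF refl sA])
  have cmp: "compose {1..n} ?T \<in> ?P \<rightarrow>\<^sub>M ?PA"
    unfolding compose_def
  proof (rule measurable_restrict)
    show "(\<lambda>x. ?T (x i)) \<in> ?P \<rightarrow>\<^sub>M A" if "i \<in> {1..n}" for i
      using measurable_compose[OF measurable_component_singleton[OF that] TA] .
  qed
  have "distr ?P ?PA (compose {1..n} ?T) = (\<Pi>\<^sub>M i\<in>{1..n}. distr ?U A ?T)"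
    using TA by (intro distr_PiM_finite_prob_space' prob_space_unit_lebesgue A) auto
  also have "distr ?U A ?T = A" using sA by (subst (2) A_def) (auto intro: distr_cong)
  finally have dPA: "distr ?P ?PA (compose {1..n} ?T) = ?PA" .
  let ?V = "compose {1..n} ?T -` W \<inter> space ?P"
  have V: "?V \<in> sets ?P" by (rule measurable_sets[OF cmp WA])
  have "emeasure ?P ?V = emeasure ?PA W" using emeasure_distr[OF cmp WA] by (simp only: dPA)
  then have "ennreal (P.prob ?V) \<le> ennreal (m ^ n / fact n)"
    using PAW by (simp only: P.emeasure_eq_measure)
  then have PV: "P.prob ?V \<le> m ^ n / fact n" using m by (subst (asm) ennreal_le_iff) auto
  let ?E = "{z \<in> space (?U \<Otimes>\<^sub>M ?U). c (fst z) = c (snd z)}"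
  have E: "?E \<in> sets (?U \<Otimes>\<^sub>M ?U)"
    using measurable_compose[OF measurable_fst cm] measurable_compose[OF measurable_snd cm]
    by (rule borel_measurable_eq)
  have sec: "emeasure ?U (Pair x -` ?E) \<le> ennreal \<delta>" if x: "x \<in> space ?U" for x
  proof -
    have "Pair x -` ?E = {y \<in> {0..1}. c x = c y}" using x by (auto simp: space_pair_measure)
    then show ?thesis using cell[of x] x by simp
  qed
  define D where "D = {x \<in> space ?P. \<exists>i\<in>{1..n}. \<exists>j\<in>{1..n}. i \<noteq> j \<and> (x i, x j) \<in> ?E}"
  note pairs = measure_some_pair_le[OF prob_space_unit_lebesgue finite_atLeastAtMost E \<delta>, of 1 n]
  have D: "D \<in> sets ?P" unfolding D_def by (rule pairs(1)[OF sec])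
  have "P.prob D \<le> (real (card {1..n}))\<^sup>2 * \<delta>" unfolding D_def by (rule pairs(2)[OF sec])
  then have PD: "P.prob D \<le> (real n)\<^sup>2 * \<delta>" by simp
  have "{x \<in> space ?P. pattern n (\<lambda>i. (x i, g (x i))) = \<pi>} \<subseteq> ?V \<union> D"
  proof
    fix x assume "x \<in> {x \<in> space ?P. pattern n (\<lambda>i. (x i, g (x i))) = \<pi>}"
    then have x: "x \<in> space ?P" "pattern n (\<lambda>i. (x i, g (x i))) = \<pi>" by auto
    show "x \<in> ?V \<union> D"
    proof (cases "x \<in> D")
      case False
      have xi: "x i \<in> {0..1}" if "i \<in> {1..n}" for i using x(1) that by (auto simp: space_PiM PiE_iff)
      have neq: "c (x i) \<noteq> c (x j)" if "i \<in> {1..n}" "j \<in> {1..n}" "i \<noteq> j" for i j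
      proof -
        have "(x i, x j) \<notin> ?E" using False that x(1) unfolding D_def by blast
        then show ?thesis using xi[OF that(1)] xi[OF that(2)] by (simp add: space_pair_measure)
      qed
      have inj: "inj_on (fst \<circ> compose {1..n} ?T x) {1..n}"
      proof (rule inj_onI)
        fix i j assume ij: "i \<in> {1..n}" "j \<in> {1..n}"
          "(fst \<circ> compose {1..n} ?T x) i = (fst \<circ> compose {1..n} ?T x) j"
        then have "c (x i) = c (x j)" by (simp only: comp_apply compose_eq fst_conv)
        then show "i = j" using neq ij by blast
      qed
      have "pattern n (compose {1..n} ?T x) = pattern n (\<lambda>i. (x i, g (x i)))"
      proof (rule pattern_cong_order)
        fix i j assume ij: "i \<in> {1..n}" "j \<in> {1..n}"
        have "c (x j) < c (x i) \<longleftrightarrow> x j < x i"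
          using neq[OF ij] monoD[OF c, of "x j" "x i"] monoD[OF c, of "x i" "x j"]
          by (cases "i = j"; cases rule: linorder_cases[of "x i" "x j"]) auto
        then show "fst (compose {1..n} ?T x j) < fst (compose {1..n} ?T x i) \<longleftrightarrow> fst (x j, g (x j)) < fst (x i, g (x i))"
          using ij by (simp only: compose_eq fst_conv)
      qed (simp only: compose_eq snd_conv)
      then have "compose {1..n} ?T x \<in> W"
        using x inj measurable_space[OF cmp x(1)] sets_eq_imp_space_eq[OF sPA] unfolding W_def by simp
      then show ?thesis using x by blast
    qed simp
  qed
  then have "pattern_prob g n \<pi> \<le> P.prob (?V \<union> D)"
    unfolding pattern_prob_def using V D by (intro P.finite_measure_mono) auto
  also have "\<dots> \<le> P.prob ?V + P.prob D" using V D by (rule measure_Un_le)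
  finally show ?thesis using PV PD by linarith
qed

section \<open>Zigzags near the identity\<close>

text \<open>The bands overlap in the grid points, which are a null set.\<close>
lemma obtain_unique_band:
  assumes m: "m > 0" and y: "y \<in> {0..1::real}" and off: "\<And>j. j \<le> m \<Longrightarrow> y \<noteq> real j / real m"
  obtains b where "b < m" "\<And>a. a < m \<Longrightarrow> y \<in> {real a / real m..real (Suc a) / real m} \<longleftrightarrow> a = b"
proof -
  define b where "b = nat \<lfloor>real m * y\<rfloor>"
  have b: "real b \<le> real m * y" "real m * y < real b + 1"
    using y by (auto simp: b_def)
  have "y < 1" using y off[of m] m by auto
  then have "real m * y < real m" using m by simp
  then have bm: "b < m" using b by linarith
  show ?thesis
  proof (rule that[OF bm])
    fix a assume a: "a < m"
    have "y \<in> {real a / real m..real (Suc a) / real m} \<longleftrightarrow> real a \<le> real m * y \<and> real m * y \<le> real a + 1"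
      using m by (auto simp: field_simps)
    moreover have "real m * y \<noteq> real a + 1"
    proof
      assume "real m * y = real a + 1"
      then have "y = real (Suc a) / real m" using m by (simp add: field_simps)
      then show False using off[of "Suc a"] a by simp
    qed
    ultimately have "y \<in> {real a / real m..real (Suc a) / real m} \<longleftrightarrow> real a \<le> real m * y \<and> real m * y < real a + 1"
      by linarith
    also have "\<dots> \<longleftrightarrow> a = b" using b by auto
    finally show "y \<in> {real a / real m..real (Suc a) / real m} \<longleftrightarrow> a = b" .
  qed
qed

lemma AE_off_grid: "AE y in lborel. \<forall>j\<le>m. y \<noteq> real j / real m"
proof -
  have "(\<lambda>j. real j / real m) ` {..m} \<in> null_sets lborel"
    by (intro finite_imp_null_set_lborel) auto
  from AE_not_in[OF this] show ?thesis by eventually_elim auto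
qed

text \<open>The map runs \<open>K\<close> times through each block \<open>[b / m, (b + 1) / m]\<close>, along cells of length
  \<open>1 / (m * K)\<close>. As \<open>K\<close> is odd, it leaves a block at the top, where the next one begins. Each
  run visits a set of heights inside the block for a \<open>K\<close>-th of its measure.\<close>
lemma zigzag_exists:
  assumes m: "m > 0" and K: "odd K"
  obtains \<phi> where "\<phi> \<in> mspace C_lambda" "\<And>x. x \<in> {0..1} \<Longrightarrow> \<bar>\<phi> x - x\<bar> \<le> 1 / real m"
    "\<And>i A. i < m * K \<Longrightarrow> A \<in> sets borel \<Longrightarrow>
      emeasure lborel ({real i / real (m * K)<..real (Suc i) / real (m * K)} \<inter> \<phi> -` A) \<le> ennreal (1 / real K) * emeasure lborel A"
proof -
  define N where "N = m * K"
  define t where "t i = real i / real N" for i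
  \<comment> \<open>The \<open>i\<close>-th breakpoint belongs to the block \<open>i div K\<close>, and is at its bottom or top according to
    the parity of the run.\<close>
  define p where "p i = real (i div K + (i mod K) mod 2) / real m" for i
  have K0: "K > 0" using K odd_pos by blast
  have N0: "N > 0" using m K0 by (simp add: N_def)
  have step: "{p i, p (Suc i)} = {real (i div K) / real m, real (Suc (i div K)) / real m}" for i
  proof (cases "Suc (i mod K) = K")
    case True
    then have "Suc i div K = Suc (i div K)" "Suc i mod K = 0" by (simp_all add: div_Suc mod_Suc)
    moreover have "(i mod K) mod 2 = 0"
    proof -
      have "even (i mod K)" using K even_Suc[of "i mod K"] unfolding True by blast
      then show ?thesis by (simp only: even_iff_mod_2_eq_zero)
    qed
    ultimately show ?thesis by (simp add: p_def)
  next
    case False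
    then have "Suc i div K = i div K" "Suc i mod K = Suc (i mod K)"
      using K0 by (simp_all add: div_Suc mod_Suc)
    moreover have "(i mod K) mod 2 = 0 \<and> Suc (i mod K) mod 2 = 1 \<or> (i mod K) mod 2 = 1 \<and> Suc (i mod K) mod 2 = 0"
    proof -
      have "r mod 2 = 0 \<and> Suc r mod 2 = 1 \<or> r mod 2 = 1 \<and> Suc r mod 2 = 0" for r :: nat by presburger
      then show ?thesis .
    qed
    ultimately show ?thesis by (auto simp: p_def)
  qed
  have lt: "real (i div K) / real m < real (Suc (i div K)) / real m" for i
    using m by (simp add: divide_strict_right_mono)
  have J: "{min (p i) (p (Suc i))..max (p i) (p (Suc i))} = {real (i div K) / real m..real (Suc (i div K)) / real m}"
    and ab: "\<bar>p (Suc i) - p i\<bar> = 1 / real m" and ne: "p i \<noteq> p (Suc i)" for i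
  proof -
    have "p i = real (i div K) / real m \<and> p (Suc i) = real (Suc (i div K)) / real m \<or>
      p (Suc i) = real (i div K) / real m \<and> p i = real (Suc (i div K)) / real m"
      using step[of i] by (metis doubleton_eq_iff)
    then show "{min (p i) (p (Suc i))..max (p i) (p (Suc i))} = {real (i div K) / real m..real (Suc (i div K)) / real m}"
      "\<bar>p (Suc i) - p i\<bar> = 1 / real m" "p i \<noteq> p (Suc i)"
      using lt[of i] by (auto simp: min_def max_def diff_divide_distrib[symmetric])
  qed
  have tS: "t i < t (Suc i)" "t (Suc i) - t i = 1 / real N" for i
    using N0 by (auto simp: t_def divide_strict_right_mono diff_divide_distrib[symmetric])
  interpret breakpoints N t p
    by unfold_locales (use tS(1) in \<open>metis less_imp_le\<close>, use tS(1) in \<open>metis less_irrefl\<close>)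
  let ?\<phi> = "piecewise_affine N t p"
  have s: "(t (Suc i) - t i) / \<bar>p (Suc i) - p i\<bar> = 1 / real K" for i
    unfolding tS ab using m K0 by (simp add: N_def field_simps)
  have divK: "i div K < m" if "i < N" for i
    using that by (simp add: N_def less_mult_imp_div_less)
  have ends: "t 0 = 0" "t N = 1" using N0 by (auto simp: t_def)
  have "restrict ?\<phi> {0..1} \<in> mspace C_lambda"
  proof (rule piecewise_affine_in_C_lambda[OF breakpoints_axioms ends ne])
    fix i assume i: "i \<le> N"
    show "p i \<in> {0..1}"
    proof (cases "i = N")
      case True
      then show ?thesis using m K0 by (simp add: p_def N_def)
    next
      case False
      then have "i div K + (i mod K) mod 2 \<le> m" using divK[of i] i by linarith
      then show ?thesis using m by (simp add: p_def flip: of_nat_add)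
    qed
  next
    show "AE y in lborel. y \<in> {0..1} \<longrightarrow> (\<Sum>i<N. (t (Suc i) - t i) / \<bar>p (Suc i) - p i\<bar> *
         indicator {min (p i) (p (Suc i))..max (p i) (p (Suc i))} y) = 1"
      using AE_off_grid[of m]
    proof (eventually_elim, intro impI)
      fix y :: real assume off: "\<forall>j\<le>m. y \<noteq> real j / real m" and y: "y \<in> {0..1}"
      obtain b where b: "b < m" "\<And>a. a < m \<Longrightarrow> y \<in> {real a / real m..real (Suc a) / real m} \<longleftrightarrow> a = b"
        using obtain_unique_band[OF m y] off by blast
      have "(\<Sum>i<N. (t (Suc i) - t i) / \<bar>p (Suc i) - p i\<bar> *
         indicator {min (p i) (p (Suc i))..max (p i) (p (Suc i))} y) = (\<Sum>i<N. 1 / real K * (if i div K = b then 1 else 0))"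
        unfolding s J using b(2)[OF divK] by (intro sum.cong refl) (auto simp: indicator_def)
      also have "\<dots> = real (card {i \<in> {..<N}. i div K = b}) / real K"
        unfolding sum_distrib_left[symmetric] by (simp add: sum.If_cases Int_def)
      also have "{i \<in> {..<N}. i div K = b} = {b * K..<b * K + K}"
      proof (intro set_eqI iffI)
        fix i assume "i \<in> {i \<in> {..<N}. i div K = b}"
        then show "i \<in> {b * K..<b * K + K}"
          using dividend_less_div_times[OF K0, of i] by (auto simp: add.commute)
      next
        fix i assume i: "i \<in> {b * K..<b * K + K}"
        then have "i div K = b" by (intro div_nat_eqI) (auto simp: mult.commute)
        moreover have "b * K + K \<le> N" using b(1) mult_le_mono1[of "Suc b" m K] by (simp add: N_def)
        ultimately show "i \<in> {i \<in> {..<N}. i div K = b}" using i by auto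
      qed
      finally show "(\<Sum>i<N. (t (Suc i) - t i) / \<bar>p (Suc i) - p i\<bar> *
         indicator {min (p i) (p (Suc i))..max (p i) (p (Suc i))} y) = 1" using K0 by simp
    qed
  qed
  moreover have "\<bar>restrict ?\<phi> {0..1} x - x\<bar> \<le> 1 / real m" if x: "x \<in> {0..1}" for x
  proof -
    obtain k where k: "k < N" "t k \<le> x" "x \<le> t (Suc k)"
    proof (cases "x = 0")
      case True
      show ?thesis using that[of 0] N0 True by (simp add: t_def)
    next
      case False
      then show ?thesis using in_segment[of x] x ends that by (metis atLeastAtMost_iff less_eq_real_def)
    qed
    have "?\<phi> x \<in> {real (k div K) / real m..real (Suc (k div K)) / real m}"
      using piecewise_affine_between[OF k tS(1)] unfolding J .
    moreover have "real (k div K) / real m \<le> x"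
    proof -
      have "real (k div K) / real m = real (k div K * K) / real N" using K0 by (simp add: N_def)
      also have "\<dots> \<le> t k" unfolding t_def by (intro divide_right_mono of_nat_mono) auto
      finally show ?thesis using k by simp
    qed
    moreover have "x \<le> real (Suc (k div K)) / real m"
    proof -
      have "Suc k \<le> Suc (k div K) * K" using dividend_less_div_times[OF K0, of k] by simp
      then have "t (Suc k) \<le> real (Suc (k div K) * K) / real N"
        unfolding t_def by (intro divide_right_mono of_nat_mono) auto
      also have "\<dots> = real (Suc (k div K)) / real m"
        using K0 by (simp add: N_def del: of_nat_Suc mult_Suc)
      finally show ?thesis using k by simp
    qed
    moreover have "real (Suc (k div K)) / real m - real (k div K) / real m = 1 / real m"
      by (simp add: diff_divide_distrib[symmetric])
    ultimately show ?thesis using x unfolding abs_le_iff by (simp del: of_nat_Suc)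
  qed
  moreover have "emeasure lborel ({real i / real (m * K)<..real (Suc i) / real (m * K)} \<inter> restrict ?\<phi> {0..1} -` A)
      \<le> ennreal (1 / real K) * emeasure lborel A" if i: "i < m * K" and A: "A \<in> sets borel" for i A
  proof -
    have iN: "i < N" using i by (simp add: N_def)
    have "{t i<..t (Suc i)} \<subseteq> {0..1}" using mono_le[of 0 i] mono_le[of "Suc i" N] iN ends by auto
    then have "{t i<..t (Suc i)} \<inter> restrict ?\<phi> {0..1} -` A = {t i<..t (Suc i)} \<inter> ?\<phi> -` A" by auto
    moreover have "emeasure lborel ({t i<..t (Suc i)} \<inter> ?\<phi> -` A) =
        ennreal (1 / real K) * emeasure lborel (A \<inter> {min (p i) (p (Suc i))..max (p i) (p (Suc i))})"
      using emeasure_segment_vimage[OF iN tS(1) ne A] unfolding s .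
    moreover have "emeasure lborel (A \<inter> {min (p i) (p (Suc i))..max (p i) (p (Suc i))}) \<le> emeasure lborel A"
      using A by (intro emeasure_mono) auto
    ultimately show ?thesis unfolding t_def N_def by (simp add: mult_left_mono)
  qed
  ultimately show ?thesis by (rule that)
qed

section \<open>Maps with many patterns\<close>

text \<open>On a cell, \<open>\<phi>\<close> is uniform on a block, whose measure is \<open>1 / m\<close>. Since \<open>f\<close> preserves the
  measure, the height \<open>f (\<phi> x)\<close>, given the cell of \<open>x\<close>, has a density of at most \<open>m\<close>.\<close>
lemma zigzag_pattern_prob_le:
  assumes f: "f \<in> mspace C_lambda" and \<phi>: "\<phi> \<in> mspace C_lambda" and m: "m > 0" and K: "K > 0"
    and cells: "\<And>i A. i < m * K \<Longrightarrow> A \<in> sets borel \<Longrightarrow>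
      emeasure lborel ({real i / real (m * K)<..real (Suc i) / real (m * K)} \<inter> \<phi> -` A) \<le> ennreal (1 / real K) * emeasure lborel A"
  shows "pattern_prob (compose {0..1} f \<phi>) n \<pi> \<le> real m ^ n / fact n + (real n)\<^sup>2 * (1 / real (m * K))"
proof -
  let ?U = unit_lebesgue
  define N where "N = m * K"
  have N0: "N > 0" using m K by (simp add: N_def)
  \<comment> \<open>The value of \<open>c\<close> on the \<open>i\<close>-th cell is \<open>i + 1\<close>; the point \<open>0\<close> lies in no cell.\<close>
  define c where "c x = real_of_int \<lceil>real N * x\<rceil>" for x
  define cell where "cell i = {real i / real N<..real (Suc i) / real N}" for i
  have c_cell: "c x = real (Suc i) \<longleftrightarrow> x \<in> cell i" for x i
  proof -
    have "c x = real (Suc i) \<longleftrightarrow> \<lceil>real N * x\<rceil> = int (Suc i)"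
      unfolding c_def by (metis of_int_of_nat_eq of_int_eq_iff)
    also have "\<dots> \<longleftrightarrow> real i < real N * x \<and> real N * x \<le> real (Suc i)"
      by (simp add: ceiling_eq_iff)
    also have "\<dots> \<longleftrightarrow> x \<in> cell i" using N0 by (simp add: cell_def field_simps)
    finally show ?thesis .
  qed
  have cell_borel: "cell i \<in> sets borel" for i by (simp add: cell_def)
  have cell_sub: "cell i \<subseteq> {0..1}" if "i < N" for i
  proof
    fix x assume x: "x \<in> cell i"
    have "real (Suc i) / real N \<le> 1" using that N0 by simp
    moreover have "0 \<le> real i / real N" by simp
    ultimately show "x \<in> {0..1}" using x
      unfolding cell_def greaterThanAtMost_iff atLeastAtMost_iff by linarith
  qed
  have em_cell: "emeasure lborel (cell i) = ennreal (1 / real N)" for i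
  proof -
    have "real i / real N \<le> real (Suc i) / real N" by (intro divide_right_mono) auto
    then show ?thesis by (simp add: cell_def diff_divide_distrib[symmetric])
  qed
  have "mono c" unfolding c_def
    by (intro monoI of_int_le_iff[THEN iffD2] ceiling_mono mult_left_mono) auto
  moreover have "emeasure ?U {y \<in> {0..1}. c x = c y} \<le> ennreal (1 / real N)" for x
  proof -
    let ?I = "{(c x - 1) / real N<..c x / real N}"
    have "{y \<in> {0..1}. c x = c y} \<subseteq> ?I"
      using N0 by (auto simp: c_def field_simps) linarith+
    moreover have "{y \<in> {0..1}. c x = c y} \<in> sets borel"
      unfolding c_def by measurable
    ultimately have "emeasure ?U {y \<in> {0..1}. c x = c y} \<le> emeasure lborel ?I"
      by (subst emeasure_unit_lebesgue) (auto intro: emeasure_mono)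
    also have "\<dots> = ennreal (1 / real N)"
    proof -
      have "(c x - 1) / real N \<le> c x / real N" by (intro divide_right_mono) auto
      then show ?thesis by (simp add: diff_divide_distrib[symmetric])
    qed
    finally show ?thesis .
  qed
  moreover have "emeasure ?U {x \<in> {0..1}. (c x, compose {0..1} f \<phi> x) \<in> X}
      \<le> ennreal (real m) * (\<integral>\<^sup>+x. emeasure ?U {y \<in> {0..1}. (c x, y) \<in> X} \<partial>?U)"
    if X: "X \<in> sets (borel \<Otimes>\<^sub>M borel)" for X
  proof -
    define h where "h v = emeasure ?U (Pair v -` X \<inter> {0..1})" for v
    have sec: "Pair v -` X \<inter> {0..1} \<in> sets ?U" for v
      using sets_Pair1[OF X] by (simp add: sets_unit_lebesgue_iff)
    define A where "A i = f -` (Pair (real (Suc i)) -` X \<inter> {0..1}) \<inter> {0..1}" for i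
    have A: "A i \<in> sets ?U" for i
      using measurable_sets[OF C_lambdaD(3)[OF f] sec] by (simp add: A_def)
    have emA: "emeasure lborel (A i) = h (real (Suc i))" for i
    proof -
      have "emeasure lborel (A i) = emeasure ?U (A i)"
        using A[of i] unfolding sets_unit_lebesgue_iff by (intro emeasure_unit_lebesgue[symmetric]) auto
      also have "\<dots> = h (real (Suc i))"
        unfolding A_def h_def by (rule emeasure_vimage_C_lambda[OF f sec])
      finally show ?thesis .
    qed
    have cover: "{x \<in> {0..1}. (c x, compose {0..1} f \<phi> x) \<in> X} - {0} \<subseteq> (\<Union>i<N. cell i \<inter> \<phi> -` A i)"
    proof
      fix x assume x: "x \<in> {x \<in> {0..1}. (c x, compose {0..1} f \<phi> x) \<in> X} - {0}"
      then have x01: "x \<in> {0..1}" "x > 0" by auto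
      have ci: "0 < \<lceil>real N * x\<rceil>" "\<lceil>real N * x\<rceil> \<le> int N"
        using x01 N0 mult_left_mono[of x 1 "real N"] by (auto simp: ceiling_le_iff)
      define i where "i = nat (\<lceil>real N * x\<rceil> - 1)"
      have z: "\<lceil>real N * x\<rceil> = int (Suc i)" using ci(1) unfolding i_def by linarith
      then have i: "i < N" using ci(2) by linarith
      have i2: "c x = real (Suc i)" unfolding c_def z by simp
      have "x \<in> cell i" using i2 c_cell by blast
      moreover have "\<phi> x \<in> A i"
        using x x01 C_lambdaD(2)[OF \<phi> x01(1)] C_lambdaD(2)[OF f C_lambdaD(2)[OF \<phi> x01(1)]] i2
        compose_eq[OF x01(1), of f \<phi>] by (simp add: A_def)
      ultimately show "x \<in> (\<Union>i<N. cell i \<inter> \<phi> -` A i)" using i by blast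
    qed
    have pm: "cell i \<inter> \<phi> -` A i \<in> sets borel" if "i < N" for i
    proof -
      have "cell i \<inter> \<phi> -` A i = cell i \<inter> (\<phi> -` A i \<inter> space ?U)" using cell_sub[OF that] by auto
      then show ?thesis
        using measurable_sets[OF C_lambdaD(3)[OF \<phi>] A[of i]] cell_borel[of i] by (simp add: sets_unit_lebesgue_iff)
    qed
    have Sm: "{x \<in> {0..1}. (c x, compose {0..1} f \<phi> x) \<in> X} \<in> sets ?U"
    proof -
      have idm: "(\<lambda>x. x) \<in> borel_measurable ?U"
        unfolding measurable_cong_sets[OF sets_unit_lebesgue refl] by (simp add: measurable_restrict_space1)
      have cm: "c \<in> borel_measurable ?U"
        using measurable_compose[OF idm borel_measurable_mono[OF \<open>mono c\<close>]] by simp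
      have gm: "compose {0..1} f \<phi> \<in> borel_measurable ?U"
        using C_lambdaD(3)[OF C_lambda_compose[OF f \<phi>]] unfolding measurable_cong_sets[OF refl sets_unit_lebesgue]
        by (simp add: measurable_restrict_space2_iff)
      have "(\<lambda>x. (c x, compose {0..1} f \<phi> x)) -` X \<inter> space ?U \<in> sets ?U"
        by (rule measurable_sets[OF measurable_Pair[OF cm gm] X])
      then show ?thesis by (simp add: vimage_def Int_def conj_commute)
    qed
    have "emeasure ?U {x \<in> {0..1}. (c x, compose {0..1} f \<phi> x) \<in> X}
        = emeasure lborel {x \<in> {0..1}. (c x, compose {0..1} f \<phi> x) \<in> X}"
      using Sm by (intro emeasure_unit_lebesgue) (auto simp: sets_unit_lebesgue_iff)
    also have "\<dots> = emeasure lborel ({x \<in> {0..1}. (c x, compose {0..1} f \<phi> x) \<in> X} - {0})"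
      using Sm by (intro emeasure_Diff_null_set[symmetric]) (auto simp: sets_unit_lebesgue_iff)
    also have "\<dots> \<le> emeasure lborel (\<Union>i<N. cell i \<inter> \<phi> -` A i)"
      using pm by (intro emeasure_mono cover) auto
    also have "\<dots> \<le> (\<Sum>i<N. emeasure lborel (cell i \<inter> \<phi> -` A i))"
      using pm by (intro emeasure_subadditive_finite) auto
    also have "\<dots> \<le> (\<Sum>i<N. ennreal (1 / real K) * h (real (Suc i)))"
    proof (rule sum_mono)
      fix i assume i: "i \<in> {..<N}"
      have "A i \<in> sets borel" using A[of i] by (simp add: sets_unit_lebesgue_iff)
      then show "emeasure lborel (cell i \<inter> \<phi> -` A i) \<le> ennreal (1 / real K) * h (real (Suc i))"
        using cells[of i "A i"] i emA[of i] by (simp add: cell_def N_def)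
    qed
    also have "\<dots> = ennreal (real m) * (\<Sum>i<N. ennreal (1 / real N) * h (real (Suc i)))"
    proof -
      have "ennreal (1 / real K) = ennreal (real m) * ennreal (1 / real N)"
        using m by (simp add: N_def flip: ennreal_mult)
      then show ?thesis by (simp add: sum_distrib_left mult.assoc)
    qed
    also have "(\<Sum>i<N. ennreal (1 / real N) * h (real (Suc i))) = (\<Sum>i<N. \<integral>\<^sup>+x. h (real (Suc i)) * indicator (cell i) x \<partial>?U)"
    proof (intro sum.cong refl)
      fix i assume i: "i \<in> {..<N}"
      have ci: "cell i \<in> sets ?U" using cell_borel cell_sub[of i] i by (simp add: sets_unit_lebesgue_iff)
      have "emeasure ?U (cell i) = ennreal (1 / real N)"
        using cell_borel cell_sub[of i] i by (subst emeasure_unit_lebesgue) (auto simp: em_cell)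
      then show "ennreal (1 / real N) * h (real (Suc i)) = (\<integral>\<^sup>+x. h (real (Suc i)) * indicator (cell i) x \<partial>?U)"
        using ci by (subst nn_integral_cmult_indicator) (simp_all only: mult.commute)
    qed
    also have "\<dots> = (\<integral>\<^sup>+x. (\<Sum>i<N. h (real (Suc i)) * indicator (cell i) x) \<partial>?U)"
    proof (rule nn_integral_sum[symmetric])
      fix i assume "i \<in> {..<N}"
      then have "cell i \<in> sets ?U" using cell_borel cell_sub[of i] by (simp add: sets_unit_lebesgue_iff)
      then show "(\<lambda>x. h (real (Suc i)) * indicator (cell i) x) \<in> borel_measurable ?U" by simp
    qed
    also have "\<dots> \<le> (\<integral>\<^sup>+x. h (c x) \<partial>?U)"
    proof (rule nn_integral_mono)
      fix x
      show "(\<Sum>i<N. h (real (Suc i)) * indicator (cell i) x) \<le> h (c x)"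
      proof (cases "\<exists>i<N. x \<in> cell i")
        case True
        then obtain i where i: "i < N" "x \<in> cell i" by blast
        have "x \<in> cell j \<longleftrightarrow> j = i" for j
          using i(2) c_cell[of x j] c_cell[of x i] by auto
        then have "(\<Sum>j<N. h (real (Suc j)) * indicator (cell j) x) = (\<Sum>j<N. if j = i then h (real (Suc j)) else 0)"
          by (intro sum.cong refl) (simp add: indicator_def)
        also have "\<dots> = h (real (Suc i))" using i by simp
        finally show ?thesis using i c_cell[of x i] by simp
      next
        case False
        then have "(\<Sum>i<N. h (real (Suc i)) * indicator (cell i) x) = 0" by (intro sum.neutral) auto
        then show ?thesis by simp
      qed
    qed
    also have "(\<lambda>x. h (c x)) = (\<lambda>x. emeasure ?U {y \<in> {0..1}. (c x, y) \<in> X})"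
      by (auto simp: h_def intro!: arg_cong[where f="emeasure _"])
    finally show ?thesis by (simp add: mult_left_mono)
  qed
  ultimately show ?thesis
    using pattern_prob_le_dominated[OF C_lambda_compose[OF f \<phi>], of c "real m" "1 / real N"]
    by (simp add: N_def)
qed

text \<open>The \<open>n\<close>-th term of the exponential series at \<open>n\<close> is at most \<open>exp n\<close>.\<close>
lemma ln_fact_ge: "ln (fact n :: real) \<ge> real n * ln (real n) - real n"
proof (cases "n = 0")
  case False
  have "real n ^ n / fact n \<le> exp (real n)"
  proof -
    have "(\<Sum>k\<in>{n}. real n ^ k / fact k) \<le> (\<Sum>k. real n ^ k / fact k)"
      using summable_exp_generic[of "real n"]
      by (intro sum_le_suminf) (auto simp: field_simps scaleR_conv_of_real)
    then show ?thesis by (simp add: exp_def field_simps scaleR_conv_of_real)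
  qed
  then have "ln (real n ^ n / fact n) \<le> ln (exp (real n))"
    using False by (subst ln_le_cancel_iff) auto
  then show ?thesis using False by (simp add: ln_div ln_realpow)
qed simp

text \<open>The block number \<open>m\<close> is chosen from the modulus of continuity of \<open>f\<close>, then \<open>n\<close> so large that
  \<open>\<eta> * ln n\<close> absorbs the loss \<open>ln m\<close> per point, and finally the number \<open>K\<close> of runs so
  large that coinciding cells add at most \<open>m ^ n / fact n\<close> to the probability of a pattern.\<close>
lemma dense_high_entropy:
  assumes f: "f \<in> mspace C_lambda" and e: "e > 0" and \<eta>: "\<eta> > 0"
  shows "\<exists>g\<in>mspace C_lambda. mdist C_lambda f g < e \<and>
    (\<exists>n\<ge>n0. (1 - \<eta>) * (real n * ln (real n)) < permuton_entropy n (map_permuton g))"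
proof -
  have "uniformly_continuous_on {0..1} f"
    using C_lambdaD(1)[OF f] by (intro compact_uniformly_continuous) auto
  then obtain d where d: "d > 0" "\<And>x y. x \<in> {0..1} \<Longrightarrow> y \<in> {0..1} \<Longrightarrow> \<bar>y - x\<bar> < d \<Longrightarrow> \<bar>f y - f x\<bar> < e / 2"
    using e unfolding uniformly_continuous_on_def dist_real_def by (metis half_gt_zero)
  obtain m where m: "m > 0" "1 / real m < d"
    using reals_Archimedean[OF d(1)] by (metis inverse_eq_divide zero_less_Suc)
  obtain n where n: "n \<ge> max n0 1" "(2 + ln (real m)) / \<eta> < ln (real n)"
  proof -
    obtain n1 where n1: "real n1 > exp ((2 + ln (real m)) / \<eta>)" using reals_Archimedean2 by blast
    define n where "n = max n1 (max n0 1)"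
    have "exp ((2 + ln (real m)) / \<eta>) < real n" using n1 by (simp add: n_def)
    then have "(2 + ln (real m)) / \<eta> < ln (real n)" by (metis exp_gt_zero ln_exp ln_less_cancel_iff order_less_trans)
    then show ?thesis using that[of n] by (simp add: n_def)
  qed
  have n1: "real n \<ge> 1" using n by simp
  define r where "r = real m ^ n / fact n"
  have r: "r > 0" using m by (simp add: r_def)
  obtain k where k: "real k > (real n)\<^sup>2 / r" using reals_Archimedean2 by blast
  define K where "K = 2 * k + 1"
  have "real k \<le> real (m * K)"
  proof -
    have "k \<le> K" "K \<le> m * K" using m by (auto simp: K_def)
    then show ?thesis by (intro of_nat_mono) linarith
  qed
  then have "(real n)\<^sup>2 / r < real (m * K)" using k by linarith
  then have small: "(real n)\<^sup>2 * (1 / real (m * K)) \<le> r"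
    using r m by (simp add: K_def field_simps del: of_nat_mult of_nat_Suc of_nat_add)
  have "odd K" "K > 0" by (auto simp: K_def)
  then obtain \<phi> where \<phi>: "\<phi> \<in> mspace C_lambda" "\<And>x. x \<in> {0..1} \<Longrightarrow> \<bar>\<phi> x - x\<bar> \<le> 1 / real m"
    "\<And>i A. i < m * K \<Longrightarrow> A \<in> sets borel \<Longrightarrow>
      emeasure lborel ({real i / real (m * K)<..real (Suc i) / real (m * K)} \<inter> \<phi> -` A) \<le> ennreal (1 / real K) * emeasure lborel A"
    using zigzag_exists[OF m(1)] by metis
  let ?g = "compose {0..1} f \<phi>"
  have g: "?g \<in> mspace C_lambda" by (rule C_lambda_compose[OF f \<phi>(1)])
  have "\<bar>f x - ?g x\<bar> \<le> e / 2" if x: "x \<in> {0..1}" for x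
    using d(2)[OF C_lambdaD(2)[OF \<phi>(1) x] x] \<phi>(2)[OF x] m(2) x by (simp add: compose_eq abs_minus_commute)
  then have "mdist C_lambda f ?g \<le> e / 2" using mdist_C_lambda_le[OF f g] by blast
  then have close: "mdist C_lambda f ?g < e" using e by linarith
  have "pattern_prob ?g n \<pi> \<le> 2 * r" for \<pi>
    using zigzag_pattern_prob_le[OF f \<phi>(1) m(1) \<open>K > 0\<close> \<phi>(3), of n \<pi>] small unfolding r_def by linarith
  then have "- ln (2 * r) \<le> permuton_entropy n (map_permuton ?g)"
    unfolding permuton_entropy_map_permuton[OF g]
    by (intro entropy_ge_neg_ln_max finite_permutations pattern_prob_nonneg sum_pattern_prob_permutes g) auto
  moreover have "- ln (2 * r) = ln (fact n) - real n * ln (real m) - ln 2"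
    using r m by (simp add: r_def ln_mult ln_div ln_realpow)
  moreover have "(1 - \<eta>) * (real n * ln (real n)) < ln (fact n) - real n * ln (real m) - ln 2"
  proof -
    have "2 + ln (real m) < \<eta> * ln (real n)" using n(2) \<eta> by (simp add: field_simps)
    then have "real n * (2 + ln (real m)) < real n * (\<eta> * ln (real n))" using n1 by (intro mult_strict_left_mono) auto
    moreover have "ln 2 < (1::real)" using ln_2_less_1 .
    ultimately show ?thesis using ln_fact_ge[of n] n1 by (simp add: algebra_simps)
  qed
  ultimately show ?thesis using g close n(1) by (intro bexI[of _ ?g]) (auto intro!: exI[of _ n])
qed

section \<open>Patterns determined by band counts\<close>

text \<open>The \<open>i\<close>-th point of the sample lies in the interval number \<open>b i\<close> of the domain. The intervals
  are numbered from left to right, the points of interval \<open>k\<close> have their heights in the band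
  number \<open>\<sigma> k\<close>, counted from below, and are increasing there.\<close>
definition follows_bands :: "nat \<Rightarrow> nat \<Rightarrow> (nat \<Rightarrow> nat) \<Rightarrow> (nat \<Rightarrow> real \<times> real) \<Rightarrow> (nat \<Rightarrow> nat) \<Rightarrow> bool" where
  "follows_bands n M \<sigma> \<omega> b \<longleftrightarrow> (\<forall>i\<in>{1..n}. b i < M) \<and> (\<forall>i\<in>{1..n}. \<forall>j\<in>{1..n}.
     (b i < b j \<longrightarrow> fst (\<omega> i) < fst (\<omega> j)) \<and> (\<sigma> (b i) < \<sigma> (b j) \<longrightarrow> snd (\<omega> i) < snd (\<omega> j)) \<and>
     (b i = b j \<longrightarrow> (fst (\<omega> i) < fst (\<omega> j) \<longleftrightarrow> snd (\<omega> i) < snd (\<omega> j))))"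

definition band_count :: "nat \<Rightarrow> nat \<Rightarrow> (nat \<Rightarrow> nat) \<Rightarrow> nat \<Rightarrow> nat" where
  "band_count n M b = (\<lambda>k\<in>{..<M}. card {j \<in> {1..n}. b j = k})"

lemma card_by_bands:
  assumes "\<forall>i\<in>{1..n}. b i < M"
  shows "card {j \<in> {1..n}. P (b j)} = (\<Sum>k | k < M \<and> P k. band_count n M b k)"
proof -
  have "{j \<in> {1..n}. P (b j)} = (\<Union>k\<in>{k. k < M \<and> P k}. {j \<in> {1..n}. b j = k})"
    using assms by auto
  also have "card \<dots> = (\<Sum>k | k < M \<and> P k. card {j \<in> {1..n}. b j = k})"
    by (intro card_UN_disjoint) auto
  also have "\<dots> = (\<Sum>k | k < M \<and> P k. band_count n M b k)"
    by (intro sum.cong refl) (simp add: band_count_def)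
  finally show ?thesis .
qed

text \<open>\<open>Q\<close> selects the points in lower classes than \<open>i\<close>, and \<open>R\<close> those in the class of \<open>i\<close>.\<close>
lemma sample_rank_split:
  assumes b: "\<forall>j\<in>{1..n}. (Q j \<longrightarrow> z j < z i) \<and> (\<not> Q j \<and> \<not> R j \<longrightarrow> z i < z j)"
    and QR: "\<And>j. \<not> (Q j \<and> R j)"
  shows "sample_rank n z i = card {j \<in> {1..n}. Q j} +
    card {j \<in> {1..n}. R j \<and> (z j < z i \<or> z j = z i \<and> j \<le> i)}"
proof -
  have "{j \<in> {1..n}. z j < z i \<or> z j = z i \<and> j \<le> i} =
    {j \<in> {1..n}. Q j} \<union> {j \<in> {1..n}. R j \<and> (z j < z i \<or> z j = z i \<and> j \<le> i)}"
    using b by (auto; fastforce)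
  then show ?thesis
    unfolding sample_rank_def using QR by (simp only:) (intro card_Un_disjoint; auto)
qed

text \<open>The number \<open>w\<close> is the rank of the point among those of its own interval. As it is the same for
  positions and heights, both ranks are \<open>w\<close> plus a sum of counts.\<close>
lemma follows_bands_ranks:
  assumes inj: "inj_on \<sigma> {..<M}" and F: "follows_bands n M \<sigma> \<omega> b" and i: "i \<in> {1..n}"
  obtains w where "1 \<le> w" "w \<le> band_count n M b (b i)"
    "sample_rank n (fst \<circ> \<omega>) i = (\<Sum>k | k < M \<and> k < b i. band_count n M b k) + w"
    "sample_rank n (snd \<circ> \<omega>) i = (\<Sum>k | k < M \<and> \<sigma> k < \<sigma> (b i). band_count n M b k) + w"
proof -
  have bM: "\<forall>j\<in>{1..n}. b j < M" using F by (simp add: follows_bands_def)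
  have 1: "b i < b j \<Longrightarrow> fst (\<omega> i) < fst (\<omega> j)" "\<sigma> (b i) < \<sigma> (b j) \<Longrightarrow> snd (\<omega> i) < snd (\<omega> j)"
    "b i = b j \<Longrightarrow> fst (\<omega> i) < fst (\<omega> j) \<longleftrightarrow> snd (\<omega> i) < snd (\<omega> j)"
    if "i \<in> {1..n}" "j \<in> {1..n}" for i j
    using F that unfolding follows_bands_def by blast+
  have \<sigma>: "\<sigma> (b j) = \<sigma> (b i) \<longleftrightarrow> b j = b i" if "j \<in> {1..n}" for j
    using inj_on_eq_iff[OF inj, of "b j" "b i"] bM that i by blast
  let ?wx = "{j \<in> {1..n}. b j = b i \<and> ((fst \<circ> \<omega>) j < (fst \<circ> \<omega>) i \<or> (fst \<circ> \<omega>) j = (fst \<circ> \<omega>) i \<and> j \<le> i)}"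
  let ?wy = "{j \<in> {1..n}. b j = b i \<and> ((snd \<circ> \<omega>) j < (snd \<circ> \<omega>) i \<or> (snd \<circ> \<omega>) j = (snd \<circ> \<omega>) i \<and> j \<le> i)}"
  have "(fst \<circ> \<omega>) j < (fst \<circ> \<omega>) i \<longleftrightarrow> (snd \<circ> \<omega>) j < (snd \<circ> \<omega>) i" "(fst \<circ> \<omega>) j = (fst \<circ> \<omega>) i \<longleftrightarrow> (snd \<circ> \<omega>) j = (snd \<circ> \<omega>) i"
    if "j \<in> {1..n}" "b j = b i" for j
    using 1(3)[OF i that(1)] 1(3)[OF that(1) i] that(2) by auto
  then have w_eq: "?wx = ?wy" by blast
  have x: "sample_rank n (fst \<circ> \<omega>) i = card {j \<in> {1..n}. b j < b i} + card ?wx"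
  proof (rule sample_rank_split)
    show "\<forall>j\<in>{1..n}. (b j < b i \<longrightarrow> (fst \<circ> \<omega>) j < (fst \<circ> \<omega>) i) \<and> (\<not> b j < b i \<and> b j \<noteq> b i \<longrightarrow> (fst \<circ> \<omega>) i < (fst \<circ> \<omega>) j)"
      using 1(1)[OF i] 1(1)[OF _ i] by (auto simp: not_less le_less)
  qed auto
  have y: "sample_rank n (snd \<circ> \<omega>) i = card {j \<in> {1..n}. \<sigma> (b j) < \<sigma> (b i)} + card ?wy"
  proof (rule sample_rank_split)
    show "\<forall>j\<in>{1..n}. (\<sigma> (b j) < \<sigma> (b i) \<longrightarrow> (snd \<circ> \<omega>) j < (snd \<circ> \<omega>) i) \<and>
        (\<not> \<sigma> (b j) < \<sigma> (b i) \<and> b j \<noteq> b i \<longrightarrow> (snd \<circ> \<omega>) i < (snd \<circ> \<omega>) j)"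
      using 1(2)[OF i] 1(2)[OF _ i] \<sigma> by (metis comp_apply linorder_less_linear)
  qed auto
  have "i \<in> ?wx" using i by auto
  then have w1: "1 \<le> card ?wx" by (simp add: Suc_le_eq card_gt_0_iff One_nat_def) blast
  have "card ?wx \<le> card {j \<in> {1..n}. b j = b i}" by (intro card_mono) auto
  then have w2: "card ?wx \<le> band_count n M b (b i)" using bM i by (simp add: band_count_def)
  show ?thesis
    using that[OF w1 w2] x y card_by_bands[OF bM, of "\<lambda>k. k < b i"] card_by_bands[OF bM, of "\<lambda>k. \<sigma> k < \<sigma> (b i)"] w_eq
    by (simp only:)
qed

text \<open>The counts and the horizontal rank of a point determine its interval, hence \<open>w\<close> and the
  rank of its height.\<close>
lemma pattern_determined_by_band_count:
  assumes inj: "inj_on \<sigma> {..<M}" and F: "follows_bands n M \<sigma> \<omega> b" and F': "follows_bands n M \<sigma> \<omega>' b'"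
    and same: "band_count n M b = band_count n M b'"
  shows "pattern n \<omega> = pattern n \<omega>'"
  unfolding pattern_eq_iff[OF pattern_permutes]
proof
  fix i assume i: "i \<in> {1..n}"
  let ?c = "band_count n M b"
  let ?C = "\<lambda>k. \<Sum>a | a < M \<and> a < k. ?c a"
  obtain w where w: "1 \<le> w" "w \<le> ?c (b i)" "sample_rank n (fst \<circ> \<omega>) i = ?C (b i) + w"
    "sample_rank n (snd \<circ> \<omega>) i = (\<Sum>k | k < M \<and> \<sigma> k < \<sigma> (b i). ?c k) + w"
    using follows_bands_ranks[OF inj F i] by blast
  have "sample_rank n (fst \<circ> \<omega>) i \<in> sample_rank n (fst \<circ> \<omega>') ` {1..n}"
    unfolding bij_betw_imp_surj_on[OF bij_betw_sample_rank[of n "fst \<circ> \<omega>'"]]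
    using bij_betwE[OF bij_betw_sample_rank[of n "fst \<circ> \<omega>"]] i by blast
  then obtain i' where i': "i' \<in> {1..n}" "sample_rank n (fst \<circ> \<omega>') i' = sample_rank n (fst \<circ> \<omega>) i"
    by (metis imageE)
  obtain w' where w': "1 \<le> w'" "w' \<le> ?c (b' i')" "sample_rank n (fst \<circ> \<omega>') i' = ?C (b' i') + w'"
    "sample_rank n (snd \<circ> \<omega>') i' = (\<Sum>k | k < M \<and> \<sigma> k < \<sigma> (b' i'). ?c k) + w'"
    using follows_bands_ranks[OF inj F' i'(1)] unfolding same[symmetric] by blast
  have bM: "b i < M" "b' i' < M" using F F' i i' by (auto simp: follows_bands_def)
  have step: "?C k + ?c k \<le> ?C l" if "k < l" "k < M" for k l
  proof -
    have "?C k + ?c k = (\<Sum>j\<in>insert k {j. j < M \<and> j < k}. ?c j)" by (subst sum.insert) auto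
    also have "\<dots> \<le> ?C l" using that by (intro sum_mono2) auto
    finally show ?thesis .
  qed
  have eq: "?C (b i) + w = ?C (b' i') + w'" using w w' i' by simp
  have bb: "b i = b' i'"
  proof (rule linorder_cases[of "b i" "b' i'"])
    assume "b i < b' i'"
    from step[OF this bM(1)] show ?thesis using w w' eq by linarith
  next
    assume "b' i' < b i"
    from step[OF this bM(2)] show ?thesis using w w' eq by linarith
  qed
  then have "w = w'" using eq by simp
  then have "sample_rank n (snd \<circ> \<omega>') i' = sample_rank n (snd \<circ> \<omega>) i" using w w' bb by simp
  then show "pattern n \<omega>' (sample_rank n (fst \<circ> \<omega>) i) = sample_rank n (snd \<circ> \<omega>) i"
    using pattern_rank[OF i'(1), of \<omega>'] i'(2) by simp
qed

lemma card_band_patterns_le: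
  assumes inj: "inj_on \<sigma> {..<M}"
  shows "card {pattern n \<omega> | \<omega> b. follows_bands n M \<sigma> \<omega> b} \<le> (n + 1) ^ M"
proof -
  let ?Q = "{pattern n \<omega> | \<omega> b. follows_bands n M \<sigma> \<omega> b}"
  let ?C = "PiE {..<M} (\<lambda>_. {..n})"
  define F where "F c = (SOME \<pi>. \<exists>\<omega> b. follows_bands n M \<sigma> \<omega> b \<and> band_count n M b = c \<and> \<pi> = pattern n \<omega>)" for c
  have "?Q \<subseteq> F ` ?C"
  proof
    fix \<pi> assume "\<pi> \<in> ?Q"
    then obtain \<omega> b where wb: "follows_bands n M \<sigma> \<omega> b" "\<pi> = pattern n \<omega>" by blast
    let ?P = "\<lambda>\<pi>. \<exists>\<omega>' b'. follows_bands n M \<sigma> \<omega>' b' \<and> band_count n M b' = band_count n M b \<and> \<pi> = pattern n \<omega>'"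
    have "?P (F (band_count n M b))"
      unfolding F_def by (rule someI[of ?P \<pi>]) (use wb in blast)
    then have "F (band_count n M b) = \<pi>"
      using pattern_determined_by_band_count[OF inj wb(1)] wb(2) by metis
    moreover have "band_count n M b \<in> ?C"
    proof
      fix k assume "k \<in> {..<M}"
      moreover have "card {j \<in> {1..n}. b j = k} \<le> card {1..n}" by (intro card_mono) auto
      ultimately show "band_count n M b k \<in> {..n}" by (simp add: band_count_def)
    qed (simp add: band_count_def)
    ultimately show "\<pi> \<in> F ` ?C" by blast
  qed
  moreover have "finite ?C" by (intro finite_PiE) auto
  ultimately have "card ?Q \<le> card (F ` ?C)" by (intro card_mono) auto
  also have "\<dots> \<le> card ?C" using \<open>finite ?C\<close> by (rule card_image_le)
  also have "\<dots> = (n + 1) ^ M" by (simp add: card_PiE flip: Suc_eq_plus1)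
  finally show ?thesis .
qed

section \<open>Matching intervals of the domain with bands of heights\<close>

text \<open>Hall's condition: the intervals in \<open>S\<close> are mapped into the bands that they meet, and as \<open>f\<close>
  preserves the measure, these bands are at least as many.\<close>
lemma band_matching:
  assumes f: "f \<in> mspace C_lambda" and M: "M > 0"
  obtains \<sigma> where "bij_betw \<sigma> {..<M} {..<M}"
    "\<And>k. k < M \<Longrightarrow> \<exists>x\<in>{real k / real M..real (Suc k) / real M}. f x \<in> {real (\<sigma> k) / real M..real (Suc (\<sigma> k)) / real M}"
proof -
  define I where "I k = {real k / real M..real (Suc k) / real M}" for k
  define N where "N k = {j \<in> {..<M}. \<exists>x\<in>I k. f x \<in> I j}" for k
  have I01: "I k \<subseteq> {0..1}" if "k < M" for k
  proof
    fix x assume x: "x \<in> I k"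
    have "real (Suc k) / real M \<le> 1" using that M by simp
    moreover have "0 \<le> real k / real M" by simp
    ultimately show "x \<in> {0..1}" using x unfolding I_def atLeastAtMost_iff by linarith
  qed
  have len: "real k / real M \<le> real (Suc k) / real M" "real (Suc k) / real M - real k / real M = 1 / real M" for k
    by (auto intro!: divide_right_mono simp: diff_divide_distrib[symmetric])
  have "card S \<le> card (\<Union>(N ` S))" if S: "S \<subseteq> {..<M}" for S
  proof -
    let ?N = "\<Union>(N ` S)"
    have finS: "finite S" using S finite_subset by blast
    have finN: "finite ?N" using finS by (auto simp: N_def)
    \<comment> \<open>Half-open versions of the intervals, in order that they are disjoint.\<close>
    define H where "H k = {real k / real M<..real (Suc k) / real M}" for k
    have Hd: "disjoint_family_on H S"
      unfolding disjoint_family_on_def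
    proof (intro ballI impI)
      have *: "H i \<inter> H j = {}" if "i < j" for i j
      proof -
        have "real (Suc i) / real M \<le> real j / real M" using that by (intro divide_right_mono) auto
        then show ?thesis by (auto simp: H_def simp del: of_nat_Suc)
      qed
      fix i j :: nat assume "i \<noteq> j"
      then show "H i \<inter> H j = {}" using *[of i j] *[of j i] by (cases "i < j") auto
    qed
    let ?B = "\<Union>j\<in>?N. I j"
    have Bs: "?B \<in> sets unit_lebesgue"
      unfolding sets_unit_lebesgue_iff
    proof
      show "?B \<in> sets borel" using finN by (intro sets.finite_UN) (auto simp: I_def)
      have "?N \<subseteq> {..<M}" by (auto simp: N_def)
      then show "?B \<subseteq> {0..1}" using I01 by blast
    qed
    have vB: "f -` ?B \<inter> {0..1} \<in> sets unit_lebesgue"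
      using measurable_sets[OF C_lambdaD(3)[OF f] Bs] by simp
    have HI: "H k \<subseteq> I k" for k by (auto simp: H_def I_def)
    have sub: "(\<Union>k\<in>S. H k) \<subseteq> f -` ?B \<inter> {0..1}"
    proof
      fix x assume "x \<in> (\<Union>k\<in>S. H k)"
      then obtain k where k: "k \<in> S" "x \<in> H k" by blast
      have "k < M" using k S by blast
      from I01[OF this] have xI: "x \<in> I k" "x \<in> {0..1}" using k(2) HI by blast+
      have fx: "f x \<in> {0..1}" by (rule C_lambdaD(2)[OF f xI(2)])
      obtain j where j: "j < M" "f x \<in> I j"
      proof (cases "f x = 0")
        case True
        show ?thesis using that[of 0] M True by (simp add: I_def)
      next
        case False
        define j where "j = nat (\<lceil>real M * f x\<rceil> - 1)"
        have c: "0 < \<lceil>real M * f x\<rceil>" "\<lceil>real M * f x\<rceil> \<le> int M"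
          using fx False M mult_left_mono[of "f x" 1 "real M"] by (auto simp: ceiling_le_iff)
        have jc: "\<lceil>real M * f x\<rceil> = int (Suc j)" using c(1) unfolding j_def by linarith
        have "real j < real M * f x" "real M * f x \<le> real (Suc j)"
          using jc unfolding ceiling_eq_iff by auto
        then have "f x \<in> I j" using M by (simp add: I_def field_simps)
        moreover have "j < M" using jc c(2) by linarith
        ultimately show ?thesis by (rule that[rotated])
      qed
      then have "j \<in> N k" using xI by (auto simp: N_def)
      then show "x \<in> f -` ?B \<inter> {0..1}" using j xI k by blast
    qed
    have "ennreal (real (card S) / real M) = (\<Sum>k\<in>S. ennreal (1 / real M))"
      by (simp add: ennreal_of_nat_eq_real_of_nat divide_inverse flip: ennreal_mult)
    also have "\<dots> = (\<Sum>k\<in>S. emeasure lborel (H k))"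
      using len by (intro sum.cong refl) (simp add: H_def del: of_nat_Suc)
    also have "\<dots> = emeasure lborel (\<Union>k\<in>S. H k)"
    proof (rule sum_emeasure)
      show "H ` S \<subseteq> sets lborel" by (auto simp: H_def)
    qed (use Hd finS in auto)
    also have "\<dots> \<le> emeasure lborel (f -` ?B \<inter> {0..1})"
      using vB by (intro emeasure_mono sub) (simp add: sets_unit_lebesgue_iff)
    also have "\<dots> = emeasure unit_lebesgue (f -` ?B \<inter> {0..1})"
      using vB unfolding sets_unit_lebesgue_iff by (intro emeasure_unit_lebesgue[symmetric]) auto
    also have "\<dots> = emeasure unit_lebesgue ?B" by (rule emeasure_vimage_C_lambda[OF f Bs])
    also have "\<dots> = emeasure lborel ?B"
      using Bs unfolding sets_unit_lebesgue_iff by (intro emeasure_unit_lebesgue) auto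
    also have "\<dots> \<le> (\<Sum>j\<in>?N. emeasure lborel (I j))"
      using finN by (intro emeasure_subadditive_finite) (auto simp: I_def)
    also have "\<dots> = (\<Sum>j\<in>?N. ennreal (1 / real M))"
      using len by (intro sum.cong refl) (simp add: I_def del: of_nat_Suc)
    also have "\<dots> = ennreal (real (card ?N) / real M)"
      by (simp add: ennreal_of_nat_eq_real_of_nat divide_inverse flip: ennreal_mult)
    finally have "real (card S) / real M \<le> real (card ?N) / real M" by (simp add: ennreal_le_iff)
    then show ?thesis using M by (simp add: divide_le_cancel)
  qed
  then obtain \<sigma> where \<sigma>: "inj_on \<sigma> {..<M}" "\<forall>k\<in>{..<M}. \<sigma> k \<in> N k"
    using hall_marriage[of "{..<M}" N] by (auto simp: N_def)
  have "\<sigma> ` {..<M} \<subseteq> {..<M}" using \<sigma>(2) by (auto simp: N_def)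
  then have "bij_betw \<sigma> {..<M} {..<M}"
    using \<sigma>(1) by (simp add: bij_betw_def endo_inj_surj)
  then show ?thesis using \<sigma>(2) by (intro that) (auto simp: N_def I_def)
qed

section \<open>Shuffling the bands\<close>

text \<open>The permutation \<open>\<sigma>\<close> sends interval \<open>k\<close> to band \<open>\<sigma> k\<close>. The speed of the transits is \<open>1 / \<delta>\<close>.\<close>
locale band_shuffle =
  fixes M :: nat and \<sigma> :: "nat \<Rightarrow> nat" and \<delta> :: real
  assumes M_pos: "M > 0" and \<sigma>_bij: "bij_betw \<sigma> {..<M} {..<M}"
    and \<delta>_pos: "\<delta> > 0" and \<delta>_small: "\<delta> * real M < 1"
begin

text \<open>The heights at the breakpoints, in multiples of \<open>1 / M\<close>. From breakpoint \<open>2 * k\<close> to \<open>2 * k + 1\<close>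
  the path climbs the band \<open>\<sigma> k\<close>; then it transits to the bottom of the next band. The last
  transit is void: its end repeats its start.\<close>
definition level :: "nat \<Rightarrow> nat" where
  "level i = (if i = 2 * M then Suc (\<sigma> (M - 1)) else if even i then \<sigma> (i div 2) else Suc (\<sigma> (i div 2)))"

definition height :: "nat \<Rightarrow> real" where
  "height i = real (level i) / real M"

text \<open>Whether the \<open>k\<close>-th transit passes through the band \<open>j\<close>.\<close>
definition crosses :: "nat \<Rightarrow> nat \<Rightarrow> real" where
  "crosses k j = of_bool (min (level (Suc (2 * k))) (level (Suc (Suc (2 * k)))) \<le> j \<and>
     j < max (level (Suc (2 * k))) (level (Suc (Suc (2 * k)))))"

definition crossings :: "nat \<Rightarrow> real" where
  "crossings j = (\<Sum>k<M. crosses k j)"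

text \<open>A transit takes the time \<open>\<delta>\<close> per unit of height, so it occupies every band that it crosses with
  density \<open>\<delta>\<close>. The main segment through that band gives up exactly this amount of time.\<close>
definition duration :: "nat \<Rightarrow> real" where
  "duration i = (if even i then (1 - \<delta> * crossings (\<sigma> (i div 2))) / real M
     else \<delta> * \<bar>height (Suc i) - height i\<bar>)"

definition time :: "nat \<Rightarrow> real" where
  "time i = (\<Sum>l<i. duration l)"

lemma \<sigma>_less: "k < M \<Longrightarrow> \<sigma> k < M"
  using bij_betwE[OF \<sigma>_bij] by blast

lemma level_le: "i \<le> 2 * M \<Longrightarrow> level i \<le> M"
proof -
  assume i: "i \<le> 2 * M"
  have "\<sigma> (i div 2) < M" if "i \<noteq> 2 * M" using i that by (intro \<sigma>_less) linarith
  moreover have "\<sigma> (M - 1) < M" using M_pos by (intro \<sigma>_less) linarith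
  ultimately show ?thesis by (auto simp: level_def)
qed

lemma level_main: "k < M \<Longrightarrow> level (2 * k) = \<sigma> k" "k < M \<Longrightarrow> level (Suc (2 * k)) = Suc (\<sigma> k)"
proof -
  assume k: "k < M"
  have "Suc (2 * k) \<noteq> 2 * M" by presburger
  then show "level (2 * k) = \<sigma> k" "level (Suc (2 * k)) = Suc (\<sigma> k)" using k by (auto simp: level_def)
qed

lemma sum_pairs: "(\<Sum>i<2 * K. h i) = (\<Sum>k<K. h (2 * k) + h (Suc (2 * k)))" for h :: "nat \<Rightarrow> real"
  by (induction K) (simp_all add: add.assoc)

lemma crossings_bounds: "0 \<le> crossings j" "crossings j \<le> real M"
proof -
  show "0 \<le> crossings j" unfolding crossings_def by (intro sum_nonneg) (simp add: crosses_def)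
  have "crossings j \<le> (\<Sum>k<M. 1)" unfolding crossings_def by (intro sum_mono) (simp add: crosses_def)
  then show "crossings j \<le> real M" by simp
qed

lemma crossings_small: "0 \<le> \<delta> * crossings j" "\<delta> * crossings j < 1"
proof -
  show "0 \<le> \<delta> * crossings j" using \<delta>_pos crossings_bounds by (intro mult_nonneg_nonneg) auto
  have "\<delta> * crossings j \<le> \<delta> * real M" using \<delta>_pos crossings_bounds by (intro mult_left_mono) auto
  then show "\<delta> * crossings j < 1" using \<delta>_small by linarith
qed

lemma height_step: "k < M \<Longrightarrow> \<bar>height (Suc (Suc (2 * k))) - height (Suc (2 * k))\<bar> = (\<Sum>j<M. crosses k j) / real M"
proof -
  assume k: "k < M"
  let ?a = "level (Suc (2 * k))" and ?b = "level (Suc (Suc (2 * k)))"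
  have ab: "?a \<le> M" "?b \<le> M" using k by (auto intro!: level_le)
  have "(\<Sum>j<M. crosses k j) = real (card {j \<in> {..<M}. min ?a ?b \<le> j \<and> j < max ?a ?b})"
    unfolding crosses_def of_bool_def by (subst sum.If_cases) (auto simp: Int_def)
  also have "{j \<in> {..<M}. min ?a ?b \<le> j \<and> j < max ?a ?b} = {min ?a ?b..<max ?a ?b}" using ab by auto
  also have "real (card \<dots>) = \<bar>real ?b - real ?a\<bar>" by auto
  finally show ?thesis unfolding height_def by (simp add: diff_divide_distrib[symmetric] abs_divide)
qed

lemma duration_main: "duration (2 * k) = (1 - \<delta> * crossings (\<sigma> k)) / real M"
  by (simp add: duration_def)

lemma duration_transit: "duration (Suc (2 * k)) = \<delta> * \<bar>height (Suc (Suc (2 * k))) - height (Suc (2 * k))\<bar>"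
  by (simp add: duration_def)

lemma duration_nonneg: "0 \<le> duration i"
  using crossings_small[of "\<sigma> (i div 2)"] \<delta>_pos by (auto simp: duration_def intro!: divide_nonneg_nonneg mult_nonneg_nonneg)

lemma duration_main_pos: "0 < duration (2 * k)"
  unfolding duration_main using crossings_small[of "\<sigma> k"] M_pos by simp

lemma time_Suc: "time (Suc i) = time i + duration i"
  by (simp add: time_def)

lemma sum_\<sigma>: "(\<Sum>k<M. h (\<sigma> k)) = (\<Sum>j<M. h j)" for h :: "nat \<Rightarrow> real"
  by (rule sum.reindex_bij_betw[OF \<sigma>_bij])

text \<open>Double counting of the pairs of a transit and a band crossed by it: the time given up by
  the main segments is the time used by the transits.\<close>
lemma total_time: "time (2 * M) = 1"
proof -
  have "time (2 * M) = (\<Sum>k<M. (1 - \<delta> * crossings (\<sigma> k)) / real M + \<delta> * ((\<Sum>j<M. crosses k j) / real M))"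
    unfolding time_def sum_pairs duration_main duration_transit
    by (intro sum.cong refl) (simp only: lessThan_iff height_step)
  also have "\<dots> = (\<Sum>k<M. (1 - \<delta> * crossings (\<sigma> k)) / real M) + \<delta> / real M * (\<Sum>k<M. \<Sum>j<M. crosses k j)"
  proof -
    have "\<delta> * ((\<Sum>j<M. crosses k j) / real M) = \<delta> / real M * (\<Sum>j<M. crosses k j)" for k by simp
    then show ?thesis by (simp only: sum.distrib sum_distrib_left[symmetric])
  qed
  also have "(\<Sum>k<M. (1 - \<delta> * crossings (\<sigma> k)) / real M) = (\<Sum>j<M. (1 - \<delta> * crossings j) / real M)"
    by (rule sum_\<sigma>)
  also have "\<dots> = 1 - \<delta> / real M * (\<Sum>j<M. crossings j)"
    using M_pos by (simp add: sum_subtractf sum_distrib_left diff_divide_distrib flip: sum_divide_distrib)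
  also have "(\<Sum>j<M. crossings j) = (\<Sum>k<M. \<Sum>j<M. crosses k j)"
    unfolding crossings_def by (rule sum.swap)
  finally show ?thesis by simp
qed

sublocale breakpoints "2 * M" time height
proof
  fix i assume i: "i < 2 * M"
  show "time i \<le> time (Suc i)" using duration_nonneg by (simp add: time_Suc)
  assume "time i = time (Suc i)"
  then have "duration i = 0" by (simp add: time_Suc)
  then show "height i = height (Suc i)"
    using duration_main_pos[of "i div 2"] \<delta>_pos by (cases "even i") (auto simp: duration_def)
qed

abbreviation "g \<equiv> piecewise_affine (2 * M) time height"

lemma height_main: "k < M \<Longrightarrow> height (2 * k) = real (\<sigma> k) / real M" "k < M \<Longrightarrow> height (Suc (2 * k)) = real (Suc (\<sigma> k)) / real M"
  unfolding height_def by (simp_all only: level_main)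

lemma height_main_less: "k < M \<Longrightarrow> height (2 * k) < height (Suc (2 * k))"
  "k < M \<Longrightarrow> height (Suc (2 * k)) - height (2 * k) = 1 / real M"
  using M_pos by (simp_all only: height_main) (simp_all add: divide_strict_right_mono diff_divide_distrib[symmetric])

text \<open>Inside the band \<open>j\<close> the density is \<open>1 - \<delta> * crossings j\<close> from the main segment and \<open>\<delta>\<close> from each of
  the crossing transits.\<close>
lemma shuffle_in_C_lambda: "restrict g {0..1} \<in> mspace C_lambda"
proof (rule piecewise_affine_in_C_lambda[OF breakpoints_axioms _ total_time])
  show "time 0 = 0" by (simp add: time_def)
  show "height i \<noteq> height (Suc i)" if "i < 2 * M" "time i < time (Suc i)" for i
  proof (cases "even i")
    case True
    then obtain k where "i = 2 * k" by blast
    then show ?thesis using height_main_less(1)[of k] that(1) by simp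
  next
    case False
    then show ?thesis using that by (auto simp: time_Suc duration_def)
  qed
  show "height i \<in> {0..1}" if "i \<le> 2 * M" for i
    using level_le[OF that] M_pos by (simp add: height_def)
  let ?s = "\<lambda>i. (time (Suc i) - time i) / \<bar>height (Suc i) - height i\<bar>"
  let ?J = "\<lambda>i. {min (height i) (height (Suc i))..max (height i) (height (Suc i))}"
  show "AE y in lborel. y \<in> {0..1} \<longrightarrow> (\<Sum>i<2 * M. ?s i * indicator (?J i) y) = 1"
    using AE_off_grid[of M]
  proof (eventually_elim, intro impI)
    fix y :: real assume off: "\<forall>j\<le>M. y \<noteq> real j / real M" and y: "y \<in> {0..1}"
    obtain b where b: "b < M" "\<And>a. a < M \<Longrightarrow> y \<in> {real a / real M..real (Suc a) / real M} \<longleftrightarrow> a = b"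
      using obtain_unique_band[OF M_pos y] off by blast
    have yb: "real b / real M < y" "y < real (Suc b) / real M"
    proof -
      have "y \<in> {real b / real M..real (Suc b) / real M}" using b by blast
      moreover have "y \<noteq> real b / real M" "y \<noteq> real (Suc b) / real M" using off[rule_format, of b] off[rule_format, of "Suc b"] b(1)
        by (simp_all del: of_nat_Suc)
      ultimately show "real b / real M < y" "y < real (Suc b) / real M" by auto
    qed
    have lo: "real a / real M \<le> y \<longleftrightarrow> a \<le> b" for a
    proof
      assume "real a / real M \<le> y"
      then have "real a / real M < real (Suc b) / real M" using yb by linarith
      then show "a \<le> b" using M_pos by (simp add: divide_less_cancel)
    next
      assume "a \<le> b"
      then have "real a / real M \<le> real b / real M" by (intro divide_right_mono) auto
      then show "real a / real M \<le> y" using yb by linarith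
    qed
    have hi: "y \<le> real a / real M \<longleftrightarrow> b < a" for a
    proof
      assume "y \<le> real a / real M"
      then have "real b / real M < real a / real M" using yb by linarith
      then show "b < a" using M_pos by (simp add: divide_less_cancel)
    next
      assume "b < a"
      then have "real (Suc b) / real M \<le> real a / real M" by (intro divide_right_mono) auto
      then show "y \<le> real a / real M" using yb by linarith
    qed
    have J: "y \<in> ?J i \<longleftrightarrow> min (level i) (level (Suc i)) \<le> b \<and> b < max (level i) (level (Suc i))" for i
      unfolding height_def atLeastAtMost_iff min_le_iff_disj le_max_iff_disj lo hi by linarith
    have main: "?s (2 * k) * indicator (?J (2 * k)) y = (1 - \<delta> * crossings (\<sigma> k)) * of_bool (\<sigma> k = b)" if k: "k < M" for k
    proof -
      have "?s (2 * k) = 1 - \<delta> * crossings (\<sigma> k)"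
        using height_main_less(2)[OF k] M_pos by (simp add: time_Suc duration_main)
      moreover have "y \<in> ?J (2 * k) \<longleftrightarrow> \<sigma> k = b"
        unfolding J using level_main[OF k] by auto
      ultimately show ?thesis by (simp add: indicator_def of_bool_def)
    qed
    have transit: "?s (Suc (2 * k)) * indicator (?J (Suc (2 * k))) y = \<delta> * crosses k b" if k: "k < M" for k
    proof (cases "crosses k b = 0")
      case True
      then have "y \<notin> ?J (Suc (2 * k))" unfolding J crosses_def by auto
      then show ?thesis using True by simp
    next
      case False
      then have cr: "crosses k b = 1" by (simp add: crosses_def of_bool_def split: if_splits)
      then have "y \<in> ?J (Suc (2 * k))" unfolding J by (simp add: crosses_def of_bool_def split: if_splits)
      moreover have "level (Suc (2 * k)) \<noteq> level (Suc (Suc (2 * k)))" using cr by (auto simp: crosses_def of_bool_def split: if_splits)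
      then have "height (Suc (Suc (2 * k))) \<noteq> height (Suc (2 * k))" using M_pos by (simp add: height_def)
      then have "?s (Suc (2 * k)) = \<delta>" by (simp add: time_Suc duration_def)
      ultimately show ?thesis using cr by simp
    qed
    have "(\<Sum>i<2 * M. ?s i * indicator (?J i) y) = (\<Sum>k<M. (1 - \<delta> * crossings (\<sigma> k)) * of_bool (\<sigma> k = b) + \<delta> * crosses k b)"
      unfolding sum_pairs by (intro sum.cong refl) (simp only: main transit lessThan_iff)
    also have "\<dots> = (\<Sum>k<M. (1 - \<delta> * crossings (\<sigma> k)) * of_bool (\<sigma> k = b)) + \<delta> * crossings b"
      by (simp add: sum.distrib crossings_def sum_distrib_left)
    also have "(\<Sum>k<M. (1 - \<delta> * crossings (\<sigma> k)) * of_bool (\<sigma> k = b)) = (\<Sum>j<M. (1 - \<delta> * crossings j) * of_bool (j = b))"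
      by (rule sum_\<sigma>)
    also have "\<dots> = 1 - \<delta> * crossings b" using b(1) by (simp add: of_bool_def if_distrib cong: if_cong)
    finally show "(\<Sum>i<2 * M. ?s i * indicator (?J i) y) = 1" by simp
  qed
qed

lemma duration_pair_near: "k < M \<Longrightarrow> \<bar>duration (2 * k) + duration (Suc (2 * k)) - 1 / real M\<bar> \<le> \<delta>"
proof -
  assume k: "k < M"
  have "(\<Sum>j<M. crosses k j) \<le> (\<Sum>j<M. 1)" by (intro sum_mono) (simp add: crosses_def)
  then have s: "0 \<le> (\<Sum>j<M. crosses k j) / real M" "(\<Sum>j<M. crosses k j) / real M \<le> 1"
    using M_pos by (auto simp: crosses_def intro!: divide_nonneg_nonneg sum_nonneg)
  have c: "0 \<le> crossings (\<sigma> k) / real M" "crossings (\<sigma> k) / real M \<le> 1"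
    using crossings_bounds[of "\<sigma> k"] M_pos by auto
  have "duration (2 * k) + duration (Suc (2 * k)) - 1 / real M =
    \<delta> * ((\<Sum>j<M. crosses k j) / real M - crossings (\<sigma> k) / real M)"
    unfolding duration_main duration_transit height_step[OF k] by (simp add: algebra_simps diff_divide_distrib)
  also have "\<bar>\<dots>\<bar> \<le> \<delta> * 1"
    unfolding abs_mult using s c \<delta>_pos by (intro mult_mono) auto
  finally show ?thesis by simp
qed

text \<open>The main segment \<open>k\<close> with the following transit has almost the length \<open>1 / M\<close>, so the shuffle runs
  through the intervals of the domain nearly on schedule.\<close>
lemma time_near: "k \<le> M \<Longrightarrow> \<bar>time (2 * k) - real k / real M\<bar> \<le> real k * \<delta>"
proof (induction k)
  case (Suc k)
  have "time (2 * Suc k) = time (2 * k) + (duration (2 * k) + duration (Suc (2 * k)))"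
    by (simp add: time_Suc)
  moreover have "real (Suc k) / real M = real k / real M + 1 / real M" by (simp add: add_divide_distrib)
  moreover have "real (Suc k) * \<delta> = real k * \<delta> + \<delta>" by (simp add: algebra_simps)
  ultimately show ?case using Suc.IH Suc.prems duration_pair_near[of k] by linarith
qed (simp add: time_def)

text \<open>At any time the shuffle is between two consecutive breakpoints. Their heights are the ends of the
  bands \<open>\<sigma> k\<close> and \<open>\<sigma> (k + 1)\<close>, which \<open>f\<close> visits at times not further than \<open>3 / M\<close> away.\<close>
lemma shuffle_close:
  assumes osc: "\<And>x y. x \<in> {0..1} \<Longrightarrow> y \<in> {0..1} \<Longrightarrow> \<bar>x - y\<bar> \<le> 3 / real M \<Longrightarrow> \<bar>f x - f y\<bar> \<le> \<eta>"
    and match: "\<And>k. k < M \<Longrightarrow> \<exists>x\<in>{real k / real M..real (Suc k) / real M}.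
      f x \<in> {real (\<sigma> k) / real M..real (Suc (\<sigma> k)) / real M}"
    and small: "\<delta> * real M * real M \<le> 1" and x: "x \<in> {0..1}"
  shows "\<bar>f x - g x\<bar> \<le> \<eta> + 1 / real M"
proof -
  obtain i where i: "i < 2 * M" "time i \<le> x" "x \<le> time (Suc i)" "time i < time (Suc i)"
  proof (cases "x = 0")
    case True
    show ?thesis
      using that[of 0] M_pos True duration_main_pos[of 0] by (simp add: time_def)
  next
    case False
    moreover have "time 0 = 0" by (simp add: time_def)
    ultimately obtain i where "i < 2 * M" "time i < x" "x \<le> time (Suc i)"
      using in_segment[of x] x total_time by auto
    then show ?thesis using that[of i] by simp
  qed
  define k where "k = i div 2"
  have k: "k < M" using i(1) by (simp add: k_def)
  have ik: "i = 2 * k \<or> i = Suc (2 * k)" unfolding k_def by presburger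
  have "time (2 * k) \<le> time i" "time (Suc i) \<le> time (2 * Suc k)"
    using ik k by (auto intro!: mono_le)
  then have t: "time (2 * k) \<le> x" "x \<le> time (2 * Suc k)" using i by auto
  have M1: "real M * \<delta> \<le> 1 / real M" using small M_pos by (simp add: field_simps)
  have kd: "real k * \<delta> \<le> real M * \<delta>" "real (Suc k) * \<delta> \<le> real M * \<delta>"
    using k \<delta>_pos by (intro mult_right_mono; simp)+
  have lo: "real k / real M - 1 / real M \<le> x" using time_near[of k] t(1) kd M1 k by linarith
  have up: "x \<le> real (Suc k) / real M + 1 / real M" using time_near[of "Suc k"] t(2) kd M1 k by linarith
  have width: "real (Suc j) / real M = real j / real M + 1 / real M" for j by (simp add: add_divide_distrib)
  have three: "3 / real M = 1 / real M + 1 / real M + 1 / real M" by (simp add: add_divide_distrib[symmetric])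
  have near: "\<bar>h - f x\<bar> \<le> \<eta> + 1 / real M"
    if j: "j < M" "j = k \<or> j = Suc k" and h: "h = real (\<sigma> j) / real M \<or> h = real (Suc (\<sigma> j)) / real M" for j h
  proof -
    obtain z where z: "z \<in> {real j / real M..real (Suc j) / real M}"
      "f z \<in> {real (\<sigma> j) / real M..real (Suc (\<sigma> j)) / real M}" using match[OF j(1)] by blast
    have "real (Suc j) / real M \<le> 1" "0 \<le> real j / real M" using j(1) by auto
    then have z01: "z \<in> {0..1}" using z(1) unfolding atLeastAtMost_iff by linarith
    have "\<bar>x - z\<bar> \<le> 3 / real M"
      using z(1) lo up j(2) width[of k] width[of "Suc k"] unfolding three atLeastAtMost_iff abs_le_iff by auto
    then have "\<bar>f x - f z\<bar> \<le> \<eta>" by (rule osc[OF x z01])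
    moreover have "\<bar>h - f z\<bar> \<le> 1 / real M" using h z(2) width[of "\<sigma> j"] unfolding atLeastAtMost_iff abs_le_iff by auto
    ultimately show ?thesis by linarith
  qed
  have "\<bar>height i - f x\<bar> \<le> \<eta> + 1 / real M"
    using ik height_main[OF k] by (intro near[of k] k) auto
  moreover have "\<bar>height (Suc i) - f x\<bar> \<le> \<eta> + 1 / real M"
  proof (cases "i = 2 * k")
    case True
    then show ?thesis using height_main[OF k] by (intro near[of k] k) auto
  next
    case False
    then have si: "Suc i = 2 * Suc k" using ik by auto
    show ?thesis
    proof (cases "Suc k < M")
      case True
      then show ?thesis using height_main(1)[OF True] unfolding si by (intro near[of "Suc k"]) auto
    next
      case False
      then have "Suc k = M" "M - 1 = k" using k by simp_all
      then have "height (Suc i) = real (Suc (\<sigma> k)) / real M"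
        unfolding si by (simp add: height_def level_def)
      then show ?thesis by (intro near[of k] k) auto
    qed
  qed
  moreover have "g x \<in> {min (height i) (height (Suc i))..max (height i) (height (Suc i))}"
    by (rule piecewise_affine_between[OF i])
  ultimately show ?thesis unfolding atLeastAtMost_iff by linarith
qed

definition main_interval :: "nat \<Rightarrow> real set" where
  "main_interval k = {time (2 * k)<..<time (Suc (2 * k))}"

lemma main_interval_less: "k < l \<Longrightarrow> l < M \<Longrightarrow> x \<in> main_interval k \<Longrightarrow> y \<in> main_interval l \<Longrightarrow> x < y"
proof -
  assume "k < l" "l < M" "x \<in> main_interval k" "y \<in> main_interval l"
  then show "x < y" using mono_le[of "Suc (2 * k)" "2 * l"] by (auto simp: main_interval_def)
qed

lemma main_interval_subset: "k < M \<Longrightarrow> main_interval k \<subseteq> {0..1}"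
proof
  fix x assume "k < M" "x \<in> main_interval k"
  moreover have "time 0 = 0" by (simp add: time_def)
  ultimately show "x \<in> {0..1}"
    using mono_le[of 0 "2 * k"] mono_le[of "Suc (2 * k)" "2 * M"] total_time by (auto simp: main_interval_def)
qed

text \<open>Every main segment gives up at most the time \<open>\<delta>\<close>, as no more than \<open>M\<close> transits cross its band.\<close>
lemma off_main_measure:
  "{0..1} - (\<Union>k<M. main_interval k) \<in> sets unit_lebesgue"
  "measure unit_lebesgue ({0..1} - (\<Union>k<M. main_interval k)) \<le> \<delta> * real M"
proof -
  interpret U: prob_space unit_lebesgue by (rule prob_space_unit_lebesgue)
  have s: "main_interval k \<in> sets unit_lebesgue" if "k < M" for k
    using main_interval_subset[OF that] by (simp add: sets_unit_lebesgue_iff main_interval_def)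
  then have A: "(\<Union>k<M. main_interval k) \<in> sets unit_lebesgue" by (intro sets.finite_UN) auto
  show "{0..1} - (\<Union>k<M. main_interval k) \<in> sets unit_lebesgue"
    using sets.compl_sets[OF A] by simp
  have d: "disjoint_family_on main_interval {..<M}"
    unfolding disjoint_family_on_def
  proof (intro ballI impI)
    fix k l assume "k \<in> {..<M}" "l \<in> {..<M}" "k \<noteq> l"
    then show "main_interval k \<inter> main_interval l = {}"
      using main_interval_less[of k l] main_interval_less[of l k] by (cases "k < l") fastforce+
  qed
  have m: "U.prob (main_interval k) = duration (2 * k)" if "k < M" for k
  proof -
    have "emeasure unit_lebesgue (main_interval k) = emeasure lborel (main_interval k)"
      using s[OF that] by (intro emeasure_unit_lebesgue) (auto simp: sets_unit_lebesgue_iff)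
    also have "\<dots> = ennreal (duration (2 * k))"
      using duration_nonneg[of "2 * k"] by (simp add: main_interval_def time_Suc)
    finally show ?thesis using duration_nonneg[of "2 * k"] by (simp add: U.emeasure_eq_measure)
  qed
  have "U.prob (\<Union>k<M. main_interval k) = (\<Sum>k<M. duration (2 * k))"
    using U.finite_measure_finite_Union[OF finite_lessThan _ d] s m by (simp add: image_subset_iff)
  also have "\<dots> \<ge> (\<Sum>k<M. (1 - \<delta> * real M) / real M)"
    unfolding duration_main using \<delta>_pos crossings_bounds
    by (intro sum_mono divide_right_mono diff_left_mono mult_left_mono) auto
  also have "(\<Sum>k<M. (1 - \<delta> * real M) / real M) = 1 - \<delta> * real M" using M_pos by simp
  finally have "1 - \<delta> * real M \<le> U.prob (\<Union>k<M. main_interval k)" .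
  then show "measure unit_lebesgue ({0..1} - (\<Union>k<M. main_interval k)) \<le> \<delta> * real M"
    using U.prob_compl[OF A] by simp
qed

lemma g_main_interval:
  assumes k: "k < M" and x: "x \<in> main_interval k"
  shows "g x = real (\<sigma> k) / real M + 1 / real M * ((x - time (2 * k)) / duration (2 * k))"
    and "real (\<sigma> k) / real M < g x" and "g x < real (Suc (\<sigma> k)) / real M"
proof -
  have D: "duration (2 * k) > 0" by (rule duration_main_pos)
  have xs: "time (2 * k) < x" "x < time (Suc (2 * k))" using x by (auto simp: main_interval_def)
  show eq: "g x = real (\<sigma> k) / real M + 1 / real M * ((x - time (2 * k)) / duration (2 * k))"
    using piecewise_affine_segment[of "2 * k" x] k xs D height_main(1)[OF k] height_main_less(2)[OF k]
    by (simp add: time_Suc)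
  have u: "0 < (x - time (2 * k)) / duration (2 * k)" "(x - time (2 * k)) / duration (2 * k) < 1"
    using xs D by (auto simp: time_Suc divide_less_eq)
  have "0 < 1 / real M * ((x - time (2 * k)) / duration (2 * k))"
    using u M_pos by (intro mult_pos_pos) auto
  moreover have "1 / real M * ((x - time (2 * k)) / duration (2 * k)) < 1 / real M * 1"
    using u M_pos by (intro mult_strict_left_mono) auto
  moreover have "real (Suc (\<sigma> k)) / real M = real (\<sigma> k) / real M + 1 / real M" by (simp add: add_divide_distrib)
  ultimately show "real (\<sigma> k) / real M < g x" "g x < real (Suc (\<sigma> k)) / real M" unfolding eq by linarith+
qed

lemma follows_bands_main:
  assumes "\<And>i. i \<in> {1..n} \<Longrightarrow> b i < M \<and> x i \<in> main_interval (b i)"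
  shows "follows_bands n M \<sigma> (\<lambda>i. (x i, g (x i))) b"
  unfolding follows_bands_def fst_conv snd_conv
proof (intro conjI ballI impI)
  fix i j assume ij: "i \<in> {1..n}" "j \<in> {1..n}"
  note i = assms[OF ij(1)] and j = assms[OF ij(2)]
  show "x i < x j" if "b i < b j" using main_interval_less[OF that] i j by blast
  show "g (x i) < g (x j)" if "\<sigma> (b i) < \<sigma> (b j)"
  proof -
    have "real (Suc (\<sigma> (b i))) / real M \<le> real (\<sigma> (b j)) / real M"
      using that by (intro divide_right_mono) auto
    then show ?thesis using g_main_interval(3)[of "b i" "x i"] g_main_interval(2)[of "b j" "x j"] i j by auto
  qed
  show "x i < x j \<longleftrightarrow> g (x i) < g (x j)" if "b i = b j"
  proof -
    define D where "D = real M * duration (2 * b j)"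
    have "D > 0" using M_pos duration_main_pos[of "b j"] by (simp add: D_def)
    moreover have "g (x l) = real (\<sigma> (b j)) / real M + (x l - time (2 * b j)) / D" if "l = i \<or> l = j" for l
      using g_main_interval(1)[of "b l" "x l"] i j that \<open>b i = b j\<close> by (auto simp: D_def)
    ultimately show ?thesis by (simp add: divide_less_cancel)
  qed
qed (use assms in blast)

text \<open>Unless one of the \<open>n\<close> points is on a transit, the pattern is one of the at most \<open>(n + 1) ^ M\<close>
  patterns that are determined by the counts.\<close>
lemma shuffle_entropy_le:
  "permuton_entropy n (map_permuton (restrict g {0..1}))
    \<le> real M * ln (real n + 1) + real n * (\<delta> * real M) * ln (fact n) + 1"
proof -
  let ?h = "restrict g {0..1}"
  let ?P = "sample_space n"
  interpret P: prob_space ?P by (rule prob_space_sample_space)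
  interpret PP: product_prob_space "\<lambda>_. unit_lebesgue" "{1..n}"
    by (intro product_prob_spaceI prob_space_unit_lebesgue)
  let ?S = "{\<pi>. \<pi> permutes {1..n}}"
  define Q where "Q = {pattern n \<omega> | \<omega> b. follows_bands n M \<sigma> \<omega> b}"
  have finS: "finite ?S" by (intro finite_permutations) simp
  have QS: "Q \<subseteq> ?S" unfolding Q_def using pattern_permutes by blast
  have "follows_bands n M \<sigma> (\<lambda>i. (x0, g x0)) (\<lambda>_. 0)" if "x0 \<in> main_interval 0" for x0
    using follows_bands_main[of n "\<lambda>_. 0" "\<lambda>_. x0"] that M_pos by auto
  moreover obtain x0 where "x0 \<in> main_interval 0"
  proof -
    have "time (2 * 0) < time (Suc (2 * 0))" using duration_main_pos[of 0] by (simp add: time_Suc)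
    from dense[OF this] show ?thesis using that by (auto simp: main_interval_def)
  qed
  ultimately have Q_ne: "Q \<noteq> {}" unfolding Q_def by blast
  have cQ: "card Q \<le> (n + 1) ^ M"
    unfolding Q_def by (rule card_band_patterns_le[OF bij_betw_imp_inj_on[OF \<sigma>_bij]])
  have finQ: "finite Q" using QS finS by (rule finite_subset)
  have cQ1: "card Q > 0" using finQ Q_ne by (simp add: card_gt_0_iff)
  let ?B = "{0..1} - (\<Union>k<M. main_interval k)"
  let ?E = "\<lambda>i. {x \<in> space ?P. x i \<in> ?B}"
  have Em: "?E i \<in> sets ?P" "P.prob (?E i) \<le> \<delta> * real M" if "i \<in> {1..n}" for i
  proof -
    show "?E i \<in> sets ?P"
      using measurable_sets[OF measurable_component_singleton[OF that] off_main_measure(1)]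
      by (simp add: vimage_def Int_def conj_commute)
    have "emeasure ?P (?E i) = emeasure unit_lebesgue ?B"
      by (rule PP.emeasure_PiM_Collect_single[OF that off_main_measure(1)])
    then have "P.prob (?E i) = measure unit_lebesgue ?B" by (simp add: measure_def)
    then show "P.prob (?E i) \<le> \<delta> * real M" using off_main_measure(2) by simp
  qed
  have sub: "{x \<in> space ?P. pattern n (\<lambda>i. (x i, ?h (x i))) \<in> ?S - Q} \<subseteq> (\<Union>i\<in>{1..n}. ?E i)"
  proof
    fix x assume x: "x \<in> {x \<in> space ?P. pattern n (\<lambda>i. (x i, ?h (x i))) \<in> ?S - Q}"
    show "x \<in> (\<Union>i\<in>{1..n}. ?E i)"
    proof (rule ccontr)
      assume "x \<notin> (\<Union>i\<in>{1..n}. ?E i)"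
      moreover have x01: "x i \<in> {0..1}" if "i \<in> {1..n}" for i
        using x that by (auto simp: space_PiM PiE_iff)
      ultimately have "\<exists>k<M. x i \<in> main_interval k" if "i \<in> {1..n}" for i
        using x that by blast
      then obtain b where b: "\<And>i. i \<in> {1..n} \<Longrightarrow> b i < M \<and> x i \<in> main_interval (b i)" by metis
      have "pattern n (\<lambda>i. (x i, ?h (x i))) = pattern n (\<lambda>i. (x i, g (x i)))"
        using x01 by (intro pattern_cong_order) (simp_all only: restrict_apply' snd_conv fst_conv)
      also have "\<dots> \<in> Q" unfolding Q_def using follows_bands_main[of n b x, OF b] by blast
      finally show False using x by blast
    qed
  qed
  have "(\<Sum>\<pi>\<in>?S - Q. pattern_prob ?h n \<pi>) = P.prob {x \<in> space ?P. pattern n (\<lambda>i. (x i, ?h (x i))) \<in> ?S - Q}"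
    using finS by (intro sum_pattern_prob shuffle_in_C_lambda) auto
  also have "\<dots> \<le> P.prob (\<Union>i\<in>{1..n}. ?E i)"
    using Em by (intro P.finite_measure_mono sub sets.finite_UN) auto
  also have "\<dots> \<le> (\<Sum>i\<in>{1..n}. P.prob (?E i))"
    using Em by (intro P.finite_measure_subadditive_finite) auto
  also have "\<dots> \<le> (\<Sum>i\<in>{1..n}. \<delta> * real M)" by (intro sum_mono Em)
  also have "\<dots> = real n * (\<delta> * real M)" by simp
  finally have rest: "(\<Sum>\<pi>\<in>?S - Q. pattern_prob ?h n \<pi>) \<le> real n * (\<delta> * real M)" .
  have cS: "card ?S = fact n" by (intro card_permutations) auto
  have "permuton_entropy n (map_permuton ?h) \<le>
      ln (real (card Q)) + (\<Sum>\<pi>\<in>?S - Q. pattern_prob ?h n \<pi>) * ln (real (card ?S)) + 1"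
    unfolding permuton_entropy_map_permuton[OF shuffle_in_C_lambda]
    by (intro entropy_le_concentrated finS QS Q_ne pattern_prob_nonneg sum_pattern_prob_permutes shuffle_in_C_lambda)
  also have "\<dots> \<le> real M * ln (real n + 1) + real n * (\<delta> * real M) * ln (fact n) + 1"
  proof (intro add_mono order_refl)
    have "ln (real (card Q)) \<le> ln (real ((n + 1) ^ M))"
      using cQ cQ1 by (subst ln_le_cancel_iff) (simp_all only: of_nat_0_less_iff of_nat_le_iff zero_less_power zero_less_Suc Suc_eq_plus1[symmetric])
    also have "\<dots> = real M * ln (real n + 1)" by (simp add: ln_realpow add.commute)
    finally show "ln (real (card Q)) \<le> real M * ln (real n + 1)" .
    show "(\<Sum>\<pi>\<in>?S - Q. pattern_prob ?h n \<pi>) * ln (real (card ?S)) \<le> real n * (\<delta> * real M) * ln (fact n)"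
      unfolding cS of_nat_fact by (intro mult_right_mono rest ln_ge_zero) simp
  qed
  finally show ?thesis .
qed

end

section \<open>Maps with few patterns\<close>

text \<open>The band number \<open>M\<close> is chosen from the modulus of continuity of \<open>f\<close>, then \<open>n\<close> so large that
  \<open>M * ln (n + 1)\<close> is small against \<open>\<epsilon> * n\<close>, and finally \<open>\<delta>\<close> so small that points on
  transits do not matter for this \<open>n\<close>.\<close>
lemma dense_low_entropy:
  assumes f: "f \<in> mspace C_lambda" and e: "e > 0" and \<epsilon>: "\<epsilon> > 0"
  shows "\<exists>g\<in>mspace C_lambda. mdist C_lambda f g < e \<and>
    (\<exists>n\<ge>n0. permuton_entropy n (map_permuton g) < \<epsilon> * real n)"
proof -
  have "uniformly_continuous_on {0..1} f"
    using C_lambdaD(1)[OF f] by (intro compact_uniformly_continuous) auto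
  then obtain d where d: "d > 0" "\<And>x y. x \<in> {0..1} \<Longrightarrow> y \<in> {0..1} \<Longrightarrow> \<bar>y - x\<bar> < d \<Longrightarrow> \<bar>f y - f x\<bar> < e / 4"
    using e unfolding uniformly_continuous_on_def dist_real_def by (metis zero_less_divide_iff zero_less_numeral)
  obtain M where M: "M > 0" "1 / real M < min (d / 3) (e / 4)"
    using reals_Archimedean[of "min (d / 3) (e / 4)"] d(1) e
    by (metis inverse_eq_divide zero_less_Suc min_less_iff_conj zero_less_divide_iff zero_less_numeral)
  obtain \<sigma> where \<sigma>: "bij_betw \<sigma> {..<M} {..<M}"
    "\<And>k. k < M \<Longrightarrow> \<exists>x\<in>{real k / real M..real (Suc k) / real M}. f x \<in> {real (\<sigma> k) / real M..real (Suc (\<sigma> k)) / real M}"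
    using band_matching[OF f M(1)] by metis
  obtain n where n: "n \<ge> n0" "real M * ln (real n + 1) + 2 < \<epsilon> * real n"
  proof -
    \<comment> \<open>With \<open>s = sqrt (n + 1)\<close> and \<open>ln (n + 1) \<le> 2 * s\<close>, it suffices that \<open>2 * M * s + 2 < \<epsilon> * (s\<^sup>2 - 1)\<close>,
      which holds for \<open>s > r\<close>.\<close>
    define r where "r = (2 * real M + 2 + \<epsilon>) / \<epsilon>"
    obtain n1 where n1: "real n1 > r\<^sup>2" using reals_Archimedean2 by blast
    define n where "n = max n0 n1"
    define s where "s = sqrt (real n + 1)"
    have s2: "s\<^sup>2 = real n + 1" by (simp add: s_def)
    have s1: "s \<ge> 1" by (simp add: s_def)
    have "r\<^sup>2 < s\<^sup>2" using n1 unfolding s2 n_def by simp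
    then have "r < s" using s1 by (rule power2_less_imp_less[OF _ order_trans[OF zero_le_one]])
    then have "2 * real M + 2 + \<epsilon> < \<epsilon> * s" using \<epsilon> unfolding r_def by (simp add: pos_divide_less_eq mult.commute)
    then have "s * (2 * real M + 2 + \<epsilon>) < s * (\<epsilon> * s)" using s1 by (intro mult_strict_left_mono) auto
    moreover have "1 * (2 + \<epsilon>) \<le> s * (2 + \<epsilon>)" using s1 \<epsilon> by (intro mult_right_mono) auto
    moreover have "s * (\<epsilon> * s) = \<epsilon> * (real n + 1)" using s2 by (simp add: power2_eq_square)
    ultimately have 1: "2 * real M * s + 2 < \<epsilon> * real n" by (simp add: algebra_simps)
    have "ln (real n + 1) = 2 * ln s" unfolding s2[symmetric] using s1 by (simp add: ln_realpow)
    also have "\<dots> \<le> 2 * s" using s1 by (simp add: ln_bound)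
    finally have "real M * ln (real n + 1) \<le> real M * (2 * s)" by (intro mult_left_mono) auto
    then have "real M * ln (real n + 1) + 2 < \<epsilon> * real n" using 1 by simp
    then show ?thesis using that[of n] by (simp add: n_def)
  qed
  \<comment> \<open>The constant \<open>D\<close> makes \<open>\<delta> * M * n * ln (fact n)\<close>, the cost of the exceptional event, at most \<open>1\<close>.\<close>
  define D where "D = 1 + real n * ln (fact n)"
  have nL: "0 \<le> real n * ln (fact n :: real)" by (intro mult_nonneg_nonneg ln_ge_zero) auto
  then have D: "D \<ge> 1" by (simp add: D_def)
  define \<delta> where "\<delta> = 1 / (2 * real M * real M * D)"
  have M1: "real M \<ge> 1" using M(1) by simp
  have \<delta>: "\<delta> > 0" using M(1) D by (simp add: \<delta>_def)
  have dMM: "\<delta> * real M * real M = 1 / (2 * D)" using M(1) by (simp add: \<delta>_def)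
  have dMM1: "\<delta> * real M * real M \<le> 1 / 2" unfolding dMM using D by (simp add: field_simps)
  have dM: "\<delta> * real M \<le> \<delta> * real M * real M" using mult_left_mono[OF M1, of "\<delta> * real M"] \<delta> by simp
  have dM1: "\<delta> * real M < 1" using dM dMM1 by linarith
  interpret band_shuffle M \<sigma> \<delta>
    by unfold_locales (use M(1) \<sigma>(1) \<delta> dM1 in auto)
  let ?g = "restrict (piecewise_affine (2 * M) time height) {0..1}"
  have osc: "\<bar>f x - f y\<bar> \<le> e / 4" if "x \<in> {0..1}" "y \<in> {0..1}" "\<bar>x - y\<bar> \<le> 3 / real M" for x y
  proof -
    have "3 / real M < d" using M(2) by simp
    then show ?thesis using d(2)[OF that(2,1)] that(3) by linarith
  qed
  have "\<bar>f x - ?g x\<bar> \<le> e / 2" if "x \<in> {0..1}" for x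
    using shuffle_close[OF osc \<sigma>(2) _ that] dMM1 M(2) that by auto
  then have "mdist C_lambda f ?g \<le> e / 2" using mdist_C_lambda_le[OF f shuffle_in_C_lambda] by blast
  then have "mdist C_lambda f ?g < e" using e by linarith
  moreover have "permuton_entropy n (map_permuton ?g) < \<epsilon> * real n"
  proof -
    have "real n * (\<delta> * real M) * ln (fact n) = (\<delta> * real M) * (real n * ln (fact n))" by simp
    also have "\<dots> \<le> 1 / (2 * D) * (real n * ln (fact n))" using dM nL unfolding dMM by (intro mult_right_mono) auto
    also have "\<dots> \<le> 1 / (2 * D) * (2 * D)" using D nL by (intro mult_left_mono) (auto simp: D_def)
    also have "\<dots> = 1" using D by simp
    finally show ?thesis using shuffle_entropy_le[of n] n(2) by linarith
  qed
  ultimately show ?thesis using shuffle_in_C_lambda n(1) by blast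
qed

section \<open>Genericity\<close>

lemma comeager_in_Inter_open_dense:
  assumes "countable \<U>" "\<And>U. U \<in> \<U> \<Longrightarrow> openin X U" "\<And>U. U \<in> \<U> \<Longrightarrow> X closure_of U = topspace X"
  shows "comeager_in X (topspace X \<inter> \<Inter>\<U>)"
  unfolding comeager_in_def meager_in_def
proof (intro conjI exI ballI)
  let ?N = "(\<lambda>U. topspace X - U) ` \<U>"
  show "countable ?N" using assms(1) by (rule countable_image)
  show "nowhere_dense_in X N" if N: "N \<in> ?N" for N
  proof -
    obtain U where U: "U \<in> \<U>" "N = topspace X - U" using N by blast
    have "closedin X N" using assms(2)[OF U(1)] U(2) by (simp add: closedin_def openin_subset double_diff)
    then show ?thesis
      using assms(3)[OF U(1)] U(2)
      by (simp add: nowhere_dense_in_def closure_of_closedin interior_of_complement)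
  qed
  show "topspace X - topspace X \<inter> \<Inter>\<U> = \<Union>?N" by blast
qed simp

lemma openin_C_lambdaI:
  assumes "U \<subseteq> mspace C_lambda"
    and "\<And>f. f \<in> U \<Longrightarrow> \<exists>d>0. \<forall>g\<in>mspace C_lambda. mdist C_lambda f g < d \<longrightarrow> g \<in> U"
  shows "openin (mtopology_of C_lambda) U"
proof -
  interpret C: Metric_space "mspace C_lambda" "mdist C_lambda" by simp
  have "\<exists>d>0. C.mball f d \<subseteq> U" if "f \<in> U" for f
    using assms(2)[OF that] by (meson C.in_mball subsetI)
  then show ?thesis
    using assms(1) by (simp add: mtopology_of_def C.openin_mtopology)
qed

lemma dense_in_C_lambdaI:
  assumes "\<And>f e. f \<in> mspace C_lambda \<Longrightarrow> e > 0 \<Longrightarrow> \<exists>g\<in>U. g \<in> mspace C_lambda \<and> mdist C_lambda f g < e"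
  shows "mtopology_of C_lambda closure_of U = topspace (mtopology_of C_lambda)"
proof -
  interpret C: Metric_space "mspace C_lambda" "mdist C_lambda" by simp
  have "C.mtopology closure_of U = mspace C_lambda"
    unfolding C.metric_closure_of using assms by auto
  then show ?thesis by (simp add: mtopology_of_def)
qed

lemma openin_entropy_less:
  "openin (mtopology_of C_lambda) {f \<in> mspace C_lambda. \<exists>n\<ge>n0. permuton_entropy n (map_permuton f) < c n}"
proof (rule openin_C_lambdaI)
  fix f assume "f \<in> {f \<in> mspace C_lambda. \<exists>n\<ge>n0. permuton_entropy n (map_permuton f) < c n}"
  then obtain n where f: "f \<in> mspace C_lambda" and n: "n \<ge> n0" "permuton_entropy n (map_permuton f) < c n" by blast
  obtain d where d: "d > 0" "\<And>g. g \<in> mspace C_lambda \<Longrightarrow> mdist C_lambda f g < d \<Longrightarrow>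
      \<bar>permuton_entropy n (map_permuton g) - permuton_entropy n (map_permuton f)\<bar> < c n - permuton_entropy n (map_permuton f)"
    using permuton_entropy_continuous[OF f, of "c n - permuton_entropy n (map_permuton f)" n] n(2) by auto
  have "permuton_entropy n (map_permuton g) < c n" if "g \<in> mspace C_lambda" "mdist C_lambda f g < d" for g
    using d(2)[OF that] by linarith
  then show "\<exists>d>0. \<forall>g\<in>mspace C_lambda. mdist C_lambda f g < d \<longrightarrow>
      g \<in> {f \<in> mspace C_lambda. \<exists>n\<ge>n0. permuton_entropy n (map_permuton f) < c n}"
    using d(1) n(1) by blast
qed blast

lemma openin_entropy_greater:
  "openin (mtopology_of C_lambda) {f \<in> mspace C_lambda. \<exists>n\<ge>n0. c n < permuton_entropy n (map_permuton f)}"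
proof (rule openin_C_lambdaI)
  fix f assume "f \<in> {f \<in> mspace C_lambda. \<exists>n\<ge>n0. c n < permuton_entropy n (map_permuton f)}"
  then obtain n where f: "f \<in> mspace C_lambda" and n: "n \<ge> n0" "c n < permuton_entropy n (map_permuton f)" by blast
  obtain d where d: "d > 0" "\<And>g. g \<in> mspace C_lambda \<Longrightarrow> mdist C_lambda f g < d \<Longrightarrow>
      \<bar>permuton_entropy n (map_permuton g) - permuton_entropy n (map_permuton f)\<bar> < permuton_entropy n (map_permuton f) - c n"
    using permuton_entropy_continuous[OF f, of "permuton_entropy n (map_permuton f) - c n" n] n(2) by auto
  have "c n < permuton_entropy n (map_permuton g)" if "g \<in> mspace C_lambda" "mdist C_lambda f g < d" for g
    using d(2)[OF that] by linarith
  then show "\<exists>d>0. \<forall>g\<in>mspace C_lambda. mdist C_lambda f g < d \<longrightarrow>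
      g \<in> {f \<in> mspace C_lambda. \<exists>n\<ge>n0. c n < permuton_entropy n (map_permuton f)}"
    using d(1) n(1) by blast
qed blast

lemma permuton_entropy_bounds:
  assumes "f \<in> mspace C_lambda"
  shows "0 \<le> permuton_entropy n (map_permuton f)"
    and "permuton_entropy n (map_permuton f) \<le> real n * ln (real n)"
proof -
  let ?S = "{\<pi>. \<pi> permutes {1..n}}"
  have fin: "finite ?S" by (intro finite_permutations) simp
  have card: "card ?S = fact n" by (intro card_permutations) auto
  have ne: "?S \<noteq> {}" using permutes_id by blast
  show "0 \<le> permuton_entropy n (map_permuton f)"
    unfolding permuton_entropy_map_permuton[OF assms]
    by (intro entropy_nonneg_finite fin pattern_prob_nonneg sum_pattern_prob_permutes assms)
  have "permuton_entropy n (map_permuton f) \<le> ln (real (card ?S))"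
    unfolding permuton_entropy_map_permuton[OF assms]
    by (intro entropy_le_ln_card fin ne pattern_prob_nonneg sum_pattern_prob_permutes assms)
  also have "\<dots> \<le> real n * ln (real n)"
  proof (cases "n = 0")
    case False
    have "ln (fact n :: real) \<le> ln (real (n ^ n))"
      using fact_le_power[of n, where 'a = real] False by (subst ln_le_cancel_iff) auto
    then show ?thesis using False unfolding card by (simp add: ln_realpow)
  qed (simp add: card)
  finally show "permuton_entropy n (map_permuton f) \<le> real n * ln (real n)" .
qed

lemma liminf_eq_0I:
  fixes a :: "nat \<Rightarrow> real"
  assumes nn: "\<And>n. 0 \<le> a n" and small: "\<And>k. \<exists>n\<ge>k. a n < 1 / real (Suc k)"
  shows "liminf (\<lambda>n. ereal (a n)) = 0"
proof (rule antisym)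
  show "0 \<le> liminf (\<lambda>n. ereal (a n))" using nn by (intro Liminf_bounded always_eventually) auto
  show "liminf (\<lambda>n. ereal (a n)) \<le> 0"
  proof (rule ccontr)
    assume "\<not> liminf (\<lambda>n. ereal (a n)) \<le> 0"
    then have "0 < liminf (\<lambda>n. ereal (a n))" by simp
    then obtain r where r: "0 < ereal r" "ereal r < liminf (\<lambda>n. ereal (a n))" using ereal_dense2 by blast
    from less_LiminfD[OF r(2)] obtain N where N: "\<And>n. n \<ge> N \<Longrightarrow> r < a n"
      by (auto simp: eventually_sequentially)
    obtain k where k: "1 / real (Suc k) < r"
      using reals_Archimedean[of r] r(1) by (auto simp: inverse_eq_divide)
    obtain n where n: "n \<ge> max k N" "a n < 1 / real (Suc (max k N))" using small by blast
    have "1 / real (Suc (max k N)) \<le> 1 / real (Suc k)" by (intro divide_left_mono) auto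
    then show False using N[of n] n k by simp
  qed
qed

lemma limsup_eq_1I:
  fixes b :: "nat \<Rightarrow> real"
  assumes le: "\<And>n. n \<ge> 2 \<Longrightarrow> b n \<le> 1" and large: "\<And>k. \<exists>n\<ge>k + 2. 1 - 1 / real (Suc k) < b n"
  shows "limsup (\<lambda>n. ereal (b n)) = 1"
proof (rule antisym)
  show "limsup (\<lambda>n. ereal (b n)) \<le> 1"
    using le by (intro Limsup_bounded) (auto simp: eventually_sequentially)
  show "1 \<le> limsup (\<lambda>n. ereal (b n))"
  proof (rule ccontr)
    assume "\<not> 1 \<le> limsup (\<lambda>n. ereal (b n))"
    then have "limsup (\<lambda>n. ereal (b n)) < 1" by simp
    then obtain r where r: "limsup (\<lambda>n. ereal (b n)) < ereal r" "ereal r < 1" using ereal_dense2 by blast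
    from Limsup_lessD[OF r(1)] obtain N where N: "\<And>n. n \<ge> N \<Longrightarrow> b n < r"
      by (auto simp: eventually_sequentially)
    have "r < 1" using r(2) by simp
    then obtain k where k: "1 / real (Suc k) < 1 - r"
      using reals_Archimedean[of "1 - r"] by (auto simp: inverse_eq_divide)
    obtain n where n: "n \<ge> max k N + 2" "1 - 1 / real (Suc (max k N)) < b n" using large by blast
    have "1 / real (Suc (max k N)) \<le> 1 / real (Suc k)" by (intro divide_left_mono) auto
    moreover have "N \<le> n" using n(1) by linarith
    ultimately show False using N[of n] n(2) k by linarith
  qed
qed

theorem theorem1p4:
  shows "\<exists>G. comeager_in (mtopology_of C_lambda) G \<and>
    (\<forall>f\<in>G. liminf (\<lambda>n. ereal (permuton_entropy n (map_permuton f) / real n)) = 0 \<and>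
           limsup (\<lambda>n. ereal (permuton_entropy n (map_permuton f) / (real n * ln (real n)))) = 1)"
proof -
  let ?H = "\<lambda>n f. permuton_entropy n (map_permuton f)"
  let ?C = "mtopology_of C_lambda"
  define U where "U k = {f \<in> mspace C_lambda. \<exists>n\<ge>Suc k. ?H n f < 1 / real (Suc k) * real n}" for k
  define V where "V k = {f \<in> mspace C_lambda. \<exists>n\<ge>k + 2. (1 - 1 / real (Suc k)) * (real n * ln (real n)) < ?H n f}" for k
  define \<U> where "\<U> = range U \<union> range V"
  have "openin ?C (U k)" "openin ?C (V k)" for k
    unfolding U_def V_def by (rule openin_entropy_less openin_entropy_greater)+
  then have "openin ?C W" if "W \<in> \<U>" for W
    using that unfolding \<U>_def by blast
  moreover have "?C closure_of W = topspace ?C" if "W \<in> \<U>" for W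
  proof (rule dense_in_C_lambdaI)
    fix f and e :: real assume f: "f \<in> mspace C_lambda" and e: "e > 0"
    have pos: "1 / real (Suc k) > 0" for k by simp
    from that consider k where "W = U k" | k where "W = V k" unfolding \<U>_def by blast
    then show "\<exists>g\<in>W. g \<in> mspace C_lambda \<and> mdist C_lambda f g < e"
    proof cases
      case (1 k)
      then show ?thesis using dense_low_entropy[OF f e pos[of k], of "Suc k"] unfolding U_def by blast
    next
      case (2 k)
      then show ?thesis using dense_high_entropy[OF f e pos[of k], of "k + 2"] unfolding V_def by blast
    qed
  qed
  ultimately have "comeager_in ?C (topspace ?C \<inter> \<Inter>\<U>)"
    by (intro comeager_in_Inter_open_dense) (auto simp: \<U>_def)
  moreover have "liminf (\<lambda>n. ereal (?H n f / real n)) = 0 \<and> limsup (\<lambda>n. ereal (?H n f / (real n * ln (real n)))) = 1"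
    if G: "f \<in> topspace ?C \<inter> \<Inter>\<U>" for f
  proof
    have f: "f \<in> mspace C_lambda" "\<And>k. f \<in> U k" "\<And>k. f \<in> V k" using G by (auto simp: \<U>_def)
    show "liminf (\<lambda>n. ereal (?H n f / real n)) = 0"
    proof (rule liminf_eq_0I)
      show "0 \<le> ?H n f / real n" for n using permuton_entropy_bounds(1)[OF f(1)] by simp
      fix k
      obtain n where n: "n \<ge> Suc k" "?H n f < 1 / real (Suc k) * real n" using f(2)[of k] unfolding U_def by blast
      then have "?H n f / real n < 1 / real (Suc k)" by (subst pos_divide_less_eq) auto
      then show "\<exists>n\<ge>k. ?H n f / real n < 1 / real (Suc k)" using n(1) by (intro exI[of _ n]) simp
    qed
    show "limsup (\<lambda>n. ereal (?H n f / (real n * ln (real n)))) = 1"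
    proof (rule limsup_eq_1I)
      have pos: "0 < real n * ln (real n)" if "n \<ge> 2" for n using that by (intro mult_pos_pos) auto
      show "?H n f / (real n * ln (real n)) \<le> 1" if "n \<ge> 2" for n
        using permuton_entropy_bounds(2)[OF f(1), of n] pos[OF that] by (simp add: divide_le_eq)
      fix k
      obtain n where n: "n \<ge> k + 2" "(1 - 1 / real (Suc k)) * (real n * ln (real n)) < ?H n f"
        using f(3)[of k] unfolding V_def by blast
      have "1 - 1 / real (Suc k) < ?H n f / (real n * ln (real n))"
        using n(2) pos[of n] n(1) by (subst pos_less_divide_eq) auto
      then show "\<exists>n\<ge>k + 2. 1 - 1 / real (Suc k) < ?H n f / (real n * ln (real n))" using n(1) by blast
    qed
  qed
  ultimately show ?thesis by blast
qed

end
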